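(* Suppose that for every $1\le i\le n$ the function $\kappa_i:(0,\infty)\to\mathbb{R}$ is continuous with $\liminf_{r\to\infty}\kappa_i(r)>0$ and $\lim_{r\to0}r\kappa_i(r)=0$, and suppose that there exist constants $\varepsilon_i\in[0,c_i)$, $1\le i\le n$, such that for any $x,y\in\mathbb{R}^d$, $$\sum_{i=1}^n|\gamma^i(x)-\gamma^i(y)|\,w_i\ \le\ \sum_{i=1}^n\varepsilon_i\,f_i(|x^i-y^i|)\,w_i .$$ Then for any $t\ge0$ and any probability measures $\mu,\nu$ on $\mathbb{R}^d$, $$W_{f,w}(\mu p_t,\nu p_t)\le e^{-ct}\,W_{f,w}(\mu,\nu)\qquad\text{and}\qquad W_{\ell^1}(\mu p_t,\nu p_t)\le A\,e^{-ct}\,W_{\ell^1}(\mu,\nu),$$ where $c=\min_{i=1,\dots,n}(c_i-\varepsilon_i)$ and $A=2\big/\min_{i=1,\dots,n}(\varphi_i(R_0^i)\,w_i)$.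
   Context: Setting. Let $d=\sum_{i=1}^n d_i$ with $n,d_1,\dots,d_n\in\mathbb{N}$, and write $x=(x^1,\dots,x^n)\in\mathbb{R}^d$ with $x^i\in\mathbb{R}^{d_i}$; $|\cdot|$ is the Euclidean norm. Consider the diffusion $X=(X^1,\dots,X^n)$ in $\mathbb{R}^d$ solving $$dX^i_t=b^i(X_t)\,dt+dB^i_t,\qquad i=1,\dots,n,$$ where $B^i$ are independent Brownian motions in $\mathbb{R}^{d_i}$, $b^i:\mathbb{R}^d\to\mathbb{R}^{d_i}$ are locally Lipschitz, and $b^i(x)=b^i_0(x^i)+\gamma^i(x)$ with $b^i_0:\mathbb{R}^{d_i}\to\mathbb{R}^{d_i}$ locally Lipschitz and $\gamma^i:\mathbb{R}^d\to\mathbb{R}^{d_i}$. The unique strong solution is assumed non-explosive for every initial condition; $p_t(x,dy)$ are its transition kernels and $\mu p_t=\int\mu(dx)p_t(x,\cdot)$. For real $a$, $a^-=\max(-a,0)$. For $r\in(0,\infty)$, $$\kappa_i(r)=r^{-2}\inf\{-2(x-y)\cdot(b_0^i(x)-b_0^i(y)):x,y\in\mathbb{R}^{d_i},\ |x-y|=r\}.$$ Define (with $r>0$ understood in the conditions on $\kappa_i(r)$) $$R_0^i=\inf\{R\ge0:\kappa_i(r)\ge0\ \forall r\ge R\},\quad R_1^i=\inf\{R\ge R_0^i:\kappa_i(r)R(R-R_0^i)\ge8\ \forall r\ge R\},$$ $$\varphi_i(r)=\exp\Big(-\frac14\int_0^r s\kappa_i(s)^-ds\Big),\quad\Phi_i(r)=\int_0^r\varphi_i(s)ds,\quad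 g_i(r)=1-\frac12\int_0^{r\wedge R_1^i}\frac{\Phi_i(s)}{\varphi_i(s)}ds\Big/\int_0^{R_1^i}\frac{\Phi_i(s)}{\varphi_i(s)}ds,$$ $$f_i(r)=\int_0^r\varphi_i(s)g_i(s)\,ds,\qquad \frac1{c_i}=\int_0^{R_1^i}\Phi_i(s)\varphi_i(s)^{-1}ds,\quad c_i\in(0,\infty).$$ Let $w_1,\dots,w_n\in(0,1]$ be weights and set $d_{f,w}(x,y)=\sum_{i=1}^n f_i(|x^i-y^i|)\,w_i$ and $d_{\ell^1}(x,y)=\sum_{i=1}^n|x^i-y^i|$. For probability measures $\mu,\nu$ on $\mathbb{R}^d$, $W_{f,w}(\mu,\nu)=\inf_\eta\int d_{f,w}\,d\eta$ and $W_{\ell^1}(\mu,\nu)=\inf_\eta\int d_{\ell^1}\,d\eta$, the infima being over all couplings $\eta$ of $\mu$ and $\nu$. *)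

theory Defs
  imports "HOL-Probability.Probability"
begin

section \<open>Block decomposition of Euclidean space\<close>

text \<open>
  The space \<open>\<real>\<^sup>d = \<real>\<^bsup>d\<^sub>1\<^esup> \<times> \<dots> \<times> \<real>\<^bsup>d\<^sub>n\<^esup>\<close> is rendered as \<open>real ^ 'm\<close> together with a
  surjection \<open>blk :: 'm \<Rightarrow> 'n\<close> sending each of the \<open>d = CARD('m)\<close> coordinates to the number of its
  block, so \<open>n = CARD('n)\<close> and \<open>d\<^sub>i = card (blk -` {i}) \<ge> 1\<close>. The factor \<open>\<real>\<^bsup>d\<^sub>i\<^esup>\<close> is the
  coordinate subspace of vectors vanishing off \<open>blk -` {i}\<close>, with the inherited Euclidean norm and
  inner product.
\<close>

definition coord_space :: "'m set \<Rightarrow> (real ^ 'm) set" where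
  "coord_space J = {x. \<forall>j. j \<notin> J \<longrightarrow> x $ j = 0}"

definition coord_proj :: "'m set \<Rightarrow> real ^ 'm \<Rightarrow> real ^ 'm" where
  "coord_proj J x = (\<chi> j. if j \<in> J then x $ j else 0)"

abbreviation block_space :: "('m \<Rightarrow> 'n) \<Rightarrow> 'n \<Rightarrow> (real ^ 'm) set" where
  "block_space blk i \<equiv> coord_space (blk -` {i})"

abbreviation block :: "('m \<Rightarrow> 'n) \<Rightarrow> 'n \<Rightarrow> real ^ 'm \<Rightarrow> real ^ 'm" where
  "block blk i \<equiv> coord_proj (blk -` {i})"

text \<open>The library notion concerns time-dependent maps; here the time dependence is trivial.\<close>

abbreviation locally_lipschitz_on :: "'a::metric_space set \<Rightarrow> ('a \<Rightarrow> 'b::metric_space) \<Rightarrow> bool" where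
  "locally_lipschitz_on S F \<equiv> local_lipschitz (UNIV :: real set) S (\<lambda>_. F)"


section \<open>Brownian motion and the diffusion\<close>

definition indep_processes ::
  "'w measure \<Rightarrow> ('i \<Rightarrow> real \<Rightarrow> 'w \<Rightarrow> 'a::topological_space) \<Rightarrow> 'i set \<Rightarrow> bool" where
  "indep_processes M Y I \<longleftrightarrow>
     prob_space.indep_vars M (\<lambda>_. Pi\<^sub>M {0..} (\<lambda>_. borel)) (\<lambda>i \<omega>. \<lambda>t\<in>{0..}. Y i t \<omega>) I"

definition real_brownian_motion :: "'w measure \<Rightarrow> (real \<Rightarrow> 'w \<Rightarrow> real) \<Rightarrow> bool" where
  "real_brownian_motion M W \<longleftrightarrow>
     (\<forall>t\<ge>0. W t \<in> borel_measurable M) \<and>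
     (AE \<omega> in M. W 0 \<omega> = 0) \<and>
     (AE \<omega> in M. continuous_on {0..} (\<lambda>t. W t \<omega>)) \<and>
     (\<forall>s t. 0 \<le> s \<and> s < t \<longrightarrow>
        distributed M lborel (\<lambda>\<omega>. W t \<omega> - W s \<omega>) (normal_density 0 (sqrt (t - s)))) \<and>
     (\<forall>(\<tau> :: nat \<Rightarrow> real) N. 0 \<le> \<tau> 0 \<and> mono \<tau> \<longrightarrow>
        prob_space.indep_vars M (\<lambda>_. borel) (\<lambda>k \<omega>. W (\<tau> (Suc k)) \<omega> - W (\<tau> k) \<omega>) {..<N})"

text \<open>Standard Brownian motion in the coordinate subspace spanned by \<open>J\<close>.\<close>

definition brownian_motion_in ::
  "'w measure \<Rightarrow> 'm set \<Rightarrow> (real \<Rightarrow> 'w \<Rightarrow> real ^ 'm) \<Rightarrow> bool" where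
  "brownian_motion_in M J B \<longleftrightarrow>
     (\<forall>t\<ge>0. \<forall>\<omega>\<in>space M. B t \<omega> \<in> coord_space J) \<and>
     (\<forall>j\<in>J. real_brownian_motion M (\<lambda>t \<omega>. B t \<omega> $ j)) \<and>
     indep_processes M (\<lambda>j t \<omega>. B t \<omega> $ j) J"

text \<open>The filtration generated by the driving processes, augmented by the null sets.\<close>

definition augmented_filtration ::
  "'w measure \<Rightarrow> ('n \<Rightarrow> real \<Rightarrow> 'w \<Rightarrow> 'a::topological_space) \<Rightarrow> real \<Rightarrow> 'w measure" where
  "augmented_filtration M B t =
     sigma (space M)
       ({B i s -` A \<inter> space M | i s A. 0 \<le> s \<and> s \<le> t \<and> A \<in> sets borel} \<union> null_sets M)"

text \<open>
  Global (hence non-explosive) strong solution of \<open>dX\<^sup>i = b\<^sup>i(X) dt + dB\<^sup>i\<close> started in \<open>x\<close>. Since the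
  noise is additive, the equation in integrated form involves no stochastic integral.
\<close>

definition strong_solution ::
  "'w measure \<Rightarrow> ('m::finite \<Rightarrow> 'n) \<Rightarrow> ('n \<Rightarrow> real ^ 'm \<Rightarrow> real ^ 'm) \<Rightarrow>
   ('n \<Rightarrow> real \<Rightarrow> 'w \<Rightarrow> real ^ 'm) \<Rightarrow> real ^ 'm \<Rightarrow> (real \<Rightarrow> 'w \<Rightarrow> real ^ 'm) \<Rightarrow> bool" where
  "strong_solution M blk b B x X \<longleftrightarrow>
     (\<forall>t\<ge>0. X t \<in> measurable (augmented_filtration M B t) borel) \<and>
     (AE \<omega> in M. continuous_on {0..} (\<lambda>t. X t \<omega>) \<and>
        (\<forall>t\<ge>0. \<forall>i. block blk i (X t \<omega>) =
            block blk i x + integral {0..t} (\<lambda>s. b i (X s \<omega>)) + B i t \<omega>))"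

text \<open>\<open>X x\<close> is the solution started in \<open>x\<close>.\<close>

definition transition_kernel ::
  "'w measure \<Rightarrow> ('a \<Rightarrow> real \<Rightarrow> 'w \<Rightarrow> 'a::topological_space) \<Rightarrow> real \<Rightarrow> 'a \<Rightarrow> 'a measure" where
  "transition_kernel M X t x = distr M borel (X x t)"


section \<open>The functions and constants built from the drift\<close>

text \<open>
  A priori the infimum may be \<open>-\<infinity>\<close>, hence the extended real values. The functions below take a
  real-valued \<open>\<kappa>\<close>, of which only the values on \<open>(0, \<infinity>)\<close> matter.
\<close>

definition kappa :: "(real ^ 'm) set \<Rightarrow> (real ^ 'm \<Rightarrow> real ^ 'm::finite) \<Rightarrow> real \<Rightarrow> ereal" where
  "kappa S \<beta> r = ereal (1 / r\<^sup>2) *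
     Inf {ereal (-2 * ((x - y) \<bullet> (\<beta> x - \<beta> y))) | x y. x \<in> S \<and> y \<in> S \<and> norm (x - y) = r}"

definition R0 :: "(real \<Rightarrow> real) \<Rightarrow> real" where
  "R0 \<kappa> = Inf {R. 0 \<le> R \<and> (\<forall>r>0. R \<le> r \<longrightarrow> 0 \<le> \<kappa> r)}"

definition R1 :: "(real \<Rightarrow> real) \<Rightarrow> real" where
  "R1 \<kappa> = Inf {R. R0 \<kappa> \<le> R \<and> (\<forall>r>0. R \<le> r \<longrightarrow> 8 \<le> \<kappa> r * R * (R - R0 \<kappa>))}"

definition phi :: "(real \<Rightarrow> real) \<Rightarrow> real \<Rightarrow> real" where
  "phi \<kappa> r = exp (- (1/4) * integral {0..r} (\<lambda>s. s * max (- \<kappa> s) 0))"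

definition Phi :: "(real \<Rightarrow> real) \<Rightarrow> real \<Rightarrow> real" where
  "Phi \<kappa> r = integral {0..r} (phi \<kappa>)"

definition gfun :: "(real \<Rightarrow> real) \<Rightarrow> real \<Rightarrow> real" where
  "gfun \<kappa> r = 1 - (1/2) *
     (integral {0..min r (R1 \<kappa>)} (\<lambda>s. Phi \<kappa> s / phi \<kappa> s) /
      integral {0..R1 \<kappa>} (\<lambda>s. Phi \<kappa> s / phi \<kappa> s))"

definition ffun :: "(real \<Rightarrow> real) \<Rightarrow> real \<Rightarrow> real" where
  "ffun \<kappa> r = integral {0..r} (\<lambda>s. phi \<kappa> s * gfun \<kappa> s)"

definition rate :: "(real \<Rightarrow> real) \<Rightarrow> real" where
  "rate \<kappa> = 1 / integral {0..R1 \<kappa>} (\<lambda>s. Phi \<kappa> s / phi \<kappa> s)"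


section \<open>Kantorovich distances\<close>

definition couplings :: "'a::topological_space measure \<Rightarrow> 'a measure \<Rightarrow> ('a \<times> 'a) measure set" where
  "couplings \<mu> \<nu> = {\<eta>. prob_space \<eta> \<and> sets \<eta> = sets (borel \<Otimes>\<^sub>M borel) \<and>
     distr \<eta> borel fst = \<mu> \<and> distr \<eta> borel snd = \<nu>}"

definition kantorovich ::
  "('a::topological_space \<Rightarrow> 'a \<Rightarrow> real) \<Rightarrow> 'a measure \<Rightarrow> 'a measure \<Rightarrow> ennreal" where
  "kantorovich \<rho> \<mu> \<nu> = (INF \<eta>\<in>couplings \<mu> \<nu>. \<integral>\<^sup>+ p. ennreal (\<rho> (fst p) (snd p)) \<partial>\<eta>)"

definition dist_fw ::
  "('m \<Rightarrow> 'n) \<Rightarrow> ('n \<Rightarrow> real \<Rightarrow> real) \<Rightarrow> ('n \<Rightarrow> real) \<Rightarrow> real ^ 'm \<Rightarrow> real ^ 'm::finite \<Rightarrow> real" where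
  "dist_fw blk f w x y = (\<Sum>i\<in>UNIV. f i (norm (block blk i x - block blk i y)) * w i)"

definition dist_l1 :: "('m \<Rightarrow> 'n) \<Rightarrow> real ^ 'm \<Rightarrow> real ^ 'm::finite \<Rightarrow> real" where
  "dist_l1 blk x y = (\<Sum>i\<in>UNIV. norm (block blk i x - block blk i y))"

end

theory Submission
  imports Defs
begin

text \<open>
  The reflection coupling is realised in discrete time, so no stochastic calculus is needed. Two Euler
  chains are driven by Gaussian noise that is reflected in each block at distance at least \<open>\<delta>\<close> and
  is synchronous in the other blocks. A second order expansion of \<open>f\<^sub>i\<close> and the inequality
  \<open>2 f\<^sub>i'' - r \<kappa>\<^sub>i f\<^sub>i' / 2 \<le> - c\<^sub>i f\<^sub>i\<close> show that
  \<open>e\<^bsup>cs\<^esup> d\<^sub>f\<^sub>w(x, y) + l e\<^bsup>-Cs\<^esup> (1 + |x|\<^sup>2 + |y|\<^sup>2)\<close>, truncated at a level \<open>S\<close>, is a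
  supermartingale along the coupled chain once the step is small. Truncation makes this work for drifts
  of arbitrary growth, for which moments of the Euler chain may be infinite.

  Along almost every Brownian path the Euler scheme converges to the diffusion. A coupling of
  Euler chains becomes a coupling of the exact transition kernels by gluing: given the cell of a fine
  countable partition containing the Euler endpoint, the exact endpoint is resampled from its
  conditional law. Uniform integrability comes from the second moments, which are bounded by the same
  supermartingale. All couplings depend measurably on the starting points, which reduces general
  initial laws to point masses.
\<close>

section \<open>The one-dimensional distance functions\<close>

text \<open>Reflection doubles the radial noise to \<open>2 * sqrt h * \<zeta>\<close>, of variance
  \<open>4 * h\<close>; this is the origin of the term \<open>2 f''\<close>. The direction of
  reflection is undefined at distance zero, and the second order expansion needs distances bounded
  below, so the noise is shared below \<delta>. Contraction is lost there, but
  \<open>f r \<le> r\<close> and \<open>r * \<kappa> r\<close> are small, so the loss is an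
  arbitrarily small multiple of the step. The interaction enters through \<open>f' \<le> 1\<close>:
  the weighted hypothesis on \<gamma> turns it into a loss of rate \<open>\<epsilon> i\<close> in
  block i, whence the minimum of \<open>rate (\<kappa> i) - \<epsilon> i\<close>. The order of
  limits matters: \<delta> and the largest step depend on l and S, so the step goes to 0 for fixed l
  and S, and only then l goes to 0 and S to infinity. No optimal coupling has to exist: countably
  many kernels, each an exact coupling of the transition kernels, contract up to any prescribed
  error. The prefactor A comes from
  \<open>phi \<kappa> (R0 \<kappa>) / 2 * r \<le> f r \<le> r\<close>.\<close>

lemma FTC_atLeast:
  fixes f :: "real \<Rightarrow> real"
  assumes "continuous_on {0..} f" "0 \<le> r"
  shows "((\<lambda>s. integral {0..s} f) has_real_derivative f r) (at r within {0..})"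
proof -
  have "((\<lambda>s. integral {0..s} f) has_real_derivative f r) (at r within {0..r+1})"
    using assms by (intro integral_has_real_derivative) (auto intro: continuous_on_subset)
  moreover have "at r within {0..r+1} = at r within {0..}"
    by (rule at_within_nhd[of _ "{..<r+1}"]) auto
  ultimately show ?thesis by simp
qed

lemma has_real_derivative_within_atLeast:
  fixes f :: "real \<Rightarrow> real"
  assumes "0 < r"
  shows "(f has_real_derivative d) (at r within {0..}) \<longleftrightarrow> (f has_real_derivative d) (at r)"
proof -
  have "at r within {0..} = at r"
    by (rule at_within_interior) (use assms in simp)
  then show ?thesis by simp
qed

lemma integral_affine:
  fixes a u v :: real
  assumes "u \<le> v"
  shows "integral {u..v} (\<lambda>s. a + (s - u)) = a * (v - u) + (v - u)\<^sup>2 / 2"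
proof -
  have "((\<lambda>s. a + (s - u)) has_integral (a * v + (v - u)\<^sup>2 / 2) - (a * u + (u - u)\<^sup>2 / 2)) {u..v}"
  proof (rule fundamental_theorem_of_calculus[OF assms, where f="\<lambda>s. a * s + (s - u)\<^sup>2 / 2"])
    fix s
    have "((\<lambda>s. a * s + (s - u)\<^sup>2 / 2) has_real_derivative a + (s - u)) (at s within {u..v})"
      by (rule derivative_eq_intros refl | simp)+
    then show "((\<lambda>s. a * s + (s - u)\<^sup>2 / 2) has_vector_derivative a + (s - u)) (at s within {u..v})"
      by (rule has_real_derivative_iff_has_vector_derivative[THEN iffD1])
  qed
  from integral_unique[OF this] show ?thesis by (simp add: right_diff_distrib)
qed

section \<open>Hypotheses on a single block and the radii \<open>R0\<close>,
  \<open>R1\<close>\<close>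

locale contraction_profile =
  fixes \<kappa> :: "real \<Rightarrow> real"
  assumes cont_kappa: "continuous_on {0<..} \<kappa>"
    and Liminf_kappa: "0 < Liminf at_top (\<lambda>r. ereal (\<kappa> r))"
    and lim_r_kappa: "((\<lambda>r. r * \<kappa> r) \<longlongrightarrow> 0) (at_right 0)"
begin

lemma kappa_eventually_ge:
  obtains m R where "0 < m" "0 < R" "\<And>r. R \<le> r \<Longrightarrow> m \<le> \<kappa> r"
proof -
  obtain m where m: "0 < ereal m" "ereal m < Liminf at_top (\<lambda>r. ereal (\<kappa> r))"
    using ereal_dense2[OF Liminf_kappa] by auto
  have "eventually (\<lambda>r. ereal m < ereal (\<kappa> r)) at_top"
    using less_LiminfD[OF m(2)] .
  then obtain R where "\<And>r. R \<le> r \<Longrightarrow> m < \<kappa> r"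
    by (auto simp: eventually_at_top_linorder)
  then have "m \<le> \<kappa> r" if "max R 1 \<le> r" for r
    using that by (simp add: less_imp_le)
  then show ?thesis
    using that[of m "max R 1"] m by simp
qed

text \<open>Multiplying by r removes the singularity at 0: the product is 0 there whatever
  \<open>\<kappa> 0\<close> is, which matches the limit. Later estimates are therefore phrased with
  \<open>r * \<kappa> r\<close>.\<close>

lemma cont_r_kappa: "continuous_on {0..} (\<lambda>r. r * \<kappa> r)"
proof (subst continuous_on_eq_continuous_within, rule ballI)
  fix r :: real assume r: "r \<in> {0..}"
  show "continuous (at r within {0..}) (\<lambda>r. r * \<kappa> r)"
  proof (cases "r = 0")
    case True
    have "at (0::real) within {0..} = at 0 within {0<..}"
      unfolding at_within_def by (intro arg_cong[where f="\<lambda>x. inf _ (principal x)"]) auto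
    then show ?thesis using lim_r_kappa True by (simp add: continuous_within)
  next
    case False
    with r have "0 < r" by simp
    then have "isCont \<kappa> r"
      using cont_kappa by (simp add: continuous_on_eq_continuous_at)
    then have "isCont (\<lambda>r. r * \<kappa> r) r" by (intro continuous_intros)
    then show ?thesis by (rule continuous_at_imp_continuous_at_within)
  qed
qed

lemma neg_part_eq: "s * max (- \<kappa> s) 0 = max (- (s * \<kappa> s)) 0" if "0 \<le> s" for s
  using that by (cases "s = 0") (auto simp: max_def mult_le_0_iff zero_le_mult_iff)

text \<open>Integrand in the exponent of \<open>phi\<close>. By \<open>neg_part_eq\<close> it is the
  negative part of \<open>s * \<kappa> s\<close>, hence continuous up to 0 even if
  \<open>\<kappa>\<close> is unbounded there.\<close>

definition psi where "psi = (\<lambda>s. s * max (- \<kappa> s) 0)"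

lemma psi_nonneg: "0 \<le> s \<Longrightarrow> 0 \<le> psi s"
  by (simp add: psi_def)

lemma psi_ge: "0 \<le> s \<Longrightarrow> - (s * \<kappa> s) \<le> psi s"
  by (simp add: psi_def neg_part_eq)

lemma cont_psi: "continuous_on {0..} psi"
proof -
  have "continuous_on {0..} (\<lambda>s. max (- (s * \<kappa> s)) 0)"
    by (intro continuous_intros cont_r_kappa)
  then show ?thesis
    by (rule continuous_on_eq) (simp add: psi_def neg_part_eq)
qed

abbreviation "R\<^sub>0 \<equiv> R0 \<kappa>"
abbreviation "R\<^sub>1 \<equiv> R1 \<kappa>"

text \<open>The infimum is attained, up to the point 0. Beyond \<open>R0\<close> the sign follows
  from the definition; at \<open>R0\<close> it follows by letting s decrease to r, which uses
  continuity of \<open>\<kappa>\<close> and hence \<open>0 < r\<close>.\<close>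

lemma R0_nonneg: "0 \<le> R\<^sub>0" and kappa_nonneg: "R\<^sub>0 \<le> r \<Longrightarrow> 0 < r \<Longrightarrow> 0 \<le> \<kappa> r"
proof -
  let ?S = "{R. 0 \<le> R \<and> (\<forall>r>0. R \<le> r \<longrightarrow> 0 \<le> \<kappa> r)}"
  obtain m R where "0 < m" "0 < R" "\<And>r. R \<le> r \<Longrightarrow> m \<le> \<kappa> r"
    using kappa_eventually_ge by blast
  then have ne: "R \<in> ?S" by (force intro: less_imp_le less_le_trans)
  show R0: "0 \<le> R\<^sub>0" unfolding R0_def using ne by (intro cInf_greatest) auto
  have gt: "0 \<le> \<kappa> r" if r: "R\<^sub>0 < r" for r
  proof -
    have "bdd_below ?S" by (rule bdd_belowI[of _ 0]) auto
    then obtain R' where "R' \<in> ?S" "R' < r"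
      using cInf_less_iff[of ?S r] ne r unfolding R0_def by blast
    then show ?thesis using R0 r by auto
  qed
  assume r: "R\<^sub>0 \<le> r" "0 < r"
  have "isCont \<kappa> r"
    using cont_kappa r by (simp add: continuous_on_eq_continuous_at)
  then have "(\<kappa> \<longlongrightarrow> \<kappa> r) (at_right r)"
    by (simp add: isCont_def filterlim_at_split)
  moreover have "eventually (\<lambda>s. 0 \<le> \<kappa> s) (at_right r)"
    using gt r by (auto simp: eventually_at_filter intro!: always_eventually)
  ultimately show "0 \<le> \<kappa> r"
    by (intro tendsto_lowerbound[where f=\<kappa>]) auto
qed

text \<open>The bound passes to the infimum by two limits: for fixed r > R1 the radius R decreases
  to R1, then r itself decreases to R1. Equality R1 = R0 would make the product 0 rather than at
  least 8.\<close>

lemma R1_gt_R0: "R\<^sub>0 < R\<^sub>1" and kappa_ge_R1: "R\<^sub>1 \<le> r \<Longrightarrow> 8 \<le> \<kappa> r * R\<^sub>1 * (R\<^sub>1 - R\<^sub>0)"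
proof -
  let ?S = "{R. R\<^sub>0 \<le> R \<and> (\<forall>r>0. R \<le> r \<longrightarrow> 8 \<le> \<kappa> r * R * (R - R\<^sub>0))}"
  obtain m R where mR: "0 < m" "0 < R" "\<And>r. R \<le> r \<Longrightarrow> m \<le> \<kappa> r"
    using kappa_eventually_ge by blast
  \<comment> \<open>One entry per factor: beyond R one has \<open>\<kappa> r \<ge> m\<close>, then
    \<open>m * S \<ge> 8\<close>, and \<open>S - R0 \<kappa> \<ge> 1\<close> keeps the product from
    dropping.\<close>
  define S where "S = max (max R (R\<^sub>0 + 1)) (8 / m)"
  have S: "R \<le> S" "R\<^sub>0 + 1 \<le> S" "8 / m \<le> S" by (auto simp: S_def)
  have "8 \<le> \<kappa> r * S * (S - R\<^sub>0)" if "S \<le> r" for r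
  proof -
    have "8 \<le> m * S" using S(3) mR(1) by (simp add: field_simps)
    also have "\<dots> \<le> \<kappa> r * S" using mR S that R0_nonneg by (intro mult_right_mono) auto
    also have "\<dots> \<le> \<kappa> r * S * (S - R\<^sub>0)"
      using mR(1) mR(3)[of r] S that R0_nonneg mult_left_mono[of 1 "S - R\<^sub>0" "\<kappa> r * S"] by force
    finally show ?thesis .
  qed
  then have ne: "S \<in> ?S" using S by auto
  have bdd: "bdd_below ?S" by (rule bdd_belowI[of _ "R\<^sub>0"]) auto
  have ge: "R\<^sub>0 \<le> R\<^sub>1" unfolding R1_def[of \<kappa>] using ne by (intro cInf_greatest) auto
  have gt: "8 \<le> \<kappa> r * R\<^sub>1 * (R\<^sub>1 - R\<^sub>0)" if r: "R\<^sub>1 < r" for r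
  proof (rule tendsto_lowerbound)
    show "((\<lambda>R. \<kappa> r * R * (R - R\<^sub>0)) \<longlongrightarrow> \<kappa> r * R\<^sub>1 * (R\<^sub>1 - R\<^sub>0)) (at_right R\<^sub>1)"
      by (intro tendsto_intros)
    have "8 \<le> \<kappa> r * R * (R - R\<^sub>0)" if R: "R\<^sub>1 < R" "R < r" for R
    proof -
      obtain R' where R': "R' \<in> ?S" "R' < R"
        using cInf_less_iff[of ?S R] ne bdd R unfolding R1_def by blast
      have "0 \<le> R'" "R\<^sub>0 \<le> R'" "0 < r" using R' R0_nonneg R ge by auto
      then have "8 \<le> \<kappa> r * (R' * (R' - R\<^sub>0))" using R' R by (auto simp: mult.assoc)
      also have "\<dots> \<le> \<kappa> r * (R * (R - R\<^sub>0))"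
        using R' R R0_nonneg \<open>0 \<le> R'\<close> ge \<open>0 < r\<close> \<open>R\<^sub>0 \<le> R'\<close>
        by (intro mult_left_mono mult_mono kappa_nonneg) auto
      finally show ?thesis by (simp add: mult.assoc)
    qed
    then show "eventually (\<lambda>R. 8 \<le> \<kappa> r * R * (R - R\<^sub>0)) (at_right R\<^sub>1)"
      using r by (auto simp: eventually_at_right_field)
  qed simp
  show lt: "R\<^sub>0 < R\<^sub>1" using ge gt[of "R\<^sub>1 + 1"] by (cases "R\<^sub>0 = R\<^sub>1") auto
  assume r: "R\<^sub>1 \<le> r"
  show "8 \<le> \<kappa> r * R\<^sub>1 * (R\<^sub>1 - R\<^sub>0)"
  proof (rule tendsto_lowerbound)
    have "isCont \<kappa> r"
      using cont_kappa r lt R0_nonneg by (simp add: continuous_on_eq_continuous_at)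
    then have "(\<kappa> \<longlongrightarrow> \<kappa> r) (at_right r)"
      by (simp add: isCont_def filterlim_at_split)
    then show "((\<lambda>r. \<kappa> r * R\<^sub>1 * (R\<^sub>1 - R\<^sub>0)) \<longlongrightarrow> \<kappa> r * R\<^sub>1 * (R\<^sub>1 - R\<^sub>0)) (at_right r)"
      by (intro tendsto_intros)
    show "eventually (\<lambda>s. 8 \<le> \<kappa> s * R\<^sub>1 * (R\<^sub>1 - R\<^sub>0)) (at_right r)"
      using gt r by (auto simp: eventually_at_filter intro!: always_eventually)
  qed simp
qed

lemma R1_pos: "0 < R\<^sub>1" using R1_gt_R0 R0_nonneg by simp

section \<open>The weights \<open>phi\<close>, \<open>Phi\<close>, \<open>gfun\<close> and the
  rate\<close>

lemma phi_psi: "phi \<kappa> r = exp (- (1/4) * integral {0..r} psi)"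
  by (simp add: phi_def psi_def)

lemma phi_pos: "0 < phi \<kappa> r" by (simp add: phi_def)

lemma phi_deriv: "0 \<le> r \<Longrightarrow> (phi \<kappa> has_real_derivative - (1/4) * psi r * phi \<kappa> r) (at r within {0..})"
  unfolding phi_psi[abs_def]
  by (rule derivative_eq_intros FTC_atLeast cont_psi refl | assumption | simp)+

lemma integral_psi_mono: "0 \<le> r \<Longrightarrow> r \<le> s \<Longrightarrow> integral {0..r} psi \<le> integral {0..s} psi"
  by (rule integral_subset_le)
     (auto intro!: psi_nonneg integrable_continuous_real intro: continuous_on_subset[OF cont_psi])

lemma phi_antimono: "0 \<le> r \<Longrightarrow> r \<le> s \<Longrightarrow> phi \<kappa> s \<le> phi \<kappa> r"
  using integral_psi_mono unfolding phi_psi by simp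

lemma phi_le_1: "0 \<le> r \<Longrightarrow> phi \<kappa> r \<le> 1"
  using phi_antimono[of 0 r] by (simp add: phi_psi)

text \<open>\<open>\<kappa>\<close> is nonnegative beyond \<open>R0\<close>, so the exponent stops
  growing there.\<close>

lemma phi_eq_R0: assumes "R\<^sub>0 \<le> r" shows "phi \<kappa> r = phi \<kappa> R\<^sub>0"
proof -
  have "integral {R\<^sub>0..r} psi = integral {R\<^sub>0..r} (\<lambda>_. 0)"
  proof (rule integral_cong)
    fix s assume "s \<in> {R\<^sub>0..r}"
    then show "psi s = 0" using kappa_nonneg[of s] R0_nonneg by (cases "s = 0") (auto simp: psi_def)
  qed
  moreover have "integral {0..R\<^sub>0} psi + integral {R\<^sub>0..r} psi = integral {0..r} psi"
    using assms R0_nonneg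
    by (intro Henstock_Kurzweil_Integration.integral_combine integrable_continuous_real continuous_on_subset[OF cont_psi]) auto
  ultimately show ?thesis by (simp add: phi_psi)
qed

lemma cont_phi: "continuous_on {0..} (phi \<kappa>)"
  using phi_deriv by (intro DERIV_continuous_on[where D="\<lambda>r. - (1/4) * psi r * phi \<kappa> r"]) auto

lemma Phi_deriv: "0 \<le> r \<Longrightarrow> (Phi \<kappa> has_real_derivative phi \<kappa> r) (at r within {0..})"
  unfolding Phi_def[abs_def] by (intro FTC_atLeast cont_phi)

lemma cont_Phi: "continuous_on {0..} (Phi \<kappa>)"
  using Phi_deriv by (intro DERIV_continuous_on[where D="phi \<kappa>"]) auto

lemma integrable_atLeast: "continuous_on {0..} f \<Longrightarrow> 0 \<le> a \<Longrightarrow> f integrable_on {a..b::real}" for f :: "real \<Rightarrow> real"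
  by (rule integrable_continuous_real) (rule continuous_on_subset, auto)

lemma Phi_0 [simp]: "Phi \<kappa> 0 = 0" by (simp add: Phi_def)

lemma Phi_diff: "0 \<le> r \<Longrightarrow> r \<le> s \<Longrightarrow> Phi \<kappa> s - Phi \<kappa> r = integral {r..s} (phi \<kappa>)"
  unfolding Phi_def
  using Henstock_Kurzweil_Integration.integral_combine[of 0 r s "phi \<kappa>"] integrable_atLeast[OF cont_phi, of 0 s] by auto

lemma Phi_diff_ge: assumes "0 \<le> r" "r \<le> s" shows "phi \<kappa> s * (s - r) \<le> Phi \<kappa> s - Phi \<kappa> r"
proof -
  have "integral {r..s} (\<lambda>_. phi \<kappa> s) \<le> integral {r..s} (phi \<kappa>)"
    using assms by (intro integral_le integrable_atLeast cont_phi continuous_intros phi_antimono) auto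
  then show ?thesis using assms by (simp add: Phi_diff mult.commute)
qed

lemma Phi_diff_le: assumes "0 \<le> r" "r \<le> s" shows "Phi \<kappa> s - Phi \<kappa> r \<le> phi \<kappa> r * (s - r)"
proof -
  have "integral {r..s} (phi \<kappa>) \<le> integral {r..s} (\<lambda>_. phi \<kappa> r)"
    using assms by (intro integral_le integrable_atLeast cont_phi continuous_intros phi_antimono) auto
  then show ?thesis using assms by (simp add: Phi_diff mult.commute)
qed

lemma Phi_nonneg: "0 \<le> r \<Longrightarrow> 0 \<le> Phi \<kappa> r"
  using Phi_diff_ge[of 0 r] phi_pos[of r] by (auto intro: order_trans[rotated])

lemma Phi_pos: "0 < r \<Longrightarrow> 0 < Phi \<kappa> r"
  using Phi_diff_ge[of 0 r] phi_pos[of r] by (auto intro: less_le_trans[rotated])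

abbreviation "q \<equiv> \<lambda>s. Phi \<kappa> s / phi \<kappa> s"
abbreviation "I \<equiv> integral {0..R\<^sub>1} q"

lemma cont_q: "continuous_on {0..} q"
  using phi_pos by (intro continuous_intros cont_phi cont_Phi) (auto simp: less_imp_neq[symmetric])

lemma q_nonneg: "0 \<le> r \<Longrightarrow> 0 \<le> q r" using Phi_nonneg phi_pos by (simp add: less_imp_le)

text \<open>On [R0, R1] \<open>phi\<close> is constant and \<open>Phi\<close> affine, so the
  integral of \<open>q\<close> over that interval is explicit. As \<open>rate\<close> is
  \<open>1 / I\<close>, this bounds the rate from above, and \<open>gen_nonneg\<close> weighs that
  bound against the defining property of R1.\<close>

lemma I_ge: "(R\<^sub>1 - R\<^sub>0) * Phi \<kappa> R\<^sub>1 \<le> 2 * phi \<kappa> R\<^sub>0 * I"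
proof -
  let ?p = "phi \<kappa> R\<^sub>0" and ?D = "R\<^sub>1 - R\<^sub>0"
  have Phi: "Phi \<kappa> s = Phi \<kappa> R\<^sub>0 + ?p * (s - R\<^sub>0)" if "R\<^sub>0 \<le> s" for s
    using Phi_diff_ge[OF R0_nonneg that] Phi_diff_le[OF R0_nonneg that] phi_eq_R0[OF that] by simp
  have 1: "integral {R\<^sub>0..R\<^sub>1} (\<lambda>s. Phi \<kappa> R\<^sub>0 / ?p + (s - R\<^sub>0)) = Phi \<kappa> R\<^sub>0 / ?p * ?D + ?D\<^sup>2 / 2"
    by (rule integral_affine) (use R1_gt_R0 in simp)
  have 2: "integral {R\<^sub>0..R\<^sub>1} q = integral {R\<^sub>0..R\<^sub>1} (\<lambda>s. Phi \<kappa> R\<^sub>0 / ?p + (s - R\<^sub>0))"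
  proof (rule integral_cong)
    fix s assume "s \<in> {R\<^sub>0..R\<^sub>1}"
    then have "Phi \<kappa> s = Phi \<kappa> R\<^sub>0 + ?p * (s - R\<^sub>0)" "phi \<kappa> s = ?p" using Phi[of s] phi_eq_R0[of s] by auto
    then show "q s = Phi \<kappa> R\<^sub>0 / ?p + (s - R\<^sub>0)"
      using phi_pos[of "R\<^sub>0"] by (simp add: add_divide_distrib)
  qed
  have "integral {R\<^sub>0..R\<^sub>1} q \<le> I"
    using R0_nonneg by (intro integral_subset_le integrable_atLeast cont_q) (auto intro: q_nonneg)
  then have "Phi \<kappa> R\<^sub>0 / ?p * ?D + ?D\<^sup>2 / 2 \<le> I" unfolding 2 1 .
  then have "2 * ?p * (Phi \<kappa> R\<^sub>0 / ?p * ?D + ?D\<^sup>2 / 2) \<le> 2 * ?p * I"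
    using phi_pos[of "R\<^sub>0"] by (intro mult_left_mono) auto
  moreover have "2 * ?p * (Phi \<kappa> R\<^sub>0 / ?p * ?D + ?D\<^sup>2 / 2) = ?D * (2 * Phi \<kappa> R\<^sub>0 + ?p * ?D)"
    using phi_pos[of "R\<^sub>0"] by (simp add: field_simps power2_eq_square)
  moreover have "?D * (Phi \<kappa> R\<^sub>1) \<le> ?D * (2 * Phi \<kappa> R\<^sub>0 + ?p * ?D)"
    using R1_gt_R0 Phi[of "R\<^sub>1"] Phi_nonneg[OF R0_nonneg] by (intro mult_left_mono) auto
  ultimately show ?thesis by linarith
qed

lemma I_pos: "0 < I"
proof -
  have "0 < (R\<^sub>1 - R\<^sub>0) * Phi \<kappa> R\<^sub>1" using R1_gt_R0 R1_pos Phi_pos by simp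
  then have "0 < 2 * phi \<kappa> R\<^sub>0 * I" using I_ge by linarith
  then show ?thesis using phi_pos[of "R\<^sub>0"] by (simp add: zero_less_mult_iff)
qed

lemma rate_eq: "rate \<kappa> = 1 / I" by (simp add: rate_def)

lemma rate_pos: "0 < rate \<kappa>" using I_pos by (simp add: rate_eq)

lemma gfun_eq: "gfun \<kappa> r = 1 - (1/2) * (rate \<kappa> * integral {0..min r R\<^sub>1} q)"
  by (simp add: gfun_def rate_eq)

lemma gfun_R1: "R\<^sub>1 \<le> r \<Longrightarrow> gfun \<kappa> r = 1/2"
  using I_pos by (simp add: gfun_eq rate_eq min_def)

lemma integral_q_mono: "0 \<le> r \<Longrightarrow> r \<le> s \<Longrightarrow> integral {0..r} q \<le> integral {0..s} q"
  by (intro integral_subset_le integrable_atLeast cont_q) (auto intro: q_nonneg)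

lemma gfun_antimono: assumes "0 \<le> r" "r \<le> s" shows "gfun \<kappa> s \<le> gfun \<kappa> r"
  unfolding gfun_eq using rate_pos R1_pos assms
  by (intro diff_left_mono mult_left_mono integral_q_mono) (auto simp: min_def)

lemma gfun_bounds: "0 \<le> r \<Longrightarrow> 1/2 \<le> gfun \<kappa> r" "0 \<le> r \<Longrightarrow> gfun \<kappa> r \<le> 1"
  using gfun_antimono[of r "max r R\<^sub>1"] gfun_antimono[of 0 r] R1_pos
  by (auto simp: gfun_R1) (simp add: gfun_eq)

lemma gfun_deriv: assumes "0 < r" "r < R\<^sub>1"
  shows "(gfun \<kappa> has_real_derivative - (1/2) * rate \<kappa> * q r) (at r)"
proof -
  have "((\<lambda>s. integral {0..s} q) has_real_derivative q r) (at r)"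
    using FTC_atLeast[OF cont_q, of r] assms by (simp add: has_real_derivative_within_atLeast)
  then have "((\<lambda>r. 1 - (1/2) * (rate \<kappa> * integral {0..r} q)) has_real_derivative - (1/2) * rate \<kappa> * q r) (at r)"
    by (auto intro!: derivative_eq_intros)
  then show ?thesis
  proof (rule has_field_derivative_transform_within[where S=UNIV and d="R\<^sub>1 - r"])
    fix s assume "dist s r < R\<^sub>1 - r"
    then show "1 - 1 / 2 * (rate \<kappa> * integral {0..s} q) = gfun \<kappa> s"
      by (auto simp: gfun_eq dist_real_def min_def)
  qed (use assms in auto)
qed

lemma cont_gfun: "continuous_on {0..} (gfun \<kappa>)"
proof -
  have *: "continuous_on {0..} (\<lambda>s. integral {0..s} q)"
    using FTC_atLeast[OF cont_q] by (intro DERIV_continuous_on[where D=q]) auto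
  have "continuous_on {0..} (\<lambda>r. integral {0..min r R\<^sub>1} q)"
    by (rule continuous_on_compose2[OF *]) (use R1_pos in \<open>auto intro!: continuous_intros\<close>)
  then show ?thesis unfolding gfun_eq[abs_def] by (intro continuous_intros)
qed

section \<open>The distance function \<open>f\<close> and its derivative \<open>fd\<close>\<close>

definition fd where "fd r = phi \<kappa> r * gfun \<kappa> r"
abbreviation "f \<equiv> ffun \<kappa>"

lemma ffun_eq: "f r = integral {0..r} fd" by (simp add: ffun_def fd_def[abs_def])

lemma cont_fd: "continuous_on {0..} fd"
  unfolding fd_def[abs_def] by (intro continuous_intros cont_phi cont_gfun)

lemma fd_nonneg: "0 \<le> r \<Longrightarrow> 0 \<le> fd r"
  using gfun_bounds[of r] phi_pos[of r] by (simp add: fd_def)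

lemma fd_le_phi: "0 \<le> r \<Longrightarrow> fd r \<le> phi \<kappa> r"
  using gfun_bounds[of r] phi_pos[of r] mult_left_mono[of "gfun \<kappa> r" 1 "phi \<kappa> r"] by (simp add: fd_def)

lemma fd_le_1: "0 \<le> r \<Longrightarrow> fd r \<le> 1"
  using fd_le_phi phi_le_1 order_trans by blast

text \<open>Combines \<open>phi \<kappa> r \<ge> phi \<kappa> (R0 \<kappa>)\<close> with
  \<open>gfun \<ge> 1/2\<close>; both constants reappear in A.\<close>

lemma fd_ge: assumes "0 \<le> r" shows "phi \<kappa> R\<^sub>0 / 2 \<le> fd r"
proof -
  have "phi \<kappa> R\<^sub>0 = phi \<kappa> (max r R\<^sub>0)" using phi_eq_R0[of "max r R\<^sub>0"] by simp
  also have "\<dots> \<le> phi \<kappa> r" using assms by (intro phi_antimono) auto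
  finally have "phi \<kappa> R\<^sub>0 * (1/2) \<le> phi \<kappa> r * gfun \<kappa> r"
    using gfun_bounds[of r] phi_pos assms by (intro mult_mono) (auto intro: less_imp_le)
  then show ?thesis by (simp add: fd_def)
qed

lemma fd_R1: "R\<^sub>1 \<le> r \<Longrightarrow> fd r = phi \<kappa> R\<^sub>0 / 2"
  using phi_eq_R0[of r] R1_gt_R0 by (simp add: fd_def gfun_R1)

lemma ffun_deriv: "0 \<le> r \<Longrightarrow> (f has_real_derivative fd r) (at r within {0..})"
  unfolding ffun_eq[abs_def] by (intro FTC_atLeast cont_fd)

lemma cont_ffun: "continuous_on {0..} f"
  using ffun_deriv by (intro DERIV_continuous_on[where D=fd]) auto

lemma ffun_0 [simp]: "f 0 = 0" by (simp add: ffun_eq)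

lemma ffun_diff: "0 \<le> r \<Longrightarrow> r \<le> s \<Longrightarrow> f s - f r = integral {r..s} fd"
  unfolding ffun_eq
  using Henstock_Kurzweil_Integration.integral_combine[of 0 r s fd] integrable_atLeast[OF cont_fd, of 0 s] by auto

lemma ffun_mono: assumes "0 \<le> r" "r \<le> s" shows "f r \<le> f s"
proof -
  have "0 \<le> integral {r..s} fd"
    using assms by (intro integral_nonneg integrable_atLeast cont_fd) (auto intro: fd_nonneg)
  then show ?thesis using ffun_diff[OF assms] by simp
qed

lemma ffun_Lipschitz: assumes "0 \<le> r" "r \<le> s" shows "f s \<le> f r + (s - r)"
proof -
  have "integral {r..s} fd \<le> integral {r..s} (\<lambda>_. 1)"
    using assms by (intro integral_le integrable_atLeast cont_fd) (auto intro: fd_le_1)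
  then show ?thesis using ffun_diff[OF assms] assms by simp
qed

lemma ffun_le: "0 \<le> r \<Longrightarrow> f r \<le> r"
  using ffun_Lipschitz[of 0 r] by simp

lemma ffun_nonneg: "0 \<le> r \<Longrightarrow> 0 \<le> f r"
  using ffun_mono[of 0 r] by simp

lemma ffun_ge: assumes "0 \<le> r" shows "phi \<kappa> R\<^sub>0 / 2 * r \<le> f r"
proof -
  have "integral {0..r} (\<lambda>_. phi \<kappa> R\<^sub>0 / 2) \<le> integral {0..r} fd"
    by (intro integral_le integrable_atLeast cont_fd) (use fd_ge in auto)
  then show ?thesis using assms by (simp add: ffun_eq mult.commute)
qed

lemma ffun_le_Phi: assumes "0 \<le> r" shows "f r \<le> Phi \<kappa> r"
  unfolding ffun_eq Phi_def
  by (intro integral_le integrable_atLeast cont_fd cont_phi) (auto intro: fd_le_phi)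

text \<open>The generator inequality \<open>2 f'' \<le> gen\<close>, with \<open>f''\<close> understood as the derivative of \<open>fd\<close>,
  which jumps upwards at \<open>R\<^sub>1\<close>.\<close>

definition gen where "gen r = 1/2 * (r * \<kappa> r) * fd r - rate \<kappa> * f r"

lemma cont_gen: "continuous_on {0..} gen"
  unfolding gen_def[abs_def] by (intro continuous_intros cont_fd cont_ffun cont_r_kappa)

text \<open>The product rule splits the task: the derivative of \<open>phi\<close> gives
  \<open>- psi * fd / 4\<close>, which compensates a repulsive drift, and the derivative of
  \<open>gfun\<close> gives \<open>- rate * Phi / 2\<close>, which is the contraction because
  \<open>f \<le> Phi\<close>.\<close>

lemma fd_deriv_le: assumes "0 < r" "r < R\<^sub>1"
  shows "\<exists>d. (fd has_real_derivative d) (at r) \<and> 2 * d \<le> gen r"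
proof (intro exI conjI)
  let ?d = "phi \<kappa> r * (- (1/2) * rate \<kappa> * q r) + (- (1/4) * psi r * phi \<kappa> r) * gfun \<kappa> r"
  show "(fd has_real_derivative ?d) (at r)"
    using phi_deriv[of r] gfun_deriv[OF assms] assms unfolding fd_def[abs_def]
    by (auto intro!: derivative_eq_intros simp: has_real_derivative_within_atLeast)
  have "2 * ?d = - (1/2) * (psi r * fd r) - rate \<kappa> * Phi \<kappa> r"
    using phi_pos[of r] by (simp add: fd_def algebra_simps)
  also have "\<dots> \<le> - (1/2) * (- (r * \<kappa> r) * fd r) - rate \<kappa> * f r"
    using psi_ge[of r] fd_nonneg[of r] ffun_le_Phi[of r] rate_pos assms
    by (intro diff_mono mult_left_mono mult_left_mono_neg mult_right_mono) auto
  also have "\<dots> = gen r" by (simp add: gen_def)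
  finally show "2 * ?d \<le> gen r" .
qed

text \<open>Beyond R1 the slope \<open>fd\<close> is constant, so the inward drift has to replace
  concavity: \<open>rate * f\<close> must stay below \<open>r * \<kappa> r * fd / 2\<close>. This
  follows from \<open>f r / r \<le> Phi r / r \<le> Phi R1 / R1\<close>, the bound on the rate in
  \<open>I_ge\<close>, and the defining property of R1.\<close>

lemma gen_nonneg: assumes "R\<^sub>1 \<le> r" shows "0 \<le> gen r"
proof -
  let ?P = "Phi \<kappa> R\<^sub>1" and ?p = "phi \<kappa> R\<^sub>0" and ?D = "R\<^sub>1 - R\<^sub>0"
  have pos: "0 < ?P" "0 < ?p" "0 < ?D" "0 < R\<^sub>1" "0 < r"
    using R1_pos Phi_pos phi_pos R1_gt_R0 assms by auto
  \<comment> \<open>Concavity: \<open>Phi r / r\<close> is nonincreasing because \<open>phi\<close>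
    is.\<close>
  have "?P * r \<ge> Phi \<kappa> r * R\<^sub>1"
  proof -
    have "Phi \<kappa> r - ?P \<le> phi \<kappa> R\<^sub>1 * (r - R\<^sub>1)" using Phi_diff_le[of "R\<^sub>1" r] assms pos by simp
    then have "(Phi \<kappa> r - ?P) * R\<^sub>1 \<le> phi \<kappa> R\<^sub>1 * (r - R\<^sub>1) * R\<^sub>1" using pos by (intro mult_right_mono) auto
    also have "\<dots> = (phi \<kappa> R\<^sub>1 * R\<^sub>1) * (r - R\<^sub>1)" by simp
    also have "\<dots> \<le> ?P * (r - R\<^sub>1)"
      using Phi_diff_ge[of 0 "R\<^sub>1"] assms pos by (intro mult_right_mono) auto
    finally show ?thesis by (simp add: algebra_simps)
  qed
  moreover have "f r * R\<^sub>1 \<le> Phi \<kappa> r * R\<^sub>1" using ffun_le_Phi[of r] pos by simp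
  ultimately have f: "f r * R\<^sub>1 \<le> ?P * r" by linarith
  have "rate \<kappa> * (?D * ?P) \<le> rate \<kappa> * (2 * ?p * I)" using I_ge rate_pos by (intro mult_left_mono) auto
  also have "\<dots> = 2 * ?p" using I_pos by (simp add: rate_eq)
  finally have r1: "rate \<kappa> * (?D * ?P) \<le> 2 * ?p" .
  have k: "8 \<le> \<kappa> r * R\<^sub>1 * ?D" using kappa_ge_R1[OF assms] .
  have "rate \<kappa> * (f r * R\<^sub>1) * ?D \<le> rate \<kappa> * (?P * r) * ?D"
    using f rate_pos pos by (intro mult_right_mono mult_left_mono) auto
  also have "\<dots> = (rate \<kappa> * (?D * ?P)) * r" by simp
  also have "\<dots> \<le> (2 * ?p) * r" using r1 pos by (intro mult_right_mono) auto
  \<comment> \<open>The number 8 in the definition of \<open>R1\<close> is exactly what turns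
    \<open>2 * ?p * r\<close> into half of \<open>r * \<kappa> r * fd r\<close> with
    \<open>fd r = ?p / 2\<close>, up to the factor \<open>R1 * (R1 - R0)\<close> cancelled
    below.\<close>
  also have "\<dots> = 8 * (?p * r / 4)" by simp
  also have "\<dots> \<le> (\<kappa> r * R\<^sub>1 * ?D) * (?p * r / 4)" using k pos by (intro mult_right_mono) auto
  finally have "(rate \<kappa> * f r) * (R\<^sub>1 * ?D) \<le> (1/2 * (r * \<kappa> r) * (?p / 2)) * (R\<^sub>1 * ?D)"
    by (simp add: algebra_simps)
  then have "rate \<kappa> * f r \<le> 1/2 * (r * \<kappa> r) * (?p / 2)"
    by (rule mult_right_le_imp_le) (use pos in simp)
  then show ?thesis unfolding gen_def fd_R1[OF assms] by simp
qed

text \<open>Because \<open>fd\<close> has a kink at R1, the bound on its derivative is replaced by a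
  bound on its increments: the mean value theorem below R1, constancy above, where
  \<open>gen_nonneg\<close> forces \<open>M \<ge> 0\<close>. On an interval below R1 the bound M may
  be negative.\<close>

lemma fd_diff_le:
  assumes s: "0 < s" "s \<le> s'" and M: "\<And>r. s \<le> r \<Longrightarrow> r \<le> s' \<Longrightarrow> gen r \<le> M"
  shows "fd s' - fd s \<le> 1/2 * M * (s' - s)"
proof -
  have below: "fd b - fd a \<le> 1/2 * M * (b - a)" if ab: "s \<le> a" "a \<le> b" "b \<le> s'" "b \<le> R\<^sub>1" for a b
  proof (cases "a = b")
    case False
    have "\<exists>l z. a < z \<and> z < b \<and> DERIV fd z :> l \<and> fd b - fd a = (b - a) * l"
    proof (rule MVT)
      show "a < b" using ab False by simp
      show "continuous_on {a..b} fd" by (rule continuous_on_subset[OF cont_fd]) (use ab s in auto)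
      fix x assume "a < x" "x < b"
      then have "\<exists>d. (fd has_real_derivative d) (at x) \<and> 2 * d \<le> gen x"
        using ab s by (intro fd_deriv_le) auto
      then show "fd differentiable (at x)" by (auto simp: real_differentiable_def)
    qed
    then obtain l z where z: "a < z" "z < b" "DERIV fd z :> l" "fd b - fd a = (b - a) * l" by blast
    obtain d where "DERIV fd z :> d" "2 * d \<le> gen z"
      using fd_deriv_le[of z] z ab s by auto
    moreover have "gen z \<le> M" using M z ab by auto
    ultimately have "l \<le> 1/2 * M" using DERIV_unique[OF z(3)] by force
    then show ?thesis using z ab by (simp add: mult.commute mult_right_mono)
  qed simp
  have above: "fd b - fd a \<le> 1/2 * M * (b - a)" if ab: "s \<le> a" "a \<le> b" "b \<le> s'" "R\<^sub>1 \<le> a" for a b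
  proof -
    have "0 \<le> M" using gen_nonneg[of a] M[of a] ab by auto
    then show ?thesis using ab by (simp add: fd_R1)
  qed
  show ?thesis
  proof (cases "s' \<le> R\<^sub>1 \<or> R\<^sub>1 \<le> s")
    case True then show ?thesis using below[of s s'] above[of s s'] s by auto
  next
    case False
    then show ?thesis using below[of s "R\<^sub>1"] above[of "R\<^sub>1" s'] s by (simp add: algebra_simps)
  qed
qed

text \<open>Comparison with a parabola: the derivative \<open>fd (r + v) - fd r - M * v / 2\<close>
  of \<open>h\<close> has, by \<open>fd_diff_le\<close>, the sign opposite to v, so \<open>h\<close>
  is largest at 0. The condition \<open>\<bar>u\<bar> < r\<close> keeps the segment in the positive
  half line.\<close>

lemma ffun_second_order:
  assumes "0 < r" "\<bar>u\<bar> < r" and M: "\<And>s. \<bar>s - r\<bar> \<le> \<bar>u\<bar> \<Longrightarrow> gen s \<le> M"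
  shows "f (r + u) \<le> f r + fd r * u + 1/4 * M * u\<^sup>2"
proof -
  define h where "h v = f (r + v) - f r - fd r * v - 1/4 * M * v\<^sup>2" for v
  have h': "(h has_real_derivative fd (r + v) - fd r - 1/2 * M * v) (at v)" if "\<bar>v\<bar> \<le> \<bar>u\<bar>" for v
  proof -
    have "(f has_real_derivative fd (r + v)) (at (r + v))"
      using ffun_deriv[of "r + v"] assms that by (simp add: has_real_derivative_within_atLeast)
    then have "((\<lambda>v. f (r + v)) has_real_derivative fd (r + v)) (at v)"
      using DERIV_shift[of f "fd (r + v)" v r] by (simp add: add.commute)
    then show ?thesis unfolding h_def[abs_def] by (auto intro!: derivative_eq_intros)
  qed
  have "h u \<le> h 0"
  proof (cases "0 \<le> u")
    case True
    show ?thesis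
    proof (rule DERIV_nonpos_imp_nonincreasing[OF True])
      fix v assume v: "0 \<le> v" "v \<le> u"
      have "fd (r + v) - fd r \<le> 1/2 * M * ((r + v) - r)"
        using assms v by (intro fd_diff_le M) auto
      then show "\<exists>y. DERIV h v :> y \<and> y \<le> 0" using h'[of v] v by (intro exI conjI) auto
    qed
  next
    case False
    show ?thesis
    proof (rule DERIV_nonneg_imp_nondecreasing[of u 0])
      fix v assume v: "u \<le> v" "v \<le> 0"
      have "fd r - fd (r + v) \<le> 1/2 * M * (r - (r + v))"
        using assms v False by (intro fd_diff_le M) auto
      then show "\<exists>y. DERIV h v :> y \<and> 0 \<le> y" using h'[of v] v False by (intro exI conjI) auto
    qed (use False in simp)
  qed
  then show ?thesis by (simp add: h_def)
qed

text \<open>Uniform continuity of \<open>gen\<close> on a compact interval allows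
  \<open>gen r + \<epsilon>\<close> as the bound, with one radius \<rho> for all r in
  [\<delta>, K].\<close>

lemma ffun_second_order_uniform:
  assumes "0 < \<delta>" "0 < \<epsilon>"
  obtains \<rho> where "0 < \<rho>" "\<rho> < \<delta>"
    "\<And>r u. \<delta> \<le> r \<Longrightarrow> r \<le> K \<Longrightarrow> \<bar>u\<bar> \<le> \<rho> \<Longrightarrow> f (r + u) \<le> f r + fd r * u + 1/4 * (gen r + \<epsilon>) * u\<^sup>2"
proof -
  have "uniformly_continuous_on {0..K+\<delta>} gen"
    by (intro compact_uniformly_continuous continuous_on_subset[OF cont_gen]) auto
  then obtain d where d: "0 < d" "\<And>r s. r \<in> {0..K+\<delta>} \<Longrightarrow> s \<in> {0..K+\<delta>} \<Longrightarrow> dist s r < d \<Longrightarrow> dist (gen s) (gen r) < \<epsilon>"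
    unfolding uniformly_continuous_on_def using assms by metis
  define \<rho> where "\<rho> = min d \<delta> / 2"
  show thesis
  proof (rule that[of \<rho>])
    show "0 < \<rho>" "\<rho> < \<delta>" using d assms by (auto simp: \<rho>_def)
    fix r u assume r: "\<delta> \<le> r" "r \<le> K" "\<bar>u\<bar> \<le> \<rho>"
    show "f (r + u) \<le> f r + fd r * u + 1/4 * (gen r + \<epsilon>) * u\<^sup>2"
    proof (rule ffun_second_order)
      show "0 < r" "\<bar>u\<bar> < r" using r \<open>\<rho> < \<delta>\<close> assms by auto
      fix s assume "\<bar>s - r\<bar> \<le> \<bar>u\<bar>"
      then have "dist (gen s) (gen r) < \<epsilon>"
        using r d(1) assms by (intro d) (auto simp: \<rho>_def dist_real_def min_def split: if_splits)
      then show "gen s \<le> gen r + \<epsilon>" by (auto simp: dist_real_def)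
    qed
  qed
qed

text \<open>Compactness on [0, R0] and the sign of \<open>\<kappa>\<close> beyond. Bounded repulsion
  is what limits the outward growth of the drift in \<open>drift_growth\<close>.\<close>

lemma r_kappa_bounded_below: obtains C where "0 \<le> C" "\<And>r. 0 < r \<Longrightarrow> - (r * \<kappa> r) \<le> C"
proof -
  have "compact (psi ` {0..R\<^sub>0})"
    by (intro compact_continuous_image continuous_on_subset[OF cont_psi]) auto
  then obtain C where C: "\<And>r. r \<in> {0..R\<^sub>0} \<Longrightarrow> psi r \<le> C"
    using compact_imp_bounded bounded_real by (metis abs_le_D1 imageI)
  show thesis
  proof (rule that[of "max C 0"])
    fix r :: real assume r: "0 < r"
    show "- (r * \<kappa> r) \<le> max C 0"
      using C[of r] psi_ge[of r] mult_nonneg_nonneg[of r "\<kappa> r"] kappa_nonneg[of r] r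
      by (cases "R\<^sub>0 \<le> r") (auto simp: le_max_iff_disj)
  qed simp
qed

lemma r_kappa_small: assumes "0 < \<epsilon>"
  obtains \<delta> where "0 < \<delta>" "\<And>r. 0 < r \<Longrightarrow> r < \<delta> \<Longrightarrow> - (r * \<kappa> r) \<le> \<epsilon>"
proof -
  have "eventually (\<lambda>r. dist (r * \<kappa> r) 0 < \<epsilon>) (at_right 0)"
    using tendstoD[OF lim_r_kappa assms] .
  then obtain \<delta> where "0 < \<delta>" "\<And>r. 0 < r \<Longrightarrow> r < \<delta> \<Longrightarrow> dist (r * \<kappa> r) 0 < \<epsilon>"
    by (auto simp: eventually_at_right_field)
  then show thesis using that[of \<delta>] by (force simp: dist_real_def)
qed

end

section \<open>Expansion of \<open>f\<close> along one Euler step in a single block\<close>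

lemma eventually_mult_le:
  fixes a A :: real
  assumes "0 < A"
  shows "eventually (\<lambda>h. h * a \<le> A) (at_right 0)"
proof -
  have "((\<lambda>h. h * a) \<longlongrightarrow> 0 * a) (at_right 0)" by (intro tendsto_intros)
  then have "eventually (\<lambda>h. h * a < A) (at_right 0)"
    by (rule order_tendstoD) (use assms in simp)
  then show ?thesis by eventually_elim simp
qed

text \<open>Completing the square. If v is of order h, the transverse part of a step changes the
  distance only by order \<open>h * h\<close>, so the distance moves like its radial part.\<close>

lemma norm_add_orthogonal_le:
  fixes e v :: "'a::real_inner"
  assumes "norm e = 1" "e \<bullet> v = 0" "0 < a"
  shows "norm (a *\<^sub>R e + v) \<le> a + (norm v)\<^sup>2 / (2 * a)"
proof (rule power2_le_imp_le)
  have "(norm (a *\<^sub>R e + v))\<^sup>2 = a\<^sup>2 + (norm v)\<^sup>2"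
    using assms by (simp add: power2_norm_eq_inner inner_add_left inner_add_right inner_commute)
      (simp add: power2_norm_eq_inner[symmetric] power2_eq_square)
  also have "\<dots> \<le> a\<^sup>2 + (norm v)\<^sup>2 + ((norm v)\<^sup>2 / (2 * a))\<^sup>2" by simp
  also have "\<dots> = (a + (norm v)\<^sup>2 / (2 * a))\<^sup>2"
    using assms by (simp add: power2_sum)
  finally show "(norm (a *\<^sub>R e + v))\<^sup>2 \<le> (a + (norm v)\<^sup>2 / (2 * a))\<^sup>2" .
qed (use assms in simp)

lemma (in contraction_profile) ffun_le_add:
  assumes "0 \<le> s" "0 \<le> r" "0 \<le> d" "s \<le> r + d"
  shows "f s \<le> f r + d"
  using ffun_mono[of s "r + d"] ffun_Lipschitz[of r "r + d"] assms by auto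

lemma (in contraction_profile) gen_bounded:
  obtains G where "0 \<le> G" "\<And>r. 0 \<le> r \<Longrightarrow> r \<le> K \<Longrightarrow> \<bar>gen r\<bar> \<le> G"
proof -
  have "compact (gen ` {0..K})"
    by (intro compact_continuous_image continuous_on_subset[OF cont_gen]) auto
  then obtain G where G: "\<And>r. r \<in> {0..K} \<Longrightarrow> \<bar>gen r\<bar> \<le> G"
    using compact_imp_bounded bounded_real by (metis imageI)
  show thesis
    by (rule that[of "max G 0"]) (use G in \<open>auto simp: le_max_iff_disj\<close>)
qed

text \<open>The displacement is split along the unit vector of z: the radial part \<open>u\<close>
  enters the second order expansion, the transverse part costs only \<open>h * h\<close>. The
  leading part of \<open>u\<^sup>2\<close> is \<open>4 * h * \<zeta>\<^sup>2\<close>, and the factor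
  1/4 of the expansion leaves \<open>h * (gen + \<epsilon>) * \<zeta>\<^sup>2\<close>. The estimate
  is pathwise, for every \<open>\<zeta>\<close> with
  \<open>sqrt h * \<bar>\<zeta>\<bar> \<le> \<rho>\<close>.\<close>

lemma (in contraction_profile) reflected_step:
  assumes "0 < \<delta>" "0 < \<epsilon>" "0 \<le> M"
  obtains \<rho> h0 where "0 < \<rho>" "0 < h0"
    "\<And>(z::'a::real_inner) \<Delta> \<zeta> h. \<delta> \<le> norm z \<Longrightarrow> norm z \<le> K \<Longrightarrow> norm \<Delta> \<le> M \<Longrightarrow> 0 < h \<Longrightarrow> h \<le> h0 \<Longrightarrow>
      sqrt h * \<bar>\<zeta>\<bar> \<le> \<rho> \<Longrightarrow>
      f (norm (z + h *\<^sub>R \<Delta> + (2 * sqrt h * \<zeta>) *\<^sub>R (z /\<^sub>R norm z))) \<le>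
      f (norm z) + fd (norm z) * (2 * sqrt h * \<zeta>)
        + h * (fd (norm z) * ((z /\<^sub>R norm z) \<bullet> \<Delta>) + (gen (norm z) + \<epsilon>) * \<zeta>\<^sup>2 + \<epsilon>)"
proof -
  obtain \<rho>0 where \<rho>0: "0 < \<rho>0" "\<rho>0 < \<delta> / 2"
    "\<And>r u. \<delta> / 2 \<le> r \<Longrightarrow> r \<le> K \<Longrightarrow> \<bar>u\<bar> \<le> \<rho>0 \<Longrightarrow> f (r + u) \<le> f r + fd r * u + 1/4 * (gen r + \<epsilon>) * u\<^sup>2"
    using ffun_second_order_uniform[of "\<delta> / 2" \<epsilon> K] assms by (metis half_gt_zero)
  obtain G where G: "0 \<le> G" "\<And>r. 0 \<le> r \<Longrightarrow> r \<le> K \<Longrightarrow> \<bar>gen r\<bar> \<le> G" using gen_bounded by blast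
  \<comment> \<open>D dominates the coefficient \<open>(G + \<epsilon>) * M\<close> of the remainder
    of \<open>u\<^sup>2\<close>, and \<open>D \<ge> 1\<close> makes it a safe divisor in
    \<rho>.\<close>
  define D where "D = (G + \<epsilon>) * (M + 1) + 1"
  have D_eq: "D = (G + \<epsilon>) * M + (G + \<epsilon>) + 1" by (simp add: D_def algebra_simps)
  have "0 \<le> (G + \<epsilon>) * M" "0 \<le> G + \<epsilon>" using G assms by auto
  then have D: "(G + \<epsilon>) * M \<le> D" "1 \<le> D" using D_eq by auto
  then have "0 < D" by simp
  note D = this D
  define \<rho> where "\<rho> = min (\<rho>0 / 4) (\<epsilon> / (4 * D))"
  have \<rho>: "0 < \<rho>" "\<rho> \<le> \<rho>0 / 4" "\<rho> * D \<le> \<epsilon> / 4"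
    using \<rho>0 assms D by (auto simp: \<rho>_def min_def field_simps)
  have "eventually (\<lambda>h. 0 < h \<and> h * (M + 1) \<le> \<rho>0 / 2 \<and> h * ((M + 1) * D) \<le> \<epsilon> \<and> h * (M + 1)\<^sup>2 \<le> \<epsilon> * \<delta> / 2) (at_right 0)"
    using \<rho>0 assms by (intro eventually_conj eventually_mult_le eventually_at_right_less) auto
  then obtain h0 where h0: "0 < h0" "h0 * (M + 1) \<le> \<rho>0 / 2" "h0 * (M + 1) * D \<le> \<epsilon>" "h0 * (M + 1)\<^sup>2 \<le> \<epsilon> * \<delta> / 2"
    using eventually_happens'[OF trivial_limit_at_right_real] by (auto simp: mult.assoc)
  show thesis
  proof (rule that[OF \<rho>(1) h0(1)])
    fix z \<Delta> :: 'a and \<zeta> h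
    assume z: "\<delta> \<le> norm z" "norm z \<le> K" and \<Delta>: "norm \<Delta> \<le> M" and h: "0 < h" "h \<le> h0"
      and \<zeta>: "sqrt h * \<bar>\<zeta>\<bar> \<le> \<rho>"
    define r where "r = norm z"
    define e where "e = z /\<^sub>R r"
    define \<beta> where "\<beta> = e \<bullet> \<Delta>"
    define v where "v = h *\<^sub>R (\<Delta> - \<beta> *\<^sub>R e)"
    define u where "u = 2 * sqrt h * \<zeta> + h * \<beta>"
    have r: "0 < r" "\<delta> \<le> r" "r \<le> K" using z assms by (auto simp: r_def)
    have e: "norm e = 1" "e \<bullet> e = 1" using r by (auto simp: e_def r_def dot_square_norm power2_eq_square)
    have \<beta>: "\<bar>\<beta>\<bar> \<le> M"
      using Cauchy_Schwarz_ineq2[of e \<Delta>] e \<Delta> by (simp add: \<beta>_def)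
    have hM: "h * M \<le> \<rho>0 / 2" "h * M * D \<le> \<epsilon>" "h * M\<^sup>2 \<le> \<epsilon> * \<delta> / 2"
    proof -
      have *: "h * M \<le> h0 * (M + 1)" "h * M\<^sup>2 \<le> h0 * (M + 1)\<^sup>2" using h assms by (intro mult_mono power_mono; simp)+
      then show "h * M \<le> \<rho>0 / 2" "h * M\<^sup>2 \<le> \<epsilon> * \<delta> / 2" using h0 by linarith+
      have "h * M * D \<le> h0 * (M + 1) * D" using * D by (intro mult_right_mono) auto
      then show "h * M * D \<le> \<epsilon>" using h0 by linarith
    qed
    have h\<beta>: "\<bar>h * \<beta>\<bar> \<le> h * M" using \<beta> h by (simp add: abs_mult)
    have u: "\<bar>u\<bar> \<le> \<rho>0"
    proof -
      have "\<bar>u\<bar> \<le> 2 * (sqrt h * \<bar>\<zeta>\<bar>) + \<bar>h * \<beta>\<bar>"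
        unfolding u_def using h by (intro order_trans[OF abs_triangle_ineq]) (simp add: abs_mult)
      then show ?thesis using \<zeta> \<rho> h\<beta> hM by linarith
    qed
    have a: "\<delta> / 2 \<le> r + u" using u \<rho>0 r by linarith
    have v: "e \<bullet> v = 0" "norm v \<le> h * M"
    proof -
      show "e \<bullet> v = 0" by (simp add: v_def inner_diff_right e \<beta>_def)
      have "(norm (\<Delta> - \<beta> *\<^sub>R e))\<^sup>2 = (norm \<Delta>)\<^sup>2 - \<beta>\<^sup>2"
      proof -
        have "\<Delta> \<bullet> e = \<beta>" "e \<bullet> \<Delta> = \<beta>" by (simp_all add: \<beta>_def inner_commute)
        then show ?thesis
          unfolding power2_norm_eq_inner
          by (simp add: inner_diff_left inner_diff_right e(2)) (simp add: power2_eq_square)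
      qed
      then have "(norm (\<Delta> - \<beta> *\<^sub>R e))\<^sup>2 \<le> (norm \<Delta>)\<^sup>2" by simp
      then have "norm (\<Delta> - \<beta> *\<^sub>R e) \<le> norm \<Delta>" by (rule power2_le_imp_le) simp
      then show "norm v \<le> h * M" using \<Delta> h by (simp add: v_def)
    qed
    have "z + h *\<^sub>R \<Delta> + (2 * sqrt h * \<zeta>) *\<^sub>R e = (r + u) *\<^sub>R e + v"
      using r by (simp add: u_def v_def scaleR_add_left scaleR_diff_right) (simp add: e_def)
    also have "norm \<dots> \<le> (r + u) + (norm v)\<^sup>2 / (2 * (r + u))"
      using a assms by (intro norm_add_orthogonal_le e v) auto
    also have "\<dots> \<le> (r + u) + h * (\<epsilon> / 2)"
    proof -
      have "(norm v)\<^sup>2 / (2 * (r + u)) \<le> (h * M)\<^sup>2 / \<delta>"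
        using v a assms by (intro frac_le power_mono) auto
      also have "\<dots> = h * (h * M\<^sup>2) / \<delta>" by (simp add: power2_eq_square)
      also have "\<dots> \<le> h * (\<epsilon> * \<delta> / 2) / \<delta>"
        using hM h assms by (intro divide_right_mono mult_left_mono) auto
      finally show ?thesis using assms by simp
    qed
    finally have "f (norm (z + h *\<^sub>R \<Delta> + (2 * sqrt h * \<zeta>) *\<^sub>R e)) \<le> f (r + u) + h * (\<epsilon> / 2)"
      using a assms h by (intro ffun_le_add) auto
    also have "f (r + u) \<le> f r + fd r * u + 1/4 * (gen r + \<epsilon>) * u\<^sup>2"
      using \<rho>0(3)[of r u] r u assms by auto
    also have "1/4 * (gen r + \<epsilon>) * u\<^sup>2 \<le> h * ((gen r + \<epsilon>) * \<zeta>\<^sup>2) + h * (\<epsilon> / 2)"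
    proof -
      have G': "\<bar>gen r + \<epsilon>\<bar> \<le> G + \<epsilon>" using G(2)[of r] r assms by auto
      have "u\<^sup>2 = 4 * (h * \<zeta>\<^sup>2) + h * (4 * (sqrt h * \<zeta>) * \<beta> + h * \<beta>\<^sup>2)"
        using h by (simp add: u_def power2_sum power_mult_distrib algebra_simps) (simp add: power2_eq_square)
      then have "1/4 * (gen r + \<epsilon>) * u\<^sup>2 =
          h * ((gen r + \<epsilon>) * \<zeta>\<^sup>2) + h * ((gen r + \<epsilon>) * (sqrt h * \<zeta> * \<beta> + h * \<beta>\<^sup>2 / 4))"
        by (simp add: field_simps)
      moreover have "h * ((gen r + \<epsilon>) * (sqrt h * \<zeta> * \<beta> + h * \<beta>\<^sup>2 / 4)) \<le> h * (\<epsilon> / 2)"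
      proof -
        have "\<bar>sqrt h * \<zeta> * \<beta>\<bar> \<le> \<rho> * M"
          using \<zeta> \<beta> h \<rho> by (simp add: abs_mult mult_mono)
        moreover have "\<bar>h * \<beta>\<^sup>2 / 4\<bar> \<le> (h * M) * M / 4"
          using h\<beta> \<beta> h mult_mono[OF h\<beta> \<beta>] assms by (simp add: power2_eq_square abs_mult mult.assoc)
        ultimately have "\<bar>sqrt h * \<zeta> * \<beta> + h * \<beta>\<^sup>2 / 4\<bar> \<le> M * (\<rho> + h * M / 4)"
          by (simp add: algebra_simps)
        then have "\<bar>(gen r + \<epsilon>) * (sqrt h * \<zeta> * \<beta> + h * \<beta>\<^sup>2 / 4)\<bar> \<le> (G + \<epsilon>) * (M * (\<rho> + h * M / 4))"
          unfolding abs_mult using G' by (intro mult_mono) auto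
        also have "\<dots> = ((G + \<epsilon>) * M) * (\<rho> + h * M / 4)" by simp
        also have "\<dots> \<le> D * (\<rho> + h * M / 4)"
          using D \<rho> h assms by (intro mult_right_mono add_nonneg_nonneg) auto
        also have "\<dots> = \<rho> * D + h * M * D / 4" by (simp add: algebra_simps)
        also have "\<dots> \<le> \<epsilon> / 2" using \<rho> hM by linarith
        finally have "(gen r + \<epsilon>) * (sqrt h * \<zeta> * \<beta> + h * \<beta>\<^sup>2 / 4) \<le> \<epsilon> / 2" by linarith
        then show ?thesis using h by (intro mult_left_mono) auto
      qed
      ultimately show ?thesis by linarith
    qed
    finally have "f (norm (z + h *\<^sub>R \<Delta> + (2 * sqrt h * \<zeta>) *\<^sub>R e)) \<le>
       f r + fd r * u + h * ((gen r + \<epsilon>) * \<zeta>\<^sup>2) + h * \<epsilon>" by (simp add: algebra_simps)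
    also have "\<dots> = f r + fd r * (2 * sqrt h * \<zeta>) + h * (fd r * \<beta> + (gen r + \<epsilon>) * \<zeta>\<^sup>2 + \<epsilon>)"
      by (simp add: u_def algebra_simps)
    finally show "f (norm (z + h *\<^sub>R \<Delta> + (2 * sqrt h * \<zeta>) *\<^sub>R (z /\<^sub>R norm z))) \<le>
      f (norm z) + fd (norm z) * (2 * sqrt h * \<zeta>)
        + h * (fd (norm z) * ((z /\<^sub>R norm z) \<bullet> \<Delta>) + (gen (norm z) + \<epsilon>) * \<zeta>\<^sup>2 + \<epsilon>)"
      by (simp only: e_def r_def \<beta>_def)
  qed
qed

text \<open>The noise cancels in the difference. Comparing squares avoids a division by
  \<open>norm z\<close>, so that coinciding blocks are covered too.\<close>

lemma (in contraction_profile) synchronous_step: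
  fixes z \<Delta>\<^sub>0 \<Delta>\<^sub>1 :: "'a::real_inner"
  assumes "norm \<Delta>\<^sub>0 \<le> L * norm z" "2 * (z \<bullet> \<Delta>\<^sub>0) \<le> \<omega> * norm z" "0 \<le> \<omega>" "0 \<le> h"
  shows "f (norm (z + h *\<^sub>R (\<Delta>\<^sub>0 + \<Delta>\<^sub>1))) \<le> f (norm z) + h * (\<omega> / 2 + h * L\<^sup>2 * norm z / 2 + norm \<Delta>\<^sub>1)"
proof (rule ffun_le_add)
  let ?r = "norm z" and ?p = "h * (\<omega> / 2 + h * L\<^sup>2 * norm z / 2)"
  have "norm (z + h *\<^sub>R \<Delta>\<^sub>0) \<le> ?r + ?p"
  proof (rule power2_le_imp_le)
    have "(norm (z + h *\<^sub>R \<Delta>\<^sub>0))\<^sup>2 = ?r\<^sup>2 + h * (2 * (z \<bullet> \<Delta>\<^sub>0)) + h\<^sup>2 * (norm \<Delta>\<^sub>0)\<^sup>2"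
      unfolding power2_norm_eq_inner
      by (simp add: inner_add_left inner_add_right inner_commute power2_eq_square)
    also have "\<dots> \<le> ?r\<^sup>2 + h * (\<omega> * ?r) + h\<^sup>2 * (L * ?r)\<^sup>2"
      using assms by (intro add_mono mult_left_mono power_mono) auto
    also have "\<dots> = ?r\<^sup>2 + 2 * ?r * ?p" by (simp add: power2_eq_square algebra_simps)
    also have "\<dots> \<le> (?r + ?p)\<^sup>2" by (simp add: power2_sum)
    finally show "(norm (z + h *\<^sub>R \<Delta>\<^sub>0))\<^sup>2 \<le> (?r + ?p)\<^sup>2" .
  qed (use assms in auto)
  moreover have "norm (z + h *\<^sub>R (\<Delta>\<^sub>0 + \<Delta>\<^sub>1)) \<le> norm (z + h *\<^sub>R \<Delta>\<^sub>0) + h * norm \<Delta>\<^sub>1"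
    using norm_triangle_ineq[of "z + h *\<^sub>R \<Delta>\<^sub>0" "h *\<^sub>R \<Delta>\<^sub>1"] assms by (simp add: scaleR_add_right add.assoc)
  ultimately show "norm (z + h *\<^sub>R (\<Delta>\<^sub>0 + \<Delta>\<^sub>1)) \<le> ?r + h * (\<omega> / 2 + h * L\<^sup>2 * norm z / 2 + norm \<Delta>\<^sub>1)"
    by (simp add: distrib_left)
qed (use assms in auto)

text \<open>Reflection coupling at distance at least \<open>\<delta>\<close>, synchronous coupling below; the terms with
  \<open>\<zeta>\<close> and \<open>\<zeta>\<^sup>2 - 1\<close> are centred when \<open>\<zeta>\<close> is standard normal.\<close>

definition (in contraction_profile) step_estimate ::
  "real \<Rightarrow> real \<Rightarrow> real \<Rightarrow> real \<Rightarrow> 'a::real_inner \<Rightarrow> 'a \<Rightarrow> 'a \<Rightarrow> bool" where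
  "step_estimate \<delta> \<epsilon> h \<zeta> z \<Delta>\<^sub>0 \<Delta>\<^sub>1 \<longleftrightarrow>
     f (norm (z + h *\<^sub>R (\<Delta>\<^sub>0 + \<Delta>\<^sub>1) + (2 * sqrt h * \<zeta>) *\<^sub>R (if \<delta> \<le> norm z then z /\<^sub>R norm z else 0))) \<le>
     f (norm z) + (if \<delta> \<le> norm z then fd (norm z) * (2 * sqrt h * \<zeta>) + h * ((gen (norm z) + \<epsilon> / 2) * (\<zeta>\<^sup>2 - 1)) else 0)
       + h * (norm \<Delta>\<^sub>1 - rate \<kappa> * f (norm z) + \<epsilon>)"

text \<open>Every \<delta> below \<delta>0 is admissible, so that a single threshold can later serve
  all blocks; \<rho> and h0 are chosen after it.\<close>

lemma (in contraction_profile) coupled_step: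
  assumes "0 < \<epsilon>" and KLM: "0 \<le> K" "0 \<le> L" "0 \<le> M"
  shows "\<exists>\<delta>0>0. \<forall>\<delta>. 0 < \<delta> \<longrightarrow> \<delta> \<le> \<delta>0 \<longrightarrow> (\<exists>\<rho>>0. \<exists>h0>0.
      \<forall>(z::'a::real_inner) \<Delta>\<^sub>0 \<Delta>\<^sub>1 \<zeta> h. norm z \<le> K \<longrightarrow> norm \<Delta>\<^sub>0 \<le> L * norm z \<longrightarrow> norm \<Delta>\<^sub>1 \<le> M \<longrightarrow>
        (z \<noteq> 0 \<longrightarrow> 2 * (z \<bullet> \<Delta>\<^sub>0) \<le> - ((norm z)\<^sup>2 * \<kappa> (norm z))) \<longrightarrow> 0 < h \<longrightarrow> h \<le> h0 \<longrightarrow> sqrt h * \<bar>\<zeta>\<bar> \<le> \<rho> \<longrightarrow>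
        step_estimate \<delta> \<epsilon> h \<zeta> z \<Delta>\<^sub>0 \<Delta>\<^sub>1)"
    (is "\<exists>\<delta>0>0. \<forall>\<delta>. 0 < \<delta> \<longrightarrow> \<delta> \<le> \<delta>0 \<longrightarrow> ?Q \<delta>")
proof -
  obtain \<delta>1 where \<delta>1: "0 < \<delta>1" "\<And>r. 0 < r \<Longrightarrow> r < \<delta>1 \<Longrightarrow> - (r * \<kappa> r) \<le> \<epsilon> / 2"
    using r_kappa_small[of "\<epsilon> / 2"] assms by auto
  \<comment> \<open>Below \<delta> the coupling does not produce the decay
    \<open>rate \<kappa> * f\<close>; the second entry makes this term at most \<epsilon> / 4, so
    that it is paid out of \<epsilon>.\<close>
  define \<delta>0 where "\<delta>0 = min \<delta>1 (\<epsilon> / (4 * rate \<kappa>))"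
  have "0 < \<delta>0" using \<delta>1 assms rate_pos by (simp add: \<delta>0_def)
  moreover have "\<forall>\<delta>. 0 < \<delta> \<longrightarrow> \<delta> \<le> \<delta>0 \<longrightarrow> ?Q \<delta>"
  proof (rule allI, rule impI, rule impI)
    fix \<delta> :: real assume \<delta>: "0 < \<delta>" "\<delta> \<le> \<delta>0"
    obtain \<rho> h0 where rf: "0 < \<rho>" "0 < h0"
      "\<And>(z::'a::real_inner) \<Delta> \<zeta> h. \<delta> \<le> norm z \<Longrightarrow> norm z \<le> K \<Longrightarrow> norm \<Delta> \<le> L * K + M \<Longrightarrow> 0 < h \<Longrightarrow> h \<le> h0 \<Longrightarrow>
        sqrt h * \<bar>\<zeta>\<bar> \<le> \<rho> \<Longrightarrow>
        f (norm (z + h *\<^sub>R \<Delta> + (2 * sqrt h * \<zeta>) *\<^sub>R (z /\<^sub>R norm z))) \<le>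
        f (norm z) + fd (norm z) * (2 * sqrt h * \<zeta>)
          + h * (fd (norm z) * ((z /\<^sub>R norm z) \<bullet> \<Delta>) + (gen (norm z) + \<epsilon> / 2) * \<zeta>\<^sup>2 + \<epsilon> / 2)"
      using reflected_step[of \<delta> "\<epsilon> / 2" "L * K + M" K, where 'a='a] \<delta> assms KLM by auto
    \<comment> \<open>The second entry bounds the term \<open>h * L\<^sup>2 * norm z\<close> of the
      synchronous step by \<epsilon>; the summand 1 keeps the denominator positive when L =
      0.\<close>
    define h1 where "h1 = min h0 (\<epsilon> / (L\<^sup>2 * \<delta> + 1))"
    have L\<delta>: "0 < L\<^sup>2 * \<delta> + 1" using \<delta> by (simp add: add_nonneg_pos)
    then have h1: "0 < h1" "h1 \<le> h0" using rf(2) assms by (auto simp: h1_def)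
    have "h1 \<le> \<epsilon> / (L\<^sup>2 * \<delta> + 1)" by (simp add: h1_def)
    then have h1': "h1 * (L\<^sup>2 * \<delta> + 1) \<le> \<epsilon>" unfolding pos_le_divide_eq[OF L\<delta>] .
    show "?Q \<delta>"
    proof (intro exI conjI allI impI)
      fix z \<Delta>\<^sub>0 \<Delta>\<^sub>1 :: 'a and \<zeta> h :: real
      assume z: "norm z \<le> K" and \<Delta>: "norm \<Delta>\<^sub>0 \<le> L * norm z" "norm \<Delta>\<^sub>1 \<le> M"
        and z\<Delta>: "z \<noteq> 0 \<longrightarrow> 2 * (z \<bullet> \<Delta>\<^sub>0) \<le> - ((norm z)\<^sup>2 * \<kappa> (norm z))"
        and h: "0 < h" "h \<le> h1" and \<zeta>: "sqrt h * \<bar>\<zeta>\<bar> \<le> \<rho>"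
      show "step_estimate \<delta> \<epsilon> h \<zeta> z \<Delta>\<^sub>0 \<Delta>\<^sub>1"
      proof (cases "\<delta> \<le> norm z")
        case True
        define r where "r = norm z"
        define e where "e = z /\<^sub>R r"
        have r: "0 < r" using True \<delta> unfolding r_def by linarith
        have ne: "norm e = 1" using r by (simp add: e_def r_def)
        have "norm (\<Delta>\<^sub>0 + \<Delta>\<^sub>1) \<le> L * K + M"
          using \<Delta> z KLM mult_left_mono[OF z, of L] norm_triangle_ineq[of \<Delta>\<^sub>0 \<Delta>\<^sub>1] by linarith
        then have "f (norm (z + h *\<^sub>R (\<Delta>\<^sub>0 + \<Delta>\<^sub>1) + (2 * sqrt h * \<zeta>) *\<^sub>R (z /\<^sub>R norm z))) \<le>
          f r + fd r * (2 * sqrt h * \<zeta>)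
            + h * (fd r * (e \<bullet> (\<Delta>\<^sub>0 + \<Delta>\<^sub>1)) + (gen r + \<epsilon> / 2) * \<zeta>\<^sup>2 + \<epsilon> / 2)"
          unfolding r_def e_def using True z h h1 \<zeta> by (intro rf(3)) auto
        also have "fd r * (e \<bullet> (\<Delta>\<^sub>0 + \<Delta>\<^sub>1)) \<le> norm \<Delta>\<^sub>1 - 1/2 * (r * \<kappa> r) * fd r"
        proof -
          have "e \<bullet> \<Delta>\<^sub>0 \<le> - (1/2 * (r * \<kappa> r))"
          proof -
            have "2 * (z \<bullet> \<Delta>\<^sub>0) \<le> - (r\<^sup>2 * \<kappa> r)" using z\<Delta> r by (auto simp: r_def)
            then have "inverse r * (2 * (z \<bullet> \<Delta>\<^sub>0)) \<le> inverse r * (- (r\<^sup>2 * \<kappa> r))"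
              using r by (intro mult_left_mono) auto
            moreover have "inverse r * (- (r\<^sup>2 * \<kappa> r)) = - (r * \<kappa> r)" using r by (simp add: power2_eq_square)
            moreover have "inverse r * (2 * (z \<bullet> \<Delta>\<^sub>0)) = 2 * (e \<bullet> \<Delta>\<^sub>0)" by (simp add: e_def)
            ultimately show ?thesis by linarith
          qed
          moreover have "e \<bullet> \<Delta>\<^sub>1 \<le> norm \<Delta>\<^sub>1"
            using norm_cauchy_schwarz[of e \<Delta>\<^sub>1] ne by simp
          moreover have "fd r * norm \<Delta>\<^sub>1 \<le> norm \<Delta>\<^sub>1"
            using mult_right_mono[OF fd_le_1[of r], of "norm \<Delta>\<^sub>1"] r by simp
          ultimately show ?thesis
            using mult_left_mono[of "e \<bullet> \<Delta>\<^sub>0" "- (1/2 * (r * \<kappa> r))" "fd r"]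
              mult_left_mono[of "e \<bullet> \<Delta>\<^sub>1" "norm \<Delta>\<^sub>1" "fd r"] fd_nonneg[of r] r
            by (simp add: inner_add_right distrib_left mult.commute)
        qed
        finally have "f (norm (z + h *\<^sub>R (\<Delta>\<^sub>0 + \<Delta>\<^sub>1) + (2 * sqrt h * \<zeta>) *\<^sub>R (z /\<^sub>R norm z))) \<le>
          f r + fd r * (2 * sqrt h * \<zeta>)
            + h * ((norm \<Delta>\<^sub>1 - 1/2 * (r * \<kappa> r) * fd r) + (gen r + \<epsilon> / 2) * \<zeta>\<^sup>2 + \<epsilon> / 2)"
          using h by (simp add: mult_left_mono)
        also have "(norm \<Delta>\<^sub>1 - 1/2 * (r * \<kappa> r) * fd r) + (gen r + \<epsilon> / 2) * \<zeta>\<^sup>2 + \<epsilon> / 2 =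
           (gen r + \<epsilon> / 2) * (\<zeta>\<^sup>2 - 1) + (norm \<Delta>\<^sub>1 - rate \<kappa> * f r + \<epsilon>)"
        proof -
          \<comment> \<open>\<open>gen\<close> is made for this cancellation: drift and second order
            term together leave \<open>- rate \<kappa> * f r\<close> and a centred part.\<close>
          have g: "1/2 * (r * \<kappa> r) * fd r = gen r + rate \<kappa> * f r" by (simp add: gen_def)
          show ?thesis unfolding g by (simp add: algebra_simps)
        qed
        finally show ?thesis using True by (simp add: step_estimate_def r_def distrib_left)
      next
        case False
        have "f (norm (z + h *\<^sub>R (\<Delta>\<^sub>0 + \<Delta>\<^sub>1))) \<le> f (norm z) + h * (\<epsilon> / 2 / 2 + h * L\<^sup>2 * norm z / 2 + norm \<Delta>\<^sub>1)"
        proof (rule synchronous_step)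
          show "2 * (z \<bullet> \<Delta>\<^sub>0) \<le> \<epsilon> / 2 * norm z"
          proof (cases "z = 0")
            case nz: False
            have "- (norm z * \<kappa> (norm z)) \<le> \<epsilon> / 2"
              using nz False \<delta> by (intro \<delta>1) (auto simp: \<delta>0_def)
            then have "- (norm z * \<kappa> (norm z)) * norm z \<le> \<epsilon> / 2 * norm z" by (intro mult_right_mono) auto
            then show ?thesis using z\<Delta> nz by (simp add: power2_eq_square mult_ac)
          qed simp
        qed (use \<Delta> assms h in auto)
        also have "\<epsilon> / 2 / 2 + h * L\<^sup>2 * norm z / 2 + norm \<Delta>\<^sub>1 \<le> norm \<Delta>\<^sub>1 - rate \<kappa> * f (norm z) + \<epsilon>"
        proof -
          have "rate \<kappa> * f (norm z) \<le> rate \<kappa> * \<delta>"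
            using ffun_le[of "norm z"] False rate_pos by (intro mult_left_mono) auto
          also have "\<dots> \<le> \<epsilon> / 4" using \<delta> rate_pos by (auto simp: \<delta>0_def field_simps)
          finally have "rate \<kappa> * f (norm z) \<le> \<epsilon> / 4" .
          moreover have "h * L\<^sup>2 * norm z \<le> \<epsilon>"
          proof -
            have "h * (L\<^sup>2 * norm z) \<le> h1 * (L\<^sup>2 * \<delta> + 1)"
              using h False \<delta> mult_left_mono[of "norm z" \<delta> "L\<^sup>2"] by (intro mult_mono) auto
            then show ?thesis using h1' by (simp add: mult.assoc)
          qed
          ultimately show ?thesis by linarith
        qed
        finally show ?thesis using False h by (simp add: step_estimate_def mult_left_mono)
      qed
    qed (use rf h1 in auto)
  qed
  ultimately show ?thesis by blast
qed

section \<open>The standard Gaussian measure\<close>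

lemma distr_lborel_plus: "distr lborel borel (\<lambda>x. x + c) = (lborel :: 'a::euclidean_space measure)"
  using lborel_distr_plus[of c] by (simp add: add.commute cong: distr_cong)

lemma nn_integral_lborel_translate:
  assumes [measurable]: "f \<in> borel_measurable (borel :: 'a::euclidean_space measure)"
  shows "(\<integral>\<^sup>+ x. f (x + c) \<partial>lborel) = (\<integral>\<^sup>+ x. f x \<partial>lborel)"
  by (subst (2) distr_lborel_plus[of c, symmetric]) (simp add: nn_integral_distr)

lemma nn_integral_lborel_uminus:
  assumes [measurable]: "f \<in> borel_measurable (borel :: 'a::euclidean_space measure)"
  shows "(\<integral>\<^sup>+ x. f (- x) \<partial>lborel) = (\<integral>\<^sup>+ x. f x \<partial>lborel)"
proof -
  have "(lborel :: 'a measure) = density (distr lborel borel (\<lambda>x. 0 + (-1) *\<^sub>R x)) (\<lambda>_. ennreal (\<bar>-1\<bar>^DIM('a)))"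
    by (rule lborel_affine) simp
  then have "(\<integral>\<^sup>+ x. f x \<partial>lborel) = (\<integral>\<^sup>+ x. f x \<partial>distr lborel borel (\<lambda>x. 0 + (-1) *\<^sub>R x))"
    by (simp add: density_1)
  then show ?thesis by (simp add: nn_integral_distr)
qed

text \<open>Uniqueness of Haar measure by Fubini: a translation invariant \<open>\<nu>\<close> satisfies
  \<open>\<nu> A * lborel B = \<nu> B * lborel A\<close>.\<close>

lemma distr_lborel_orthogonal:
  fixes T :: "'a::euclidean_space \<Rightarrow> 'a"
  assumes T: "orthogonal_transformation T"
  shows "distr lborel borel T = lborel"
proof -
  have lin: "linear T" and surj: "surj T"
    using T by (simp_all add: orthogonal_transformation_linear orthogonal_transformation_surj)
  have [measurable]: "T \<in> borel_measurable borel"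
    using lin by (intro borel_measurable_continuous_onI linear_continuous_on) (simp add: linear_conv_bounded_linear)
  define \<nu> where "\<nu> = distr lborel borel T"
  have [measurable_cong]: "sets \<nu> = sets borel" by (simp add: \<nu>_def)
  \<comment> \<open>An orthogonal map preserves centred balls. This makes \<open>\<nu>\<close>
    sigma-finite and fixes the proportionality constant as 1.\<close>
  have ball: "emeasure \<nu> (ball 0 n) = emeasure lborel (ball (0::'a) n)" for n
  proof -
    have "T -` ball 0 n = ball 0 n"
      using T by (auto simp: orthogonal_transformation_norm)
    then show ?thesis unfolding \<nu>_def using emeasure_distr[of T lborel borel "ball 0 n"] by simp
  qed
  interpret \<nu>: sigma_finite_measure \<nu>
  proof
    show "\<exists>A. countable A \<and> A \<subseteq> sets \<nu> \<and> \<Union>A = space \<nu> \<and> (\<forall>a\<in>A. emeasure \<nu> a \<noteq> \<infinity>)"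
      by (intro exI[of _ "range (\<lambda>n::nat. ball 0 (real n))"])
         (auto simp: ball[unfolded \<nu>_def] less_imp_neq[OF emeasure_lborel_ball_finite, simplified] \<nu>_def intro: reals_Archimedean2)
  qed
  interpret P: pair_sigma_finite \<nu> "lborel :: 'a measure" ..
  have \<nu>_translate: "(\<integral>\<^sup>+ x. f (x + c) \<partial>\<nu>) = (\<integral>\<^sup>+ x. f x \<partial>\<nu>)"
    if [measurable]: "f \<in> borel_measurable borel" for f :: "'a \<Rightarrow> ennreal" and c
  proof -
    obtain c' where "c = T c'" using surj by (metis surjD)
    then have "(\<integral>\<^sup>+ x. f (x + c) \<partial>\<nu>) = (\<integral>\<^sup>+ x. f (T (x + c')) \<partial>lborel)"
      unfolding \<nu>_def by (simp add: nn_integral_distr linear_add[OF lin])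
    also have "\<dots> = (\<integral>\<^sup>+ x. f x \<partial>\<nu>)"
      unfolding \<nu>_def by (subst nn_integral_lborel_translate[of "\<lambda>x. f (T x)"]) (simp_all add: nn_integral_distr)
    finally show ?thesis .
  qed
  have cross: "emeasure \<nu> A * emeasure lborel B = emeasure \<nu> B * emeasure lborel A"
    if [measurable]: "A \<in> sets borel" "B \<in> sets borel" for A B :: "'a set"
  proof -
    let ?a = "indicator A :: 'a \<Rightarrow> ennreal" and ?b = "indicator B :: 'a \<Rightarrow> ennreal"
    have "emeasure \<nu> A * emeasure lborel B = (\<integral>\<^sup>+ x. ?a x * emeasure lborel B \<partial>\<nu>)"
      by (simp add: nn_integral_multc)
    also have "\<dots> = (\<integral>\<^sup>+ x. \<integral>\<^sup>+ y. ?a x * ?b (y + x) \<partial>lborel \<partial>\<nu>)"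
      by (subst nn_integral_lborel_translate[of "\<lambda>y. ?a _ * ?b y"]) (simp_all add: nn_integral_cmult)
    also have "\<dots> = (\<integral>\<^sup>+ y. \<integral>\<^sup>+ x. ?a x * ?b (y + x) \<partial>\<nu> \<partial>lborel)"
      by (rule P.Fubini'[symmetric]) measurable
    also have "\<dots> = (\<integral>\<^sup>+ y. \<integral>\<^sup>+ x. ?a (x - y) * ?b x \<partial>\<nu> \<partial>lborel)"
    proof (rule nn_integral_cong)
      fix y
      show "(\<integral>\<^sup>+ x. ?a x * ?b (y + x) \<partial>\<nu>) = (\<integral>\<^sup>+ x. ?a (x - y) * ?b x \<partial>\<nu>)"
        by (subst \<nu>_translate[of "\<lambda>x. ?a (x - y) * ?b x" y, symmetric]) (simp_all add: add.commute)
    qed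
    also have "\<dots> = (\<integral>\<^sup>+ x. \<integral>\<^sup>+ y. ?a (x - y) * ?b x \<partial>lborel \<partial>\<nu>)"
      by (rule P.Fubini') measurable
    also have "\<dots> = (\<integral>\<^sup>+ x. ?b x * emeasure lborel A \<partial>\<nu>)"
    proof (rule nn_integral_cong)
      fix x
      have "(\<integral>\<^sup>+ y. ?a (x - y) * ?b x \<partial>lborel) = (\<integral>\<^sup>+ y. ?a (x + y) * ?b x \<partial>lborel)"
        by (subst nn_integral_lborel_uminus[of "\<lambda>y. ?a (x + y) * ?b x", symmetric]) simp_all
      also have "\<dots> = (\<integral>\<^sup>+ y. ?a y * ?b x \<partial>lborel)"
        by (subst nn_integral_lborel_translate[of "\<lambda>y. ?a y * ?b x" x, symmetric]) (simp_all add: add.commute)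
      also have "\<dots> = ?b x * emeasure lborel A"
        by (simp add: nn_integral_multc mult.commute)
      finally show "(\<integral>\<^sup>+ y. ?a (x - y) * ?b x \<partial>lborel) = ?b x * emeasure lborel A" .
    qed
    also have "\<dots> = emeasure \<nu> B * emeasure lborel A"
      by (simp add: nn_integral_multc)
    finally show ?thesis .
  qed
  have "\<nu> = lborel"
  proof (rule measure_eqI)
    fix A assume "A \<in> sets \<nu>"
    then have "emeasure \<nu> A * emeasure lborel (ball (0::'a) 1) = emeasure lborel A * emeasure lborel (ball (0::'a) 1)"
      using cross[of A "ball 0 1"] ball[of 1] by (simp add: mult.commute \<nu>_def)
    moreover have "emeasure lborel (ball (0::'a) 1) \<noteq> 0" "emeasure lborel (ball (0::'a) 1) \<noteq> \<infinity>"
      using emeasure_lborel_ball_finite[of "0::'a" 1] content_ball_pos[of 1 "0::'a"]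
      by (auto simp: measure_def)
    ultimately show "emeasure \<nu> A = emeasure lborel A"
      using ennreal_mult_cancel_left[of "emeasure lborel (ball (0::'a) 1)" "emeasure \<nu> A" "emeasure lborel A"]
      by (auto simp: mult.commute)
  qed (simp add: \<nu>_def)
  then show ?thesis by (simp add: \<nu>_def)
qed

text \<open>The product form of the density gives the law of boxes and coordinates; that the same
  density depends only on the norm gives invariance under rotations.\<close>

definition gauss :: "'a::euclidean_space measure" where
  "gauss = density lborel (\<lambda>x. ennreal (\<Prod>b\<in>Basis. std_normal_density (x \<bullet> b)))"

abbreviation "std_normal \<equiv> density lborel (\<lambda>x. ennreal (std_normal_density x))"

lemma sets_gauss [simp, measurable_cong]: "sets gauss = sets borel"
  by (simp add: gauss_def)

lemma space_gauss [simp]: "space gauss = UNIV"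
  by (simp add: gauss_def)

lemma prob_std_normal: "prob_space std_normal"
  using prob_space_normal_density[of 1 0] by simp

lemma emeasure_gauss_box:
  assumes [measurable]: "\<And>b. A b \<in> sets borel"
  shows "emeasure gauss {x::'a::euclidean_space. \<forall>b\<in>Basis. x \<bullet> b \<in> A b} = (\<Prod>b\<in>(Basis::'a set). emeasure std_normal (A b))"
proof -
  have [measurable]: "{x::'a. \<forall>b\<in>Basis. x \<bullet> b \<in> A b} \<in> sets borel" by measurable
  have "emeasure gauss {x::'a. \<forall>b\<in>Basis. x \<bullet> b \<in> A b} =
      (\<integral>\<^sup>+ x. (\<Prod>b\<in>Basis. ennreal (std_normal_density (x \<bullet> b)) * indicator (A b) (x \<bullet> b)) \<partial>(lborel :: 'a measure))"
    unfolding gauss_def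
    by (subst emeasure_density)
       (auto intro!: nn_integral_cong simp: prod_ennreal prod.distrib indicator_def prod_zero_iff)
  also have "\<dots> = (\<Prod>b\<in>(Basis::'a set). (\<integral>\<^sup>+ x. ennreal (std_normal_density x) * indicator (A b) x \<partial>lborel))"
    by (rule nn_integral_lborel_prod) auto
  also have "\<dots> = (\<Prod>b\<in>(Basis::'a set). emeasure std_normal (A b))"
    by (simp add: emeasure_density)
  finally show ?thesis .
qed

lemma prob_gauss: "prob_space (gauss :: 'a::euclidean_space measure)"
proof
  show "emeasure gauss (space (gauss :: 'a measure)) = 1"
    using emeasure_gauss_box[where A="\<lambda>_::'a. UNIV"] prob_space.emeasure_space_1[OF prob_std_normal] by simp
qed

lemma norm_sq_Basis: "(norm (x::'a::euclidean_space))\<^sup>2 = (\<Sum>b\<in>Basis. (x \<bullet> b)\<^sup>2)"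
  by (simp add: power2_norm_eq_inner euclidean_inner[of x x]) (simp add: power2_eq_square)

lemma gauss_density_norm:
  "(\<Prod>b\<in>Basis. std_normal_density (x \<bullet> b)) = (1 / sqrt (2 * pi)) ^ DIM('a) * exp (- (norm (x::'a::euclidean_space))\<^sup>2 / 2)"
proof -
  have "(\<Prod>b\<in>Basis. std_normal_density (x \<bullet> b)) = (1 / sqrt (2 * pi)) ^ DIM('a) * (\<Prod>b\<in>Basis. exp (- (x \<bullet> b)\<^sup>2 / 2))"
    unfolding std_normal_density_def prod.distrib by simp
  also have "(\<Prod>b\<in>Basis. exp (- (x \<bullet> b)\<^sup>2 / 2)) = exp (- (norm x)\<^sup>2 / 2)"
    by (subst exp_sum[symmetric]) (simp_all add: norm_sq_Basis sum_divide_distrib sum_negf)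
  finally show ?thesis .
qed

text \<open>Lebesgue measure is invariant, and by \<open>gauss_density_norm\<close> so is the
  density.\<close>

lemma distr_gauss_orthogonal:
  fixes T :: "'a::euclidean_space \<Rightarrow> 'a"
  assumes T: "orthogonal_transformation T"
  shows "distr gauss borel T = gauss"
proof -
  have [measurable]: "T \<in> borel_measurable borel"
    using T by (intro borel_measurable_continuous_onI linear_continuous_on)
      (simp add: linear_conv_bounded_linear[symmetric] orthogonal_transformation_linear)
  let ?g = "\<lambda>x::'a. ennreal (\<Prod>b\<in>Basis. std_normal_density (x \<bullet> b))"
  have "gauss = density (distr lborel borel T) ?g"
    by (simp add: gauss_def distr_lborel_orthogonal[OF T])
  also have "\<dots> = distr (density lborel (\<lambda>x. ?g (T x))) borel T"
    by (rule density_distr) auto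
  also have "(\<lambda>x. ?g (T x)) = ?g"
    unfolding gauss_density_norm orthogonal_transformation_norm[OF T] ..
  finally show ?thesis by (simp add: gauss_def)
qed

lemma distr_gauss_component:
  assumes b: "b \<in> Basis"
  shows "distr gauss borel (\<lambda>x::'a::euclidean_space. x \<bullet> b) = std_normal"
proof (rule measure_eqI)
  fix A assume "A \<in> sets (distr gauss borel (\<lambda>x::'a. x \<bullet> b))"
  then have [measurable]: "A \<in> sets borel" by simp
  have "emeasure (distr gauss borel (\<lambda>x::'a. x \<bullet> b)) A = emeasure gauss {x::'a. x \<bullet> b \<in> A}"
    by (simp add: emeasure_distr vimage_def)
  also have "{x::'a. x \<bullet> b \<in> A} = {x. \<forall>b'\<in>Basis. x \<bullet> b' \<in> (if b' = b then A else UNIV)}"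
    using b by auto
  also have "emeasure gauss \<dots> = (\<Prod>b'\<in>(Basis::'a set). emeasure std_normal (if b' = b then A else UNIV))"
    by (rule emeasure_gauss_box) auto
  also have "\<dots> = (\<Prod>b'\<in>(Basis::'a set). if b' = b then emeasure std_normal A else 1)"
    using prob_space.emeasure_space_1[OF prob_std_normal] by (intro prod.cong) auto
  also have "\<dots> = emeasure std_normal A" using b by (simp add: prod.delta)
  finally show "emeasure (distr gauss borel (\<lambda>x::'a. x \<bullet> b)) A = emeasure std_normal A" .
qed simp

lemma gauss_component_sq:
  assumes b: "b \<in> Basis"
  shows "integrable gauss (\<lambda>x::'a::euclidean_space. (x \<bullet> b)\<^sup>2)" "(\<integral>x. (x \<bullet> b)\<^sup>2 \<partial>(gauss :: 'a measure)) = 1"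
proof -
  have *: "has_bochner_integral std_normal (\<lambda>x. x\<^sup>2) 1"
    using std_normal_moment_even[of 1] by (intro has_bochner_integral_density) auto
  have "integrable (distr gauss borel (\<lambda>x::'a. x \<bullet> b)) (\<lambda>x. x\<^sup>2)"
    using * by (simp add: distr_gauss_component[OF b] has_bochner_integral_iff)
  then show "integrable gauss (\<lambda>x::'a. (x \<bullet> b)\<^sup>2)" by (simp add: integrable_distr_eq)
  have "(\<integral>x. (x \<bullet> b)\<^sup>2 \<partial>(gauss :: 'a measure)) = (\<integral>x. x\<^sup>2 \<partial>distr gauss borel (\<lambda>x::'a. x \<bullet> b))"
    by (simp add: integral_distr)
  then show "(\<integral>x. (x \<bullet> b)\<^sup>2 \<partial>(gauss :: 'a measure)) = 1"
    using * by (simp add: distr_gauss_component[OF b] has_bochner_integral_iff)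
qed

lemma gauss_norm_sq:
  "integrable gauss (\<lambda>x::'a::euclidean_space. (norm x)\<^sup>2)" "(\<integral>x. (norm x)\<^sup>2 \<partial>(gauss :: 'a measure)) = DIM('a)"
  unfolding norm_sq_Basis using gauss_component_sq[where 'a='a] by auto

lemma integrable_gauss_norm: "integrable gauss (\<lambda>x::'a::euclidean_space. norm x)"
proof (rule Bochner_Integration.integrable_bound)
  interpret prob_space "gauss :: 'a measure" by (rule prob_gauss)
  show "integrable gauss (\<lambda>x::'a. 1 + (norm x)\<^sup>2)" using gauss_norm_sq[where 'a='a] by auto
  have "norm x \<le> 1 + (norm x)\<^sup>2" for x :: 'a
  proof -
    have "0 \<le> (norm x - 1/2)\<^sup>2" by simp
    then show ?thesis by (simp add: power2_diff) (simp add: power2_eq_square)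
  qed
  then show "AE x::'a in gauss. norm (norm x) \<le> norm (1 + (norm x)\<^sup>2)" by auto
qed measurable

text \<open>Householder reflection in the hyperplane orthogonal to e. For e = 0 it is the identity,
  so it is orthogonal without a side condition.\<close>

definition reflect :: "'a::real_inner \<Rightarrow> 'a \<Rightarrow> 'a" where
  "reflect e x = x - (2 * (e \<bullet> x) / (e \<bullet> e)) *\<^sub>R e"

lemma reflect_orthogonal: "orthogonal_transformation (reflect e)"
  unfolding orthogonal_transformation_def
proof
  show "linear (reflect e)"
    by (intro linearI) (simp_all add: reflect_def inner_add_right algebra_simps add_divide_distrib scaleR_add_left)
  show "\<forall>v w. reflect e v \<bullet> reflect e w = v \<bullet> w"
    by (cases "e = 0") (auto simp: reflect_def inner_diff_left inner_diff_right inner_commute algebra_simps)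
qed

lemma gauss_integral_orthogonal:
  fixes T :: "'a::euclidean_space \<Rightarrow> 'a" and f :: "'a \<Rightarrow> real"
  assumes T: "orthogonal_transformation T" and [measurable]: "f \<in> borel_measurable borel"
  shows "(\<integral>x. f (T x) \<partial>gauss) = (\<integral>x. f x \<partial>gauss)"
proof -
  have [measurable]: "T \<in> borel_measurable borel"
    using T by (intro borel_measurable_continuous_onI linear_continuous_on)
      (simp add: linear_conv_bounded_linear[symmetric] orthogonal_transformation_linear)
  show ?thesis
    by (subst (2) distr_gauss_orthogonal[OF T, symmetric]) (simp add: integral_distr)
qed

lemma gauss_mean: "integrable gauss (\<lambda>x::'a::euclidean_space. e \<bullet> x)" "(\<integral>x. e \<bullet> x \<partial>(gauss :: 'a measure)) = 0"
proof -
  show "integrable gauss (\<lambda>x::'a. e \<bullet> x)"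
    by (rule Bochner_Integration.integrable_bound[OF integrable_mult_right[OF integrable_gauss_norm, of "norm e"]])
       (auto simp: abs_mult Cauchy_Schwarz_ineq2)
  have "orthogonal_transformation (\<lambda>x::'a. - x)"
    using orthogonal_transformation_neg[of "\<lambda>x::'a. x"] by simp
  from gauss_integral_orthogonal[OF this, of "\<lambda>x. e \<bullet> x"]
  show "(\<integral>x. e \<bullet> x \<partial>(gauss :: 'a measure)) = 0" by simp
qed

text \<open>The reflection along \<open>e - b\<close> carries e to a basis vector b, which reduces
  the claim to a single coordinate.\<close>

lemma gauss_inner_sq:
  fixes e :: "'a::euclidean_space"
  assumes e: "norm e = 1"
  shows "integrable gauss (\<lambda>x. (e \<bullet> x)\<^sup>2)" "(\<integral>x. (e \<bullet> x)\<^sup>2 \<partial>gauss) = 1"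
proof -
  obtain b :: 'a where b: "b \<in> Basis" using nonempty_Basis by blast
  show "integrable gauss (\<lambda>x. (e \<bullet> x)\<^sup>2)"
  proof (rule Bochner_Integration.integrable_bound[OF gauss_norm_sq(1)])
    show "AE x in gauss. norm ((e \<bullet> x)\<^sup>2) \<le> norm ((norm x)\<^sup>2)"
      using Cauchy_Schwarz_ineq2[of e] e by (auto simp: power2_le_iff_abs_le)
  qed measurable
  have ee: "e \<bullet> e = 1" "b \<bullet> b = 1" using e b by (auto simp: power2_norm_eq_inner[symmetric])
  have T: "reflect (e - b) e = b"
  proof (cases "e = b")
    case False
    then have "(e - b) \<bullet> (e - b) \<noteq> 0" by simp
    moreover have "(e - b) \<bullet> (e - b) = 2 * ((e - b) \<bullet> e)"
      by (simp add: inner_diff_left inner_diff_right ee inner_commute)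
    ultimately show ?thesis by (simp add: reflect_def)
  qed (simp add: reflect_def)
  have "b \<bullet> reflect (e - b) x = e \<bullet> x" for x
    using reflect_orthogonal[of "e - b"] T by (metis orthogonal_transformation_def)
  then show "(\<integral>x. (e \<bullet> x)\<^sup>2 \<partial>gauss) = 1"
    using gauss_integral_orthogonal[OF reflect_orthogonal, of "\<lambda>x. (b \<bullet> x)\<^sup>2" "e - b"] gauss_component_sq(2)[OF b]
    by (simp add: inner_commute)
qed

text \<open>Noise beyond the range of the local expansion is charged to
  \<open>h * (norm \<xi>)\<^sup>2\<close> on a tail event; this makes its mean an arbitrarily small
  multiple of h.\<close>

lemma gauss_tail_small:
  assumes "0 < \<epsilon>"
  obtains R where "0 < R" "(\<integral>x. (norm x)\<^sup>2 * indicator {x. R < norm x} x \<partial>(gauss :: 'a::euclidean_space measure)) < \<epsilon>"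
proof -
  have "(\<lambda>n. \<integral>x. (norm x)\<^sup>2 * indicator {x. real n < norm x} x \<partial>(gauss :: 'a measure)) \<longlonglongrightarrow> (\<integral>x. 0 \<partial>(gauss :: 'a measure))"
  proof (rule integral_dominated_convergence[where w="\<lambda>x. (norm x)\<^sup>2"])
    show "AE x::'a in gauss. (\<lambda>n. (norm x)\<^sup>2 * indicator {x. real n < norm x} x) \<longlonglongrightarrow> (0::real)"
    proof (rule AE_I2)
      fix x :: 'a
      obtain N :: nat where "norm x < real N" using reals_Archimedean2 by blast
      then have "eventually (\<lambda>n. (norm x)\<^sup>2 * indicator {x. real n < norm x} x = (0::real)) sequentially"
        by (intro eventually_sequentiallyI[of N]) (auto simp: indicator_def)
      then show "(\<lambda>n. (norm x)\<^sup>2 * indicator {x. real n < norm x} x) \<longlonglongrightarrow> (0::real)"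
        by (rule tendsto_eventually)
    qed
    show "integrable gauss (\<lambda>x::'a. (norm x)\<^sup>2)" by (rule gauss_norm_sq)
  qed (auto simp: indicator_def)
  then have "eventually (\<lambda>n. (\<integral>x. (norm x)\<^sup>2 * indicator {x. real n < norm x} x \<partial>(gauss :: 'a measure)) < \<epsilon>) sequentially"
    using assms by (intro order_tendstoD) simp_all
  then obtain n where "(\<integral>x. (norm x)\<^sup>2 * indicator {x. real n < norm x} x \<partial>(gauss :: 'a measure)) < \<epsilon>" "1 \<le> n"
    by (auto simp: eventually_sequentially intro: le_max_iff_disj dest: spec[of _ "max _ 1"]) 
       (metis max.cobounded1 max.cobounded2)
  then show thesis using that[of "real n"] by simp
qed

section \<open>Blocks of coordinates\<close>

lemma coord_proj_nth [simp]: "coord_proj J x $ j = (if j \<in> J then x $ j else 0)"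
  by (simp add: coord_proj_def)

lemma linear_coord_proj: "linear (coord_proj J)"
  by (intro linearI) (simp_all add: vec_eq_iff)

lemmas coord_proj_linear_simps =
  linear_add[OF linear_coord_proj] linear_diff[OF linear_coord_proj] linear_scale[OF linear_coord_proj]
  linear_0[OF linear_coord_proj] linear_sum[OF linear_coord_proj]

lemma bounded_linear_coord_proj: "bounded_linear (coord_proj J :: real ^ 'm::finite \<Rightarrow> _)"
  using linear_coord_proj by (simp add: linear_conv_bounded_linear)

lemma coord_proj_measurable [measurable]: "coord_proj J \<in> borel_measurable (borel :: (real ^ 'm::finite) measure)"
  by (intro borel_measurable_continuous_onI linear_continuous_on bounded_linear_coord_proj)

lemma coord_proj_in [simp]: "coord_proj J x \<in> coord_space J"
  by (simp add: coord_space_def)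

lemma coord_proj_id: "x \<in> coord_space J \<Longrightarrow> coord_proj J x = x"
  by (auto simp: coord_space_def vec_eq_iff)

lemma coord_proj_other: "x \<in> coord_space J \<Longrightarrow> J \<inter> J' = {} \<Longrightarrow> coord_proj J' x = 0"
  by (auto simp: coord_space_def vec_eq_iff)

lemma subspace_coord_space: "subspace (coord_space J)"
  by (auto simp: coord_space_def subspace_def)

lemma norm_coord_proj_le:
  fixes x :: "real ^ 'm::finite"
  shows "norm (coord_proj J x) \<le> norm x"
  by (rule norm_le_componentwise_cart) simp

lemma sum_block:
  fixes x :: "real ^ 'm::finite" and blk :: "'m \<Rightarrow> 'n::finite"
  shows "(\<Sum>i\<in>UNIV. block blk i x) = x"
proof -
  have "(\<Sum>i\<in>UNIV. block blk i x $ j) = x $ j" for j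
  proof -
    have "(\<Sum>i\<in>UNIV. block blk i x $ j) = (\<Sum>i\<in>UNIV. if i = blk j then x $ j else 0)"
      by (rule sum.cong) auto
    then show ?thesis by simp
  qed
  then show ?thesis by (simp add: vec_eq_iff)
qed

lemma inner_block:
  fixes x y :: "real ^ 'm::finite"
  shows "block blk i x \<bullet> block blk k y = (if i = k then block blk i x \<bullet> y else 0)"
proof (cases "i = k")
  case False
  then show ?thesis by (auto simp: inner_vec_def intro!: sum.neutral)
qed (auto simp: inner_vec_def intro!: sum.cong)

lemma inner_sum_block:
  fixes x y :: "real ^ 'm::finite" and blk :: "'m \<Rightarrow> 'n::finite"
  shows "x \<bullet> y = (\<Sum>i\<in>UNIV. block blk i x \<bullet> block blk i y)"
  unfolding inner_block by (simp add: inner_sum_left[symmetric] sum_block)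

section \<open>One coupled Euler step\<close>

locale weakly_coupled_drift =
  fixes blk :: "'m::finite \<Rightarrow> 'n::finite"
    and b b0 \<gamma> :: "'n \<Rightarrow> real ^ 'm \<Rightarrow> real ^ 'm"
    and \<kappa> :: "'n \<Rightarrow> real \<Rightarrow> real"
    and w \<epsilon> :: "'n \<Rightarrow> real"
  assumes b0_in: "\<And>i. b0 i \<in> block_space blk i \<rightarrow> block_space blk i"
    and \<gamma>_in: "\<And>i. \<gamma> i \<in> UNIV \<rightarrow> block_space blk i"
    and b_eq: "\<And>i x. b i x = b0 i (block blk i x) + \<gamma> i x"
    and b_Lipschitz: "\<And>i. locally_lipschitz_on UNIV (b i)"
    and kappa_eq: "\<And>i r. r > 0 \<Longrightarrow> kappa (block_space blk i) (b0 i) r = ereal (\<kappa> i r)"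
    and profile: "\<And>i. contraction_profile (\<kappa> i)"
    and w_bounds: "\<And>i. 0 < w i \<and> w i \<le> 1"
    and \<epsilon>_bounds: "\<And>i. 0 \<le> \<epsilon> i \<and> \<epsilon> i < rate (\<kappa> i)"
    and \<gamma>_bound: "\<And>x y. (\<Sum>i\<in>UNIV. norm (\<gamma> i x - \<gamma> i y) * w i)
            \<le> (\<Sum>i\<in>UNIV. \<epsilon> i * ffun (\<kappa> i) (norm (block blk i x - block blk i y)) * w i)"
begin

sublocale profile: contraction_profile "\<kappa> i" for i by (rule profile)

abbreviation "P \<equiv> block blk"

definition F :: "real ^ 'm \<Rightarrow> real ^ 'm \<Rightarrow> real" where
  "F x y = (\<Sum>i\<in>UNIV. ffun (\<kappa> i) (norm (P i x - P i y)) * w i)"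

definition c :: real where "c = Min (range (\<lambda>i. rate (\<kappa> i) - \<epsilon> i))"

text \<open>Collects the blocks into one vector field (\<open>block_drift\<close>), so that the
  system becomes a single equation with drift \<open>drift\<close>.\<close>

definition drift :: "real ^ 'm \<Rightarrow> real ^ 'm" where "drift x = (\<Sum>i\<in>UNIV. b i x)"

lemma w_nonneg: "0 \<le> w i" using w_bounds less_imp_le by blast

lemma c_pos: "0 < c" unfolding c_def using \<epsilon>_bounds by (subst Min_gr_iff) auto

lemma c_le: "c \<le> rate (\<kappa> i) - \<epsilon> i" unfolding c_def by (rule Min_le) auto

lemma b_in: "b i x \<in> block_space blk i"
  unfolding b_eq by (rule subspace_add[OF subspace_coord_space]) (use b0_in[of i] \<gamma>_in[of i] in \<open>auto simp: Pi_iff\<close>)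

lemma block_drift: "P i (drift x) = b i x"
proof -
  have "P i (drift x) = (\<Sum>k\<in>UNIV. P i (b k x))"
    by (simp add: drift_def coord_proj_linear_simps)
  also have "\<dots> = (\<Sum>k\<in>UNIV. if k = i then b i x else 0)"
    by (rule sum.cong) (auto simp: coord_proj_id[OF b_in] intro!: coord_proj_other[OF b_in])
  finally show ?thesis by simp
qed

lemma lipschitz_on_compact:
  fixes g :: "real ^ 'm \<Rightarrow> real ^ 'm"
  assumes "locally_lipschitz_on UNIV g" "compact S"
  obtains L where "0 \<le> L" "\<And>x y. x \<in> S \<Longrightarrow> y \<in> S \<Longrightarrow> norm (g x - g y) \<le> L * norm (x - y)"
proof -
  have "locally_lipschitz_on S g"
    using assms(1) by (rule local_lipschitz_subset) auto
  then have "local_lipschitz {0::real..1} S (\<lambda>_. g)"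
    by (rule local_lipschitz_subset) auto
  then obtain L where "\<And>t. t \<in> {0::real..1} \<Longrightarrow> L-lipschitz_on S g"
    by (rule local_lipschitz_compact_implies_lipschitz[where T="{0..1}" and X=S]) (use assms in \<open>auto intro: continuous_intros\<close>)
  from this[of 0] have L: "L-lipschitz_on S g" by auto
  show thesis
    by (rule that[of L]) (use lipschitz_onD[OF L] lipschitz_on_nonneg[OF L] in \<open>auto simp: dist_norm\<close>)
qed

lemma drift_lipschitz_on_compact:
  assumes "compact S"
  obtains L where "0 \<le> L" "\<And>x y. x \<in> S \<Longrightarrow> y \<in> S \<Longrightarrow> norm (drift x - drift y) \<le> L * norm (x - y)"
proof -
  have "\<exists>L\<ge>0. \<forall>x\<in>S. \<forall>y\<in>S. norm (b i x - b i y) \<le> L * norm (x - y)" for i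
    using lipschitz_on_compact[OF b_Lipschitz assms] by metis
  then obtain L where L: "\<And>i. 0 \<le> L i"
    "\<And>i x y. x \<in> S \<Longrightarrow> y \<in> S \<Longrightarrow> norm (b i x - b i y) \<le> L i * norm (x - y)" by metis
  show thesis
  proof (rule that[of "\<Sum>i\<in>UNIV. L i"])
    fix x y assume "x \<in> S" "y \<in> S"
    then have "norm (\<Sum>i\<in>UNIV. b i x - b i y) \<le> (\<Sum>i\<in>UNIV. L i * norm (x - y))"
      by (intro order_trans[OF norm_sum] sum_mono L)
    then show "norm (drift x - drift y) \<le> (\<Sum>i\<in>UNIV. L i) * norm (x - y)"
      by (simp add: drift_def sum_subtractf sum_distrib_right)
  qed (use L in \<open>simp add: sum_nonneg\<close>)
qed

lemma drift_continuous: "continuous_on UNIV drift"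
proof (rule continuous_at_imp_continuous_on, rule ballI)
  fix x :: "real ^ 'm"
  obtain L where L: "0 \<le> L" "\<And>y z. y \<in> cball x 1 \<Longrightarrow> z \<in> cball x 1 \<Longrightarrow> norm (drift y - drift z) \<le> L * norm (y - z)"
    using drift_lipschitz_on_compact[OF compact_cball] by blast
  have "L-lipschitz_on (cball x 1) drift"
    by (rule lipschitz_onI) (use L in \<open>auto simp: dist_norm\<close>)
  then have "continuous_on (cball x 1) drift" by (rule lipschitz_on_continuous_on)
  then show "isCont drift x"
    by (rule continuous_on_interior) simp
qed

lemma drift_measurable [measurable]: "drift \<in> borel_measurable borel"
  by (rule borel_measurable_continuous_onI[OF drift_continuous])

text \<open>Every pair of points is a competitor in the infimum defining \<open>kappa\<close>. It is
  through this one-sided bound that \<open>\<kappa>\<close> controls the drift.\<close>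

lemma b0_onesided:
  assumes "x \<in> block_space blk i" "y \<in> block_space blk i" "x \<noteq> y"
  shows "2 * ((x - y) \<bullet> (b0 i x - b0 i y)) \<le> - ((norm (x - y))\<^sup>2 * \<kappa> i (norm (x - y)))"
proof -
  let ?r = "norm (x - y)"
  have r: "0 < ?r" using assms by simp
  have "ereal (\<kappa> i ?r) \<le> ereal (1 / ?r\<^sup>2) * ereal (-2 * ((x - y) \<bullet> (b0 i x - b0 i y)))"
    unfolding kappa_eq[OF r, symmetric] kappa_def
    by (intro ereal_mult_left_mono Inf_lower) (use assms in auto)
  then have "\<kappa> i ?r \<le> 1 / ?r\<^sup>2 * (-2 * ((x - y) \<bullet> (b0 i x - b0 i y)))" by simp
  then have "?r\<^sup>2 * \<kappa> i ?r \<le> ?r\<^sup>2 * (1 / ?r\<^sup>2 * (-2 * ((x - y) \<bullet> (b0 i x - b0 i y))))"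
    by (rule mult_left_mono) simp
  then show ?thesis using r by simp
qed

lemma F_nonneg: "0 \<le> F x y"
  unfolding F_def using w_bounds by (intro sum_nonneg mult_nonneg_nonneg profile.ffun_nonneg) (auto intro: less_imp_le)

lemma F_le: "F x y \<le> (\<Sum>i\<in>UNIV. norm (P i x - P i y))"
proof -
  have "ffun (\<kappa> i) (norm (P i x - P i y)) * w i \<le> norm (P i x - P i y) * 1" for i
    using w_bounds[of i] profile.ffun_le by (intro mult_mono) auto
  then show ?thesis unfolding F_def by (intro sum_mono) simp
qed

lemma norm_block_diff_le: "norm (P i x - P i y) \<le> norm (x - y)"
  using norm_coord_proj_le[of _ "x - y"] by (simp add: coord_proj_linear_simps)

lemma F_le_norm: "F x y \<le> CARD('n) * norm (x - y)"
proof -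
  have "(\<Sum>i\<in>UNIV. norm (P i x - P i y)) \<le> (\<Sum>i\<in>(UNIV::'n set). norm (x - y))"
    by (intro sum_mono norm_block_diff_le)
  then show ?thesis using F_le[of x y] by simp
qed

text \<open>With \<open>f r \<le> r\<close>, \<open>w \<le> 1\<close>, the largest \<epsilon> called
  E and the smallest weight called W, the weighted hypothesis becomes a global Lipschitz bound with
  constant \<open>E * n / W\<close>.\<close>

lemma \<gamma>_Lipschitz: obtains C where "0 \<le> C" "\<And>i x y. norm (\<gamma> i x - \<gamma> i y) \<le> C * norm (x - y)"
proof -
  define E where "E = Max (range \<epsilon>)"
  have E: "\<epsilon> i \<le> E" for i unfolding E_def by (rule Max_ge) auto
  then have E0: "0 \<le> E" using \<epsilon>_bounds order_trans by blast
  note E = E E0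
  define W where "W = Min (range w)"
  have W: "W \<le> w i" "0 < W" for i
    unfolding W_def using w_bounds by (auto simp: Min_gr_iff)
  show thesis
  proof (rule that[of "E * CARD('n) / W"])
    fix i x y
    have "norm (\<gamma> i x - \<gamma> i y) * W \<le> norm (\<gamma> i x - \<gamma> i y) * w i"
      using W by (intro mult_left_mono) auto
    also have "\<dots> \<le> (\<Sum>i\<in>UNIV. norm (\<gamma> i x - \<gamma> i y) * w i)"
      by (intro member_le_sum mult_nonneg_nonneg w_nonneg) auto
    also have "\<dots> \<le> (\<Sum>i\<in>UNIV. \<epsilon> i * ffun (\<kappa> i) (norm (P i x - P i y)) * w i)" by (rule \<gamma>_bound)
    also have "\<dots> \<le> (\<Sum>i\<in>UNIV. E * (ffun (\<kappa> i) (norm (P i x - P i y)) * w i))"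
      unfolding mult.assoc using E w_bounds
      by (intro sum_mono mult_right_mono mult_nonneg_nonneg profile.ffun_nonneg) (auto intro: less_imp_le)
    also have "\<dots> = E * F x y" by (simp add: F_def sum_distrib_left)
    also have "\<dots> \<le> E * (CARD('n) * norm (x - y))" using E F_le_norm by (intro mult_left_mono) auto
    finally show "norm (\<gamma> i x - \<gamma> i y) \<le> E * CARD('n) / W * norm (x - y)"
      using W by (simp add: field_simps)
  qed (use E W in auto)
qed

text \<open>Writes \<open>b0 i\<close> as \<open>b i - \<gamma> i\<close> at the projected points
  \<open>P i x\<close> and \<open>P i y\<close> instead of x and y, so that only the distance in
  block i appears on the right.\<close>

lemma b0_Lipschitz: assumes "0 \<le> K"
  obtains L where "0 \<le> L"
    "\<And>i x y. norm x \<le> K \<Longrightarrow> norm y \<le> K \<Longrightarrow> norm (b0 i (P i x) - b0 i (P i y)) \<le> L * norm (P i x - P i y)"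
proof -
  obtain C where C: "0 \<le> C" "\<And>i x y. norm (\<gamma> i x - \<gamma> i y) \<le> C * norm (x - y)" using \<gamma>_Lipschitz by blast
  obtain L where L: "0 \<le> L"
    "\<And>x y. x \<in> cball 0 K \<Longrightarrow> y \<in> cball 0 K \<Longrightarrow> norm (drift x - drift y) \<le> L * norm (x - y)"
    using drift_lipschitz_on_compact[OF compact_cball] by blast
  show thesis
  proof (rule that[of "L + C"])
    fix i and x y :: "real ^ 'm" assume "norm x \<le> K" "norm y \<le> K"
    then have xy: "P i x \<in> cball 0 K" "P i y \<in> cball 0 K"
      using norm_coord_proj_le[of "blk -` {i}" x] norm_coord_proj_le[of "blk -` {i}" y] by auto
    have "b0 i (P i x) - b0 i (P i y) = (b i (P i x) - b i (P i y)) - (\<gamma> i (P i x) - \<gamma> i (P i y))"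
      unfolding b_eq by (simp add: coord_proj_id)
    also have "norm \<dots> \<le> norm (b i (P i x) - b i (P i y)) + norm (\<gamma> i (P i x) - \<gamma> i (P i y))"
      by (rule norm_triangle_ineq4)
    also have "norm (b i (P i x) - b i (P i y)) \<le> norm (drift (P i x) - drift (P i y))"
      using norm_block_diff_le[of i "drift (P i x)" "drift (P i y)"] by (simp add: block_drift)
    also have "\<dots> \<le> L * norm (P i x - P i y)" using L xy by blast
    finally show "norm (b0 i (P i x) - b0 i (P i y)) \<le> (L + C) * norm (P i x - P i y)"
      using C(2)[of i "P i x" "P i y"] by (simp add: distrib_right)
  qed (use L C in simp)
qed

lemma drift_bounded: obtains M where "0 \<le> M" "\<And>x. norm x \<le> K \<Longrightarrow> norm (drift x) \<le> M"
proof -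
  have "compact (drift ` cball 0 K)"
    by (intro compact_continuous_image continuous_on_subset[OF drift_continuous]) auto
  then have "bounded (drift ` cball 0 K)" by (rule compact_imp_bounded)
  then obtain M where M: "\<And>x. x \<in> cball 0 K \<Longrightarrow> norm (drift x) \<le> M"
    unfolding bounded_iff by blast
  show thesis
    by (rule that[of "max M 0"]) (use M in \<open>auto simp: le_max_iff_disj\<close>)
qed

text \<open>A one-sided growth bound: \<open>b0\<close> is controlled through
  \<open>b0_onesided\<close> and the bounded repulsion, \<gamma> through its Lipschitz constant. The
  norm of the drift may grow arbitrarily fast, yet second moments of the diffusion stay
  finite.\<close>

lemma drift_growth: obtains C where "0 \<le> C" "\<And>x. x \<bullet> drift x \<le> C * (1 + (norm x)\<^sup>2)"
proof -
  obtain C where C: "0 \<le> C" "\<And>i x y. norm (\<gamma> i x - \<gamma> i y) \<le> C * norm (x - y)" using \<gamma>_Lipschitz by blast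
  have "\<exists>D. 0 \<le> D \<and> (\<forall>r>0. - (r * \<kappa> i r) \<le> D)" for i
    using profile.r_kappa_bounded_below[of i] by metis
  then obtain D where D: "\<And>i. 0 \<le> D i" "\<And>i r. 0 < r \<Longrightarrow> - (r * \<kappa> i r) \<le> D i" by metis
  define G where "G i = D i + C + norm (b0 i 0) + norm (\<gamma> i 0)" for i
  have G: "0 \<le> G i" for i using D C by (simp add: G_def)
  show thesis
  proof (rule that[of "\<Sum>i\<in>UNIV. 2 * G i"])
    show "0 \<le> (\<Sum>i\<in>UNIV. 2 * G i)" using G by (simp add: sum_nonneg)
    fix x :: "real ^ 'm"
    have lin: "norm x \<le> 1 + (norm x)\<^sup>2"
    proof -
      have "0 \<le> (norm x - 1/2)\<^sup>2" by simp
      then show ?thesis by (simp add: power2_diff) (simp add: power2_eq_square)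
    qed
    have "P i x \<bullet> b i x \<le> 2 * G i * (1 + (norm x)\<^sup>2)" for i
    proof -
      let ?z = "P i x"
      have z: "norm ?z \<le> norm x" by (rule norm_coord_proj_le)
      have 0: "(0 :: real ^ 'm) \<in> block_space blk i" by (rule subspace_0[OF subspace_coord_space])
      have "?z \<bullet> (b0 i ?z - b0 i 0) \<le> norm ?z * D i"
      proof (cases "?z = 0")
        case False
        have "2 * (?z \<bullet> (b0 i ?z - b0 i 0)) \<le> - ((norm ?z)\<^sup>2 * \<kappa> i (norm ?z))"
          using b0_onesided[of ?z i 0] 0 False by simp
        also have "\<dots> = norm ?z * (- (norm ?z * \<kappa> i (norm ?z)))" by (simp add: power2_eq_square)
        also have "\<dots> \<le> norm ?z * D i" using D False by (intro mult_left_mono) auto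
        finally show ?thesis using mult_nonneg_nonneg[OF norm_ge_zero[of ?z] D(1)[of i]] by linarith
      qed simp
      moreover have "?z \<bullet> b0 i 0 \<le> norm ?z * norm (b0 i 0)" by (rule norm_cauchy_schwarz)
      moreover have "?z \<bullet> \<gamma> i 0 \<le> norm ?z * norm (\<gamma> i 0)" by (rule norm_cauchy_schwarz)
      moreover have "?z \<bullet> (\<gamma> i x - \<gamma> i 0) \<le> norm ?z * (C * norm x)"
        using norm_cauchy_schwarz[of ?z "\<gamma> i x - \<gamma> i 0"] mult_left_mono[OF C(2)[of i x 0], of "norm ?z"] by simp
      moreover have "?z \<bullet> b i x = ?z \<bullet> (b0 i ?z - b0 i 0) + ?z \<bullet> b0 i 0 + ?z \<bullet> (\<gamma> i x - \<gamma> i 0) + ?z \<bullet> \<gamma> i 0"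
        unfolding b_eq by (simp add: inner_add_right inner_diff_right)
      ultimately have "?z \<bullet> b i x \<le> norm ?z * (D i + norm (b0 i 0) + norm (\<gamma> i 0)) + norm ?z * (C * norm x)"
        by (simp add: algebra_simps)
      also have "\<dots> \<le> norm x * (D i + norm (b0 i 0) + norm (\<gamma> i 0)) + norm x * (C * norm x)"
        using z D C by (intro add_mono mult_right_mono) auto
      also have "\<dots> \<le> (1 + (norm x)\<^sup>2) * (D i + norm (b0 i 0) + norm (\<gamma> i 0)) + (1 + (norm x)\<^sup>2) * C"
      proof (intro add_mono mult_right_mono lin)
        have "norm x * (C * norm x) = (norm x)\<^sup>2 * C" by (simp add: power2_eq_square)
        also have "\<dots> \<le> (1 + (norm x)\<^sup>2) * C" using C by (intro mult_right_mono) auto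
        finally show "norm x * (C * norm x) \<le> (1 + (norm x)\<^sup>2) * C" .
      qed (use D in auto)
      also have "\<dots> = G i * (1 + (norm x)\<^sup>2)" by (simp add: G_def algebra_simps)
      also have "\<dots> \<le> 2 * G i * (1 + (norm x)\<^sup>2)" using G by (intro mult_right_mono) auto
      finally show ?thesis .
    qed
    then have "(\<Sum>i\<in>UNIV. P i x \<bullet> b i x) \<le> (\<Sum>i\<in>UNIV. 2 * G i * (1 + (norm x)\<^sup>2))" by (intro sum_mono)
    then show "x \<bullet> drift x \<le> (\<Sum>i\<in>UNIV. 2 * G i) * (1 + (norm x)\<^sup>2)"
      by (simp add: inner_sum_block[of x "drift x" blk] block_drift sum_distrib_right)
  qed
qed

end

section \<open>Reflection block by block and the one-step decay of \<open>F\<close>\<close>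

context weakly_coupled_drift
begin

text \<open>The value 0 codes synchronous noise, so that the formula for \<open>mirror\<close>
  covers both regimes.\<close>

definition dir :: "real \<Rightarrow> real ^ 'm \<Rightarrow> real ^ 'm \<Rightarrow> 'n \<Rightarrow> real ^ 'm" where
  "dir \<delta> x y i = (if \<delta> \<le> norm (P i x - P i y) then (P i x - P i y) /\<^sub>R norm (P i x - P i y) else 0)"

text \<open>Composition of the Householder reflections of all blocks in the reflecting regime; their
  directions are mutually orthogonal, so it collapses to one sum.\<close>

definition mirror :: "real \<Rightarrow> real ^ 'm \<Rightarrow> real ^ 'm \<Rightarrow> real ^ 'm \<Rightarrow> real ^ 'm" where
  "mirror \<delta> x y \<xi> = \<xi> - (\<Sum>i\<in>UNIV. (2 * (dir \<delta> x y i \<bullet> \<xi>)) *\<^sub>R dir \<delta> x y i)"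

lemma block_dir: "P k (dir \<delta> x y i) = (if k = i then dir \<delta> x y i else 0)"
proof -
  have "dir \<delta> x y i \<in> block_space blk i"
    unfolding dir_def by (auto intro!: subspace_scale[OF subspace_coord_space] subspace_diff[OF subspace_coord_space]
      subspace_0[OF subspace_coord_space])
  then show ?thesis by (auto simp: coord_proj_id intro!: coord_proj_other)
qed

lemma norm_dir: "0 < \<delta> \<Longrightarrow> norm (dir \<delta> x y i) = (if \<delta> \<le> norm (P i x - P i y) then 1 else 0)"
proof (cases "\<delta> \<le> norm (P i x - P i y)")
  case True
  moreover assume "0 < \<delta>"
  ultimately have "norm (P i x - P i y) \<noteq> 0" by linarith
  then show ?thesis using True by (simp add: dir_def)
qed (simp add: dir_def)

lemma norm_dir_le: "0 < \<delta> \<Longrightarrow> norm (dir \<delta> x y i) \<le> 1"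
  by (simp add: norm_dir)

lemma abs_dir_inner_le: "0 < \<delta> \<Longrightarrow> \<bar>dir \<delta> x y i \<bullet> \<xi>\<bar> \<le> norm \<xi>"
  using Cauchy_Schwarz_ineq2[of "dir \<delta> x y i" \<xi>] mult_right_mono[OF norm_dir_le[of \<delta> x y i], of "norm \<xi>"] by simp

lemma dir_inner_dir: "dir \<delta> x y i \<bullet> dir \<delta> x y k = (if i = k then (norm (dir \<delta> x y i))\<^sup>2 else 0)"
  using inner_block[of blk i "dir \<delta> x y i" k "dir \<delta> x y k"] by (simp add: block_dir power2_norm_eq_inner)

text \<open>With S the subtracted sum, orthogonality of the directions gives
  \<open>S \<bullet> S = 2 * (S \<bullet> v)\<close>, so the norm is kept. Hence mirrored Gaussian
  noise is again standard Gaussian and the second chain has the right law.\<close>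

lemma mirror_orthogonal: assumes "0 < \<delta>" shows "orthogonal_transformation (mirror \<delta> x y)"
  unfolding orthogonal_transformation
proof
  let ?e = "dir \<delta> x y"
  show "linear (mirror \<delta> x y)"
    by (intro linearI)
       (simp_all add: mirror_def inner_add_right distrib_left scaleR_add_left sum.distrib scaleR_sum_right scaleR_diff_right mult.left_commute)
  show "\<forall>v. norm (mirror \<delta> x y v) = norm v"
  proof
    fix v
    define S where "S = (\<Sum>i\<in>UNIV. (2 * (?e i \<bullet> v)) *\<^sub>R ?e i)"
    have Sv: "S \<bullet> v = (\<Sum>i\<in>UNIV. 2 * (?e i \<bullet> v)\<^sup>2)"
      by (simp add: S_def inner_sum_left power2_eq_square mult.assoc)
    have eS: "?e i \<bullet> S = 2 * (?e i \<bullet> v)" for i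
    proof -
      have "?e i \<bullet> S = (\<Sum>k\<in>UNIV. if k = i then 2 * (?e i \<bullet> v) * (norm (?e i))\<^sup>2 else 0)"
        unfolding S_def inner_sum_right by (rule sum.cong) (auto simp: dir_inner_dir)
      also have "\<dots> = 2 * (?e i \<bullet> v) * (norm (?e i))\<^sup>2" by simp
      also have "\<dots> = 2 * (?e i \<bullet> v)" using norm_dir[OF assms, of x y i] by (auto split: if_splits)
      finally show ?thesis .
    qed
    have "S \<bullet> S = (\<Sum>i\<in>UNIV. 2 * (?e i \<bullet> v) * (?e i \<bullet> S))"
      by (subst S_def) (simp add: inner_sum_left)
    also have "\<dots> = 2 * (S \<bullet> v)"
      by (simp add: eS Sv sum_distrib_left power2_eq_square)
    finally have SS: "S \<bullet> S = 2 * (S \<bullet> v)" .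
    have "(norm (v - S))\<^sup>2 = (norm v)\<^sup>2"
      unfolding power2_norm_eq_inner
      by (simp add: inner_diff_left inner_diff_right inner_commute[of v S] SS)
    then show "norm (mirror \<delta> x y v) = norm v" by (simp add: mirror_def S_def)
  qed
qed

lemma block_mirror: "P i (mirror \<delta> x y \<xi>) = P i \<xi> - (2 * (dir \<delta> x y i \<bullet> \<xi>)) *\<^sub>R dir \<delta> x y i"
proof -
  have "(\<Sum>k\<in>UNIV. P i ((2 * (dir \<delta> x y k \<bullet> \<xi>)) *\<^sub>R dir \<delta> x y k)) =
     (\<Sum>k\<in>UNIV. if k = i then (2 * (dir \<delta> x y i \<bullet> \<xi>)) *\<^sub>R dir \<delta> x y i else 0)"
    by (rule sum.cong) (auto simp: coord_proj_linear_simps block_dir)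
  then show ?thesis unfolding mirror_def coord_proj_linear_simps by simp
qed

definition euler_step :: "real \<Rightarrow> real ^ 'm \<Rightarrow> real ^ 'm \<Rightarrow> real ^ 'm" where
  "euler_step h x \<xi> = x + h *\<^sub>R drift x + sqrt h *\<^sub>R \<xi>"

text \<open>The centred terms of \<open>step_estimate\<close>, summed over the blocks with their
  weights.\<close>

definition noise_term :: "real \<Rightarrow> real \<Rightarrow> real \<Rightarrow> real ^ 'm \<Rightarrow> real ^ 'm \<Rightarrow> real ^ 'm \<Rightarrow> real" where
  "noise_term h \<delta> \<eta> x y \<xi> = (\<Sum>i\<in>UNIV. w i * (let r = norm (P i x - P i y); \<zeta> = dir \<delta> x y i \<bullet> \<xi> in
     if \<delta> \<le> r then profile.fd i r * (2 * sqrt h * \<zeta>) + h * ((profile.gen i r + \<eta> / 2) * (\<zeta>\<^sup>2 - 1)) else 0))"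

text \<open>\<open>coupled_step\<close> is summed with the weights; bounding x and y by K gives it
  uniform constants. The hypothesis on \<gamma> is used on the whole sum, where it turns the
  interaction into \<open>\<epsilon> i * f\<close>; together with \<open>- rate * f\<close> this is
  at most \<open>- c * f\<close> in each block.\<close>

lemma F_step:
  fixes K \<eta> :: real
  assumes "0 \<le> K" "0 < \<eta>"
  obtains \<delta> \<rho> h0 where "0 < \<delta>" "0 < \<rho>" "0 < h0"
    "\<And>x y h \<xi>. norm x \<le> K \<Longrightarrow> norm y \<le> K \<Longrightarrow> 0 < h \<Longrightarrow> h \<le> h0 \<Longrightarrow> sqrt h * norm \<xi> \<le> \<rho> \<Longrightarrow>
      F (euler_step h x \<xi>) (euler_step h y (mirror \<delta> x y \<xi>)) \<le> F x y + noise_term h \<delta> \<eta> x y \<xi> + h * (- c * F x y + CARD('n) * \<eta>)"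
proof -
  obtain L where L: "0 \<le> L"
    "\<And>i x y. norm x \<le> K \<Longrightarrow> norm y \<le> K \<Longrightarrow> norm (b0 i (P i x) - b0 i (P i y)) \<le> L * norm (P i x - P i y)"
    using b0_Lipschitz[OF assms(1)] by blast
  obtain C where C: "0 \<le> C" "\<And>i x y. norm (\<gamma> i x - \<gamma> i y) \<le> C * norm (x - y)" using \<gamma>_Lipschitz by blast
  \<comment> \<open>Points of the ball of radius K are at distance at most 2K, so M bounds the
    difference of \<open>\<gamma> i\<close>.\<close>
  define M where "M = C * (2 * K)"
  define Q where "Q i \<delta> \<rho> h0 \<longleftrightarrow> (\<forall>(z::real^'m) \<Delta>\<^sub>0 \<Delta>\<^sub>1 \<zeta> h. norm z \<le> 2 * K \<longrightarrow> norm \<Delta>\<^sub>0 \<le> L * norm z \<longrightarrow> norm \<Delta>\<^sub>1 \<le> M \<longrightarrow>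
        (z \<noteq> 0 \<longrightarrow> 2 * (z \<bullet> \<Delta>\<^sub>0) \<le> - ((norm z)\<^sup>2 * \<kappa> i (norm z))) \<longrightarrow> 0 < h \<longrightarrow> h \<le> h0 \<longrightarrow> sqrt h * \<bar>\<zeta>\<bar> \<le> \<rho> \<longrightarrow>
        profile.step_estimate i \<delta> \<eta> h \<zeta> z \<Delta>\<^sub>0 \<Delta>\<^sub>1)" for i \<delta> \<rho> h0
  have "\<exists>\<delta>0>0. \<forall>\<delta>. 0 < \<delta> \<longrightarrow> \<delta> \<le> \<delta>0 \<longrightarrow> (\<exists>\<rho>>0. \<exists>h0>0. Q i \<delta> \<rho> h0)" for i
    unfolding Q_def by (rule profile.coupled_step) (use assms L C in \<open>auto simp: M_def\<close>)
  then obtain \<delta>0 where \<delta>0: "\<And>i. 0 < \<delta>0 i" "\<And>i \<delta>. 0 < \<delta> \<Longrightarrow> \<delta> \<le> \<delta>0 i \<Longrightarrow> \<exists>\<rho>>0. \<exists>h0>0. Q i \<delta> \<rho> h0"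
    by metis
  define \<delta> where "\<delta> = Min (range \<delta>0)"
  have \<delta>: "0 < \<delta>" "\<And>i. \<delta> \<le> \<delta>0 i" using \<delta>0(1) by (auto simp: \<delta>_def Min_gr_iff)
  obtain \<rho>' h' where \<rho>': "\<And>i. 0 < \<rho>' i" "\<And>i. 0 < h' i" "\<And>i. Q i \<delta> (\<rho>' i) (h' i)"
    using \<delta>0(2)[OF \<delta>(1) \<delta>(2)] by metis
  define \<rho> where "\<rho> = Min (range \<rho>')"
  have \<rho>: "0 < \<rho>" "\<And>i. \<rho> \<le> \<rho>' i" using \<rho>'(1) by (auto simp: \<rho>_def Min_gr_iff)
  define h0 where "h0 = Min (range h')"
  have h0: "0 < h0" "\<And>i. h0 \<le> h' i" using \<rho>'(2) by (auto simp: h0_def Min_gr_iff)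
  show thesis
  proof (rule that[OF \<delta>(1) \<rho>(1) h0(1)])
    fix x y \<xi> :: "real ^ 'm" and h
    assume xy: "norm x \<le> K" "norm y \<le> K" and h: "0 < h" "h \<le> h0" and \<xi>: "sqrt h * norm \<xi> \<le> \<rho>"
    let ?x = "euler_step h x \<xi>" and ?y = "euler_step h y (mirror \<delta> x y \<xi>)"
    define r where "r i = norm (P i x - P i y)" for i
    define \<zeta> where "\<zeta> i = dir \<delta> x y i \<bullet> \<xi>" for i
    define N where "N i = (if \<delta> \<le> r i then profile.fd i (r i) * (2 * sqrt h * \<zeta> i) + h * ((profile.gen i (r i) + \<eta> / 2) * ((\<zeta> i)\<^sup>2 - 1)) else 0)" for i
    have nxy: "norm (x - y) \<le> 2 * K" using norm_triangle_ineq4[of x y] xy by linarith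
    have step: "ffun (\<kappa> i) (norm (P i ?x - P i ?y)) \<le> ffun (\<kappa> i) (r i) + N i
        + h * (norm (\<gamma> i x - \<gamma> i y) - rate (\<kappa> i) * ffun (\<kappa> i) (r i) + \<eta>)" for i
    proof -
      let ?z = "P i x - P i y" and ?\<Delta>0 = "b0 i (P i x) - b0 i (P i y)" and ?\<Delta>1 = "\<gamma> i x - \<gamma> i y"
      have diff: "P i ?x - P i ?y = ?z + h *\<^sub>R (?\<Delta>0 + ?\<Delta>1) + (2 * sqrt h * \<zeta> i) *\<^sub>R (if \<delta> \<le> norm ?z then ?z /\<^sub>R norm ?z else 0)"
        unfolding euler_step_def coord_proj_linear_simps block_drift block_mirror b_eq \<zeta>_def[symmetric]
        by (simp add: dir_def scaleR_diff_right scaleR_add_right)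
      have "profile.step_estimate i \<delta> \<eta> h (\<zeta> i) ?z ?\<Delta>0 ?\<Delta>1"
      proof (rule \<rho>'(3)[of i, unfolded Q_def, rule_format])
        show "norm ?z \<le> 2 * K" using norm_block_diff_le[of i x y] nxy by linarith
        show "norm ?\<Delta>0 \<le> L * norm ?z" using L xy by blast
        show "norm ?\<Delta>1 \<le> M"
          using C(2)[of i x y] mult_left_mono[OF nxy C(1)] by (simp add: M_def)
        show "2 * (?z \<bullet> ?\<Delta>0) \<le> - ((norm ?z)\<^sup>2 * \<kappa> i (norm ?z))"
          using b0_onesided[of "P i x" i "P i y"] by (cases "?z = 0") auto
        show "h \<le> h' i" using h h0(2)[of i] by linarith
        have "sqrt h * \<bar>\<zeta> i\<bar> \<le> sqrt h * norm \<xi>"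
          using h abs_dir_inner_le[OF \<delta>(1)] by (intro mult_left_mono) (auto simp: \<zeta>_def)
        then show "sqrt h * \<bar>\<zeta> i\<bar> \<le> \<rho>' i" using \<xi> \<rho>(2)[of i] by linarith
      qed (use h in auto)
      then show ?thesis unfolding diff N_def r_def profile.step_estimate_def .
    qed
    have "F ?x ?y = (\<Sum>i\<in>UNIV. w i * ffun (\<kappa> i) (norm (P i ?x - P i ?y)))"
      by (simp add: F_def mult.commute)
    also have "\<dots> \<le> (\<Sum>i\<in>UNIV. w i * (ffun (\<kappa> i) (r i) + N i
        + h * (norm (\<gamma> i x - \<gamma> i y) - rate (\<kappa> i) * ffun (\<kappa> i) (r i) + \<eta>)))"
      by (intro sum_mono mult_left_mono step w_nonneg)
    also have "\<dots> = F x y + noise_term h \<delta> \<eta> x y \<xi> + h * ((\<Sum>i\<in>UNIV. norm (\<gamma> i x - \<gamma> i y) * w i)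
        - (\<Sum>i\<in>UNIV. rate (\<kappa> i) * ffun (\<kappa> i) (r i) * w i) + (\<Sum>i\<in>UNIV. w i * \<eta>))"
      unfolding F_def noise_term_def N_def \<zeta>_def r_def Let_def
      by (simp add: distrib_left right_diff_distrib sum.distrib sum_subtractf sum_distrib_left mult_ac)
    also have "\<dots> \<le> F x y + noise_term h \<delta> \<eta> x y \<xi> + h * (- c * F x y + CARD('n) * \<eta>)"
    proof (intro add_left_mono mult_left_mono)
      have "(\<Sum>i\<in>UNIV. norm (\<gamma> i x - \<gamma> i y) * w i) - (\<Sum>i\<in>UNIV. rate (\<kappa> i) * ffun (\<kappa> i) (r i) * w i)
         \<le> (\<Sum>i\<in>UNIV. \<epsilon> i * ffun (\<kappa> i) (r i) * w i) - (\<Sum>i\<in>UNIV. rate (\<kappa> i) * ffun (\<kappa> i) (r i) * w i)"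
        using \<gamma>_bound[of x y] by (simp add: r_def)
      also have "\<dots> = (\<Sum>i\<in>UNIV. (\<epsilon> i - rate (\<kappa> i)) * (ffun (\<kappa> i) (r i) * w i))"
        by (simp add: sum_subtractf left_diff_distrib mult.assoc)
      also have "\<dots> \<le> (\<Sum>i\<in>UNIV. - c * (ffun (\<kappa> i) (r i) * w i))"
      proof (intro sum_mono mult_right_mono mult_nonneg_nonneg w_nonneg)
        show "\<epsilon> i - rate (\<kappa> i) \<le> - c" for i using c_le[of i] by linarith
      qed (simp add: profile.ffun_nonneg r_def)
      also have "\<dots> = - c * F x y" by (simp add: F_def r_def sum_distrib_left)
      finally have 1: "(\<Sum>i\<in>UNIV. norm (\<gamma> i x - \<gamma> i y) * w i) - (\<Sum>i\<in>UNIV. rate (\<kappa> i) * ffun (\<kappa> i) (r i) * w i) \<le> - c * F x y" .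
      have "(\<Sum>i\<in>UNIV. w i * \<eta>) \<le> (\<Sum>i\<in>(UNIV::'n set). 1 * \<eta>)"
        using w_bounds assms by (intro sum_mono mult_right_mono) auto
      then show "(\<Sum>i\<in>UNIV. norm (\<gamma> i x - \<gamma> i y) * w i) - (\<Sum>i\<in>UNIV. rate (\<kappa> i) * ffun (\<kappa> i) (r i) * w i) + (\<Sum>i\<in>UNIV. w i * \<eta>)
          \<le> - c * F x y + CARD('n) * \<eta>" using 1 by simp
    qed (use h in auto)
    finally show "F ?x ?y \<le> F x y + noise_term h \<delta> \<eta> x y \<xi> + h * (- c * F x y + CARD('n) * \<eta>)" .
  qed
qed

text \<open>For large noise, where \<open>F_step\<close> gives nothing, \<open>noise_term\<close>
  may be very negative; this limits how much has to be compensated there.\<close>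

lemma noise_term_bound:
  assumes "0 < \<delta>" "0 \<le> \<eta>"
  obtains G where "0 \<le> G" "\<And>x y h \<xi>. norm x \<le> K \<Longrightarrow> norm y \<le> K \<Longrightarrow> 0 < h \<Longrightarrow>
    \<bar>noise_term h \<delta> \<eta> x y \<xi>\<bar> \<le> G * (sqrt h * norm \<xi> + h * (norm \<xi>)\<^sup>2 + h)"
proof -
  have "\<exists>g\<ge>0. \<forall>r. 0 \<le> r \<longrightarrow> r \<le> 2 * K \<longrightarrow> \<bar>profile.gen i r\<bar> \<le> g" for i
    using profile.gen_bounded[where i=i and K="2 * K"] by metis
  then obtain g where g: "\<And>i. 0 \<le> g i" "\<And>i r. 0 \<le> r \<Longrightarrow> r \<le> 2 * K \<Longrightarrow> \<bar>profile.gen i r\<bar> \<le> g i" by metis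
  show thesis
  proof (rule that[of "\<Sum>i\<in>UNIV. 2 + g i + \<eta>"])
    show "0 \<le> (\<Sum>i\<in>UNIV. 2 + g i + \<eta>)" using g assms by (intro sum_nonneg) (simp add: add_nonneg_nonneg)
    fix x y \<xi> :: "real ^ 'm" and h :: real
    assume xy: "norm x \<le> K" "norm y \<le> K" and h: "0 < h"
    let ?B = "sqrt h * norm \<xi> + h * (norm \<xi>)\<^sup>2 + h"
    have "\<bar>w i * (let r = norm (P i x - P i y); \<zeta> = dir \<delta> x y i \<bullet> \<xi> in
        if \<delta> \<le> r then profile.fd i r * (2 * sqrt h * \<zeta>) + h * ((profile.gen i r + \<eta> / 2) * (\<zeta>\<^sup>2 - 1)) else 0)\<bar>
      \<le> (2 + g i + \<eta>) * ?B" for i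
    proof -
      define r where "r = norm (P i x - P i y)"
      define \<zeta> where "\<zeta> = dir \<delta> x y i \<bullet> \<xi>"
      have B: "0 \<le> ?B" using h by simp
      have r: "0 \<le> r" "r \<le> 2 * K"
        using norm_block_diff_le[of i x y] norm_triangle_ineq4[of x y] xy unfolding r_def by auto
      have \<zeta>: "\<bar>\<zeta>\<bar> \<le> norm \<xi>" using abs_dir_inner_le[OF assms(1)] by (simp add: \<zeta>_def)
      then have \<zeta>2: "\<zeta>\<^sup>2 \<le> (norm \<xi>)\<^sup>2" by (simp add: abs_le_square_iff[symmetric])
      have "\<bar>profile.fd i r * (2 * sqrt h * \<zeta>)\<bar> \<le> 1 * (2 * sqrt h * norm \<xi>)"
        unfolding abs_mult using \<zeta> h profile.fd_nonneg[OF r(1)] profile.fd_le_1[OF r(1)] by (intro mult_mono) auto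
      moreover have "\<bar>h * ((profile.gen i r + \<eta> / 2) * (\<zeta>\<^sup>2 - 1))\<bar> \<le> h * ((g i + \<eta>) * ((norm \<xi>)\<^sup>2 + 1))"
      proof -
        have "\<bar>\<zeta>\<^sup>2 - 1\<bar> \<le> (norm \<xi>)\<^sup>2 + 1" using \<zeta>2 zero_le_power2[of \<zeta>] by linarith
        then show ?thesis
          unfolding abs_mult using h g(2)[OF r, of i] assms g(1)[of i] by (intro mult_mono) auto
      qed
      ultimately have "\<bar>profile.fd i r * (2 * sqrt h * \<zeta>) + h * ((profile.gen i r + \<eta> / 2) * (\<zeta>\<^sup>2 - 1))\<bar>
        \<le> 2 * (sqrt h * norm \<xi>) + (g i + \<eta>) * (h * (norm \<xi>)\<^sup>2 + h)"
        by (simp add: algebra_simps)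
      also have "\<dots> \<le> 2 * ?B + (g i + \<eta>) * ?B"
        using h g(1)[of i] assms by (intro add_mono mult_left_mono) auto
      also have "\<dots> = (2 + g i + \<eta>) * ?B" by (simp add: algebra_simps)
      finally have *: "\<bar>profile.fd i r * (2 * sqrt h * \<zeta>) + h * ((profile.gen i r + \<eta> / 2) * (\<zeta>\<^sup>2 - 1))\<bar> \<le> (2 + g i + \<eta>) * ?B" .
      have "0 \<le> (2 + g i + \<eta>) * ?B" using B g(1)[of i] assms by (intro mult_nonneg_nonneg) auto
      then have "\<bar>if \<delta> \<le> r then profile.fd i r * (2 * sqrt h * \<zeta>) + h * ((profile.gen i r + \<eta> / 2) * (\<zeta>\<^sup>2 - 1)) else 0\<bar> \<le> (2 + g i + \<eta>) * ?B"
        using * by auto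
      then have "\<bar>w i\<bar> * \<bar>if \<delta> \<le> r then profile.fd i r * (2 * sqrt h * \<zeta>) + h * ((profile.gen i r + \<eta> / 2) * (\<zeta>\<^sup>2 - 1)) else 0\<bar> \<le> 1 * ((2 + g i + \<eta>) * ?B)"
        using w_bounds[of i] by (intro mult_mono) auto
      then show ?thesis unfolding Let_def r_def[symmetric] \<zeta>_def[symmetric] abs_mult by simp
    qed
    then have "\<bar>noise_term h \<delta> \<eta> x y \<xi>\<bar> \<le> (\<Sum>i\<in>UNIV. (2 + g i + \<eta>) * ?B)"
      unfolding noise_term_def by (intro order_trans[OF sum_abs] sum_mono)
    then show "\<bar>noise_term h \<delta> \<eta> x y \<xi>\<bar> \<le> (\<Sum>i\<in>UNIV. 2 + g i + \<eta>) * ?B"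
      by (simp add: sum_distrib_right)
  qed
qed

text \<open>A reflecting direction has norm 1, so \<open>\<zeta>\<close> has mean 0 and second
  moment 1; the other blocks contribute 0.\<close>

lemma noise_term_centred:
  assumes "0 < \<delta>"
  shows "integrable gauss (noise_term h \<delta> \<eta> x y)" "(\<integral>\<xi>. noise_term h \<delta> \<eta> x y \<xi> \<partial>gauss) = 0"
proof -
  interpret G: prob_space "gauss :: (real ^ 'm) measure" by (rule prob_gauss)
  let ?t = "\<lambda>i \<xi>. w i * (let r = norm (P i x - P i y); \<zeta> = dir \<delta> x y i \<bullet> \<xi> in
     if \<delta> \<le> r then profile.fd i r * (2 * sqrt h * \<zeta>) + h * ((profile.gen i r + \<eta> / 2) * (\<zeta>\<^sup>2 - 1)) else 0)"
  have t: "integrable gauss (?t i) \<and> (\<integral>\<xi>. ?t i \<xi> \<partial>gauss) = 0" for i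
  proof (cases "\<delta> \<le> norm (P i x - P i y)")
    case True
    then have "norm (dir \<delta> x y i) = 1" using norm_dir[OF assms] by simp
    note gauss_inner_sq[OF this] gauss_mean[of "dir \<delta> x y i"]
    then show ?thesis using True G.prob_space by (simp add: Let_def)
  qed (simp add: Let_def)
  show "integrable gauss (noise_term h \<delta> \<eta> x y)"
    unfolding noise_term_def[abs_def] using t by (intro Bochner_Integration.integrable_sum) blast
  show "(\<integral>\<xi>. noise_term h \<delta> \<eta> x y \<xi> \<partial>gauss) = 0"
    unfolding noise_term_def[abs_def]
    by (subst Bochner_Integration.integral_sum) (simp_all only: t sum.neutral_const)
qed

end

lemma norm_add_scaleR_sq:
  fixes u v :: "'a::real_inner"
  shows "(norm (u + a *\<^sub>R v))\<^sup>2 = (norm u)\<^sup>2 + 2 * a * (u \<bullet> v) + a\<^sup>2 * (norm v)\<^sup>2"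
proof -
  have "(norm (u + a *\<^sub>R v))\<^sup>2 = u \<bullet> u + (u \<bullet> (a *\<^sub>R v) + (a *\<^sub>R v) \<bullet> u) + (a *\<^sub>R v) \<bullet> (a *\<^sub>R v)"
    by (simp add: power2_norm_eq_inner inner_add_left inner_add_right distrib_left)
  also have "(a *\<^sub>R v) \<bullet> u = u \<bullet> (a *\<^sub>R v)" by (rule inner_commute)
  finally show ?thesis by (simp add: power2_norm_eq_inner) (simp add: power2_eq_square algebra_simps)
qed

section \<open>The Lyapunov function and its one-step supermartingale property\<close>

context weakly_coupled_drift
begin

lemma growth_constant_exists:
  "\<exists>C\<ge>0. \<forall>x y. 2 * (x \<bullet> drift x) + 2 * (y \<bullet> drift y) + 2 * real CARD('m) \<le> C * (1 + (norm x)\<^sup>2 + (norm y)\<^sup>2)"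
proof -
  obtain C where C: "0 \<le> C" "\<And>x. x \<bullet> drift x \<le> C * (1 + (norm x)\<^sup>2)" using drift_growth by blast
  show ?thesis
  proof (intro exI[of _ "4 * C + 2 * real CARD('m)"] conjI allI)
    fix x y
    have "2 * (x \<bullet> drift x) + 2 * (y \<bullet> drift y) \<le> C * (4 + 2 * (norm x)\<^sup>2 + 2 * (norm y)\<^sup>2)"
      using C(2)[of x] C(2)[of y] by (simp add: algebra_simps)
    also have "\<dots> \<le> C * (4 * (1 + (norm x)\<^sup>2 + (norm y)\<^sup>2))"
      using C(1) by (intro mult_left_mono) auto
    finally have "2 * (x \<bullet> drift x) + 2 * (y \<bullet> drift y) \<le> 4 * C * (1 + (norm x)\<^sup>2 + (norm y)\<^sup>2)" by (simp add: mult_ac)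
    moreover have "2 * real CARD('m) * 1 \<le> 2 * real CARD('m) * (1 + (norm x)\<^sup>2 + (norm y)\<^sup>2)"
      by (intro mult_left_mono) auto
    ultimately show "2 * (x \<bullet> drift x) + 2 * (y \<bullet> drift y) + 2 * real CARD('m) \<le> (4 * C + 2 * real CARD('m)) * (1 + (norm x)\<^sup>2 + (norm y)\<^sup>2)"
      by (simp only: distrib_right mult_1_right)
  qed (use C in auto)
qed

text \<open>The left side is the generator of the two diffusions applied to
  \<open>(norm x)\<^sup>2 + (norm y)\<^sup>2\<close>. The constant is fixed once because
  \<open>lyap\<close> is defined with it.\<close>

definition growth :: real where
  "growth = (SOME C. 0 \<le> C \<and> (\<forall>x y. 2 * (x \<bullet> drift x) + 2 * (y \<bullet> drift y) + 2 * real CARD('m) \<le> C * (1 + (norm x)\<^sup>2 + (norm y)\<^sup>2)))"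

lemma growth: "0 \<le> growth"
    "2 * (x \<bullet> drift x) + 2 * (y \<bullet> drift y) + 2 * real CARD('m) \<le> growth * (1 + (norm x)\<^sup>2 + (norm y)\<^sup>2)"
  using someI_ex[OF growth_constant_exists] unfolding growth_def by blast+

text \<open>The surplus 1 over \<open>growth\<close> makes the quadratic term decay strictly, by an
  amount of order h in each step.\<close>

definition lyap :: "real \<Rightarrow> real \<Rightarrow> real ^ 'm \<Rightarrow> real ^ 'm \<Rightarrow> real" where
  "lyap l s x y = exp (c * s) * F x y + l * exp (- (growth + 1) * s) * (1 + (norm x)\<^sup>2 + (norm y)\<^sup>2)"

text \<open>For negative r the integral runs over an empty interval, so \<open>ffun\<close> is
  constant there and factors through \<open>max 0 r\<close>, on whose range it is
  continuous.\<close>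

lemma ffun_measurable [measurable]: "ffun (\<kappa> i) \<in> borel_measurable borel"
proof -
  have "ffun (\<kappa> i) = (\<lambda>r. ffun (\<kappa> i) (max 0 r))"
  proof
    fix r show "ffun (\<kappa> i) r = ffun (\<kappa> i) (max 0 r)"
      by (cases "0 \<le> r") (auto simp: ffun_def max_def)
  qed
  also have "continuous_on UNIV (\<lambda>r. ffun (\<kappa> i) (max 0 r))"
    by (rule continuous_on_compose2[OF profile.cont_ffun]) (auto intro!: continuous_intros)
  then have "(\<lambda>r. ffun (\<kappa> i) (max 0 r)) \<in> borel_measurable borel"
    by (rule borel_measurable_continuous_onI)
  finally show ?thesis .
qed

lemma F_measurable [measurable]:
  assumes [measurable]: "f \<in> borel_measurable M" "g \<in> borel_measurable M"
  shows "(\<lambda>x. F (f x) (g x)) \<in> borel_measurable M"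
  unfolding F_def by measurable

lemma lyap_measurable [measurable]:
  assumes [measurable]: "f \<in> borel_measurable M" "g \<in> borel_measurable M"
  shows "(\<lambda>x. lyap l s (f x) (g x)) \<in> borel_measurable M"
  unfolding lyap_def by measurable

lemma lyap_nonneg: "0 \<le> l \<Longrightarrow> 0 \<le> lyap l s x y"
  unfolding lyap_def using F_nonneg by (intro add_nonneg_nonneg mult_nonneg_nonneg) auto

lemma euler_step_measurable [measurable]:
  assumes [measurable]: "f \<in> borel_measurable M" "g \<in> borel_measurable M"
  shows "(\<lambda>x. euler_step h (f x) (g x)) \<in> borel_measurable M"
  unfolding euler_step_def by measurable

lemma dir_measurable [measurable]:
  assumes [measurable]: "f \<in> borel_measurable M" "g \<in> borel_measurable M"
  shows "(\<lambda>x. dir \<delta> (f x) (g x) i) \<in> borel_measurable M"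
  unfolding dir_def by measurable

lemma mirror_measurable [measurable]:
  assumes [measurable]: "f \<in> borel_measurable M" "g \<in> borel_measurable M" "k \<in> borel_measurable M"
  shows "(\<lambda>x. mirror \<delta> (f x) (g x) (k x)) \<in> borel_measurable M"
  unfolding mirror_def by measurable

text \<open>The cross term is odd in the noise and has mean 0. The orthogonal map T is the identity
  for the first chain and \<open>mirror\<close> for the second.\<close>

lemma euler_step_norm_sq:
  fixes T :: "real ^ 'm \<Rightarrow> real ^ 'm"
  assumes T: "orthogonal_transformation T" and [measurable]: "T \<in> borel_measurable borel" and h: "0 \<le> h"
  shows "integrable gauss (\<lambda>\<xi>. (norm (euler_step h x (T \<xi>)))\<^sup>2)"
    "(\<integral>\<xi>. (norm (euler_step h x (T \<xi>)))\<^sup>2 \<partial>gauss) = (norm x)\<^sup>2 + 2 * h * (x \<bullet> drift x) + h * (h * (norm (drift x))\<^sup>2) + h * CARD('m)"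
proof -
  interpret G: prob_space "gauss :: (real ^ 'm) measure" by (rule prob_gauss)
  let ?v = "x + h *\<^sub>R drift x"
  have eq: "(norm (euler_step h x (T \<xi>)))\<^sup>2 = (norm ?v)\<^sup>2 + 2 * sqrt h * (?v \<bullet> T \<xi>) + h * (norm \<xi>)\<^sup>2" for \<xi>
  proof -
    have "(norm (?v + sqrt h *\<^sub>R T \<xi>))\<^sup>2 = (norm ?v)\<^sup>2 + 2 * sqrt h * (?v \<bullet> T \<xi>) + (sqrt h)\<^sup>2 * (norm (T \<xi>))\<^sup>2"
      by (rule norm_add_scaleR_sq)
    then show ?thesis using h by (simp add: euler_step_def orthogonal_transformation_norm[OF T])
  qed
  have "integrable (distr gauss borel T) (\<lambda>\<xi>. ?v \<bullet> \<xi>)"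
    unfolding distr_gauss_orthogonal[OF T] by (rule gauss_mean)
  then have 1: "integrable gauss (\<lambda>\<xi>. ?v \<bullet> T \<xi>)" by (simp add: integrable_distr_eq)
  have 2: "(\<integral>\<xi>. ?v \<bullet> T \<xi> \<partial>gauss) = 0"
    using gauss_integral_orthogonal[OF T, of "\<lambda>\<xi>. ?v \<bullet> \<xi>"] gauss_mean(2)[of ?v] by simp
  show "integrable gauss (\<lambda>\<xi>. (norm (euler_step h x (T \<xi>)))\<^sup>2)"
    unfolding eq using 1 gauss_norm_sq(1) by auto
  have "(\<integral>\<xi>. (norm (euler_step h x (T \<xi>)))\<^sup>2 \<partial>gauss) = (norm ?v)\<^sup>2 + 2 * sqrt h * 0 + h * DIM(real ^ 'm)"
    unfolding eq using 1 gauss_norm_sq[where 'a="real ^ 'm"] G.prob_space by (simp add: 2)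
  also have "(norm ?v)\<^sup>2 = (norm x)\<^sup>2 + 2 * h * (x \<bullet> drift x) + h * (h * (norm (drift x))\<^sup>2)"
    unfolding norm_add_scaleR_sq by (simp add: power2_eq_square)
  finally show "(\<integral>\<xi>. (norm (euler_step h x (T \<xi>)))\<^sup>2 \<partial>gauss) = (norm x)\<^sup>2 + 2 * h * (x \<bullet> drift x) + h * (h * (norm (drift x))\<^sup>2) + h * CARD('m)"
    by simp
qed

text \<open>Since \<open>lyap\<close> exceeds \<open>S\<close> outside a compact set, truncation at \<open>S\<close> tames the superlinear drift
  there; inside, the strict decay of the quadratic term absorbs all errors of order \<open>h\<close>.\<close>

lemma lyap_step:
  fixes l S T :: real
  assumes l: "0 < l" and S: "0 < S" and T: "0 \<le> T"
  obtains \<delta> h0 where "0 < \<delta>" "0 < h0"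
    "\<And>x y s h. 0 \<le> s \<Longrightarrow> s \<le> T \<Longrightarrow> 0 < h \<Longrightarrow> h \<le> h0 \<Longrightarrow>
      (\<integral>\<xi>. min (lyap l (s + h) (euler_step h x \<xi>) (euler_step h y (mirror \<delta> x y \<xi>))) S \<partial>gauss) \<le> min (lyap l s x y) S"
proof -
  interpret G: prob_space "gauss :: (real ^ 'm) measure" by (rule prob_gauss)
  let ?C = "growth + 1" and ?n = "real CARD('n)"
  have n: "0 < ?n" by simp
  define E1 where "E1 = exp (c * (T + 1))"
  define lT where "lT = l * exp (- ?C * T)"
  \<comment> \<open>\<open>lT\<close> is the smallest weight of the quadratic term up to time T, so
    \<open>lyap < S\<close> confines x and y to the ball of radius K.\<close>
  define K where "K = sqrt (S / lT)"
  \<comment> \<open>Budget per step: the quadratic term gains \<open>h * lT / 4\<close>; the error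
    of \<open>F_step\<close>, amplified by at most E1, and the tail of the noise are allowed
    \<open>h * lT / 16\<close> each.\<close>
  define \<eta> where "\<eta> = lT / (16 * E1 * ?n)"
  have pos: "0 < E1" "0 < lT" using l by (auto simp: E1_def lT_def)
  then have \<eta>: "0 < \<eta>" "E1 * (?n * \<eta>) = lT / 16" using n by (auto simp: \<eta>_def)
  have K: "0 \<le> K" by (simp add: K_def pos S less_imp_le)
  obtain \<delta> \<rho> hF where F: "0 < \<delta>" "0 < \<rho>" "0 < hF"
    "\<And>x y h \<xi>. norm x \<le> K \<Longrightarrow> norm y \<le> K \<Longrightarrow> 0 < h \<Longrightarrow> h \<le> hF \<Longrightarrow> sqrt h * norm \<xi> \<le> \<rho> \<Longrightarrow>
      F (euler_step h x \<xi>) (euler_step h y (mirror \<delta> x y \<xi>)) \<le> F x y + noise_term h \<delta> \<eta> x y \<xi> + h * (- c * F x y + ?n * \<eta>)"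
    using F_step[OF K \<eta>(1)] by blast
  obtain G where G: "0 \<le> G" "\<And>x y h \<xi>. norm x \<le> K \<Longrightarrow> norm y \<le> K \<Longrightarrow> 0 < h \<Longrightarrow>
      \<bar>noise_term h \<delta> \<eta> x y \<xi>\<bar> \<le> G * (sqrt h * norm \<xi> + h * (norm \<xi>)\<^sup>2 + h)"
    using noise_term_bound[OF F(1) less_imp_le[OF \<eta>(1)], of K] by blast
  obtain B where B: "0 \<le> B" "\<And>x. norm x \<le> K \<Longrightarrow> norm (drift x) \<le> B" using drift_bounded[of K] by blast
  \<comment> \<open>For \<open>a = sqrt h * norm \<xi>\<close> beyond \<rho>, the numbers 1 and a
    are at most \<open>a\<^sup>2 / \<rho>\<^sup>2\<close> and \<open>a\<^sup>2 / \<rho>\<close>.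
    Hence \<open>D * a\<^sup>2\<close> exceeds S plus the worst negative value of the noise term;
    the final 1 makes D positive.\<close>
  define D where "D = S / \<rho>\<^sup>2 + E1 * (G * (1 / \<rho> + 1 + 1 / \<rho>\<^sup>2)) + 1"
  have D: "0 < D" unfolding D_def using S F pos G by (intro add_nonneg_pos add_nonneg_nonneg mult_nonneg_nonneg) auto
  obtain R where R: "0 < R" "(\<integral>\<xi>. (norm (\<xi>::real^'m))\<^sup>2 * indicator {\<xi>. R < norm \<xi>} \<xi> \<partial>gauss) < lT / (16 * D)"
    using gauss_tail_small[of "lT / (16 * D)", where 'a="real^'m"] pos D by auto
  let ?tail = "\<lambda>\<xi>::real^'m. (norm \<xi>)\<^sup>2 * indicator {\<xi>. R < norm \<xi>} \<xi>"
  have "eventually (\<lambda>h. h * 1 \<le> 1 \<and> h * 1 \<le> hF \<and> h * c \<le> 1 \<and> h * (2 * B\<^sup>2) \<le> 1/4 \<and> h * R\<^sup>2 \<le> \<rho>\<^sup>2) (at_right 0)"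
    using F by (intro eventually_conj eventually_mult_le) auto
  then obtain h1 where h1: "0 < h1" "\<And>h. 0 < h \<Longrightarrow> h < h1 \<Longrightarrow>
      h \<le> 1 \<and> h \<le> hF \<and> h * c \<le> 1 \<and> h * (2 * B\<^sup>2) \<le> 1/4 \<and> h * R\<^sup>2 \<le> \<rho>\<^sup>2"
    unfolding eventually_at_right_field by auto
  show thesis
  proof (rule that[of \<delta> "h1 / 2"])
    fix x y :: "real ^ 'm" and s h :: real
    assume s: "0 \<le> s" "s \<le> T" and h: "0 < h" "h \<le> h1 / 2"
    have hh: "h \<le> 1" "h \<le> hF" "h * c \<le> 1" "h * (2 * B\<^sup>2) \<le> 1/4" "h * R\<^sup>2 \<le> \<rho>\<^sup>2"
      using h1(2)[of h] h h1(1) by auto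
    let ?x = "\<lambda>\<xi>. euler_step h x \<xi>" and ?y = "\<lambda>\<xi>. euler_step h y (mirror \<delta> x y \<xi>)"
    let ?L = "\<lambda>\<xi>. min (lyap l (s + h) (?x \<xi>) (?y \<xi>)) S"
    have intL: "integrable gauss ?L"
      by (rule G.integrable_const_bound[where B=S]) (use lyap_nonneg l S in \<open>auto simp: less_imp_le\<close>)
    show "(\<integral>\<xi>. ?L \<xi> \<partial>gauss) \<le> min (lyap l s x y) S"
    proof (cases "S \<le> lyap l s x y")
      case True
      have "(\<integral>\<xi>. ?L \<xi> \<partial>gauss) \<le> (\<integral>\<xi>. S \<partial>(gauss :: (real ^ 'm) measure))"
        by (intro integral_mono intL) auto
      then show ?thesis using True G.prob_space by simp
    next
      case False
      define A where "A = l * exp (- ?C * s)"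
      have A: "lT \<le> A" unfolding A_def lT_def using l s growth(1) by (intro mult_left_mono) auto
      have xy: "norm x \<le> K" "norm y \<le> K"
      proof -
        have "A * (1 + (norm x)\<^sup>2 + (norm y)\<^sup>2) \<le> S"
          using False F_nonneg[of x y] unfolding lyap_def A_def
          by (smt (verit) exp_ge_zero mult_nonneg_nonneg)
        then have "lT * (1 + (norm x)\<^sup>2 + (norm y)\<^sup>2) \<le> S"
          using A by (smt (verit) mult_right_mono zero_le_power2)
        then have "1 + (norm x)\<^sup>2 + (norm y)\<^sup>2 \<le> S / lT" using pos by (simp add: field_simps)
        then have "(norm x)\<^sup>2 \<le> S / lT" "(norm y)\<^sup>2 \<le> S / lT" by (smt (verit) zero_le_power2)+
        then show "norm x \<le> K" "norm y \<le> K" unfolding K_def by (auto intro: real_le_rsqrt)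
      qed
      define V where "V = (norm x)\<^sup>2 + (norm y)\<^sup>2"
      have V: "0 \<le> V" by (simp add: V_def)
      define e1 where "e1 = exp (c * (s + h))"
      define e2 where "e2 = l * exp (- ?C * (s + h))"
      have e1: "0 < e1" "e1 \<le> E1" using s hh c_pos by (auto simp: e1_def E1_def)
      have e2: "0 < e2" "e2 = A * exp (- ?C * h)" using l by (auto simp: e2_def A_def exp_add[symmetric] algebra_simps)
      let ?N = "noise_term h \<delta> \<eta> x y"
      let ?V = "\<lambda>\<xi>. (norm (?x \<xi>))\<^sup>2 + (norm (?y \<xi>))\<^sup>2"
      define U where "U \<xi> = e1 * (F x y + ?N \<xi> + h * (- c * F x y + ?n * \<eta>)) + e2 * (1 + ?V \<xi>)" for \<xi>
      \<comment> \<open>Keeps the non-random part of \<open>U\<close> nonnegative, by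
        \<open>h * c \<le> 1\<close>; used where \<open>U\<close> is bounded below by its noise term
        alone.\<close>
      have Fc: "0 \<le> F x y + h * (- c * F x y + ?n * \<eta>)"
      proof -
        have "0 \<le> F x y * (1 - h * c)" using F_nonneg hh by simp
        moreover have "0 \<le> h * (?n * \<eta>)" using h \<eta> by simp
        ultimately show ?thesis by (simp add: algebra_simps)
      qed
      \<comment> \<open>Small noise is covered by \<open>F_step\<close>. For large noise the left
        side is at most S, and the tail term compensates for it; since
        \<open>h * R\<^sup>2 \<le> \<rho>\<^sup>2\<close>, large noise forces
        \<open>R < norm \<xi>\<close>, so that the tail beyond R suffices.\<close>
      have point: "?L \<xi> \<le> U \<xi> + D * (h * ?tail \<xi>)" for \<xi>
      proof (cases "sqrt h * norm \<xi> \<le> \<rho>")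
        case True
        have "lyap l (s + h) (?x \<xi>) (?y \<xi>) = e1 * F (?x \<xi>) (?y \<xi>) + e2 * (1 + ?V \<xi>)"
          by (simp add: lyap_def e1_def e2_def add.assoc)
        also have "\<dots> \<le> U \<xi>"
          unfolding U_def using e1 F(4)[OF xy h(1) hh(2) True] by (intro add_right_mono mult_left_mono) auto
        also have "\<dots> \<le> U \<xi> + D * (h * ?tail \<xi>)" using D h by (simp add: indicator_def)
        finally show ?thesis by (simp add: min_le_iff_disj)
      next
        case False
        define a where "a = sqrt h * norm \<xi>"
        have a: "\<rho> < a" "h * (norm \<xi>)\<^sup>2 = a\<^sup>2" using False h by (auto simp: a_def power_mult_distrib)
        have "R < norm \<xi>"
        proof (rule ccontr)
          assume "\<not> R < norm \<xi>"
          then have "a\<^sup>2 \<le> h * R\<^sup>2" unfolding a(2)[symmetric] using h by (intro mult_left_mono power_mono) auto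
          then have "a\<^sup>2 \<le> \<rho>\<^sup>2" using hh by linarith
          then show False using a(1) F(2) by (smt (verit) power_strict_mono zero_less_numeral)
        qed
        then have tail: "h * ?tail \<xi> = a\<^sup>2" using a by simp
        have a2: "1 \<le> a\<^sup>2 / \<rho>\<^sup>2" "a \<le> a\<^sup>2 / \<rho>"
          using a(1) F(2) by (auto simp: field_simps power2_eq_square intro!: mult_mono)
        have "\<bar>?N \<xi>\<bar> \<le> G * (a + a\<^sup>2 + h)"
          using G(2)[OF xy h(1), of \<xi>] a by (simp add: a_def)
        also have "\<dots> \<le> G * (a\<^sup>2 / \<rho> + a\<^sup>2 + a\<^sup>2 / \<rho>\<^sup>2)"
          using a2 hh G by (intro mult_left_mono add_mono) auto
        finally have "e1 * \<bar>?N \<xi>\<bar> \<le> E1 * (G * (a\<^sup>2 / \<rho> + a\<^sup>2 + a\<^sup>2 / \<rho>\<^sup>2))"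
          using e1 by (intro mult_mono) auto
        moreover have "e1 * (- ?N \<xi>) \<le> e1 * \<bar>?N \<xi>\<bar>" using e1 by (intro mult_left_mono) auto
        ultimately have "e1 * (- ?N \<xi>) \<le> E1 * (G * (a\<^sup>2 / \<rho> + a\<^sup>2 + a\<^sup>2 / \<rho>\<^sup>2))" by linarith
        moreover have "S \<le> S * (a\<^sup>2 / \<rho>\<^sup>2)" using mult_left_mono[OF a2(1), of S] S by simp
        moreover have "D * a\<^sup>2 = S * (a\<^sup>2 / \<rho>\<^sup>2) + E1 * (G * (a\<^sup>2 / \<rho> + a\<^sup>2 + a\<^sup>2 / \<rho>\<^sup>2)) + a\<^sup>2"
          unfolding D_def by (simp add: algebra_simps)
        moreover have "U \<xi> \<ge> e1 * ?N \<xi>"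
        proof -
          have "0 \<le> e1 * (F x y + h * (- c * F x y + ?n * \<eta>))" using e1 Fc by simp
          moreover have "0 \<le> e2 * (1 + ?V \<xi>)" using e2 by simp
          moreover have "U \<xi> = e1 * (F x y + h * (- c * F x y + ?n * \<eta>)) + e1 * ?N \<xi> + e2 * (1 + ?V \<xi>)"
            unfolding U_def by (simp only: distrib_left add.assoc add.left_commute add.commute)
          ultimately show ?thesis by linarith
        qed
        ultimately have "S \<le> U \<xi> + D * (h * ?tail \<xi>)"
          unfolding tail using zero_le_power2[of a] by (simp only: mult_minus_right)
        then show ?thesis by (simp add: min_le_iff_disj)
      qed
      have T1: "orthogonal_transformation (\<lambda>\<xi>::real^'m. \<xi>)" by simp
      note Vx = euler_step_norm_sq[OF T1 _ less_imp_le[OF h(1)], of x, simplified]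
      note Vy = euler_step_norm_sq[OF mirror_orthogonal[OF F(1)] _ less_imp_le[OF h(1)], of x y y, simplified]
      note N = noise_term_centred[OF F(1), of h \<eta> x y]
      have tail: "integrable gauss ?tail"
        by (rule Bochner_Integration.integrable_bound[OF gauss_norm_sq(1)]) (auto simp: indicator_def)
      have intU: "integrable gauss U"
        unfolding U_def using Vx(1) Vy(1) N(1) by (intro Bochner_Integration.integrable_add integrable_mult_right G.integrable_const) auto
      have "(\<integral>\<xi>. ?L \<xi> \<partial>gauss) \<le> (\<integral>\<xi>. U \<xi> + D * (h * ?tail \<xi>) \<partial>gauss)"
        by (intro integral_mono intL point Bochner_Integration.integrable_add integrable_mult_right intU tail)
      also have "\<dots> = (\<integral>\<xi>. U \<xi> \<partial>gauss) + D * (h * (\<integral>\<xi>. ?tail \<xi> \<partial>gauss))"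
        using intU tail by simp
      also have "D * (h * (\<integral>\<xi>. ?tail \<xi> \<partial>gauss)) \<le> h * (lT / 16)"
      proof -
        have "D * (\<integral>\<xi>. ?tail \<xi> \<partial>gauss) \<le> D * (lT / (16 * D))" using R D by (intro mult_left_mono) auto
        also have "\<dots> = lT / 16" using D by simp
        finally have "h * (D * (\<integral>\<xi>. ?tail \<xi> \<partial>gauss)) \<le> h * (lT / 16)" using h by (intro mult_left_mono) auto
        then show ?thesis unfolding mult.left_commute[of D h] .
      qed
      also have "(\<integral>\<xi>. U \<xi> \<partial>gauss) = e1 * (F x y + h * (- c * F x y + ?n * \<eta>))
          + e2 * (1 + ((\<integral>\<xi>. (norm (?x \<xi>))\<^sup>2 \<partial>gauss) + (\<integral>\<xi>. (norm (?y \<xi>))\<^sup>2 \<partial>gauss)))"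
        unfolding U_def using Vx(1) Vy(1) N G.prob_space by simp
      also have "e1 * (F x y + h * (- c * F x y + ?n * \<eta>)) \<le> exp (c * s) * F x y + h * (lT / 16)"
      proof -
        \<comment> \<open>The decay of \<open>F\<close> in one step offsets the growth of the
          prefactor from time s to s + h.\<close>
        have "exp (c * h) * (1 - h * c) \<le> exp (c * h) * exp (- (h * c))"
          using exp_ge_add_one_self[of "- (h * c)"] by (intro mult_left_mono) auto
        also have "\<dots> = 1" by (simp add: exp_minus mult.commute)
        finally have "exp (c * s) * F x y * (exp (c * h) * (1 - h * c)) \<le> exp (c * s) * F x y * 1"
          using F_nonneg by (intro mult_left_mono) auto
        moreover have "e1 * (h * (?n * \<eta>)) \<le> E1 * (h * (?n * \<eta>))" using e1 h \<eta> by (intro mult_right_mono) auto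
        moreover have "E1 * (h * (?n * \<eta>)) = h * (lT / 16)" unfolding mult.left_commute[of E1 h] \<eta>(2) ..
        moreover have "e1 * (F x y + h * (- c * F x y + ?n * \<eta>)) = exp (c * s) * F x y * (exp (c * h) * (1 - h * c)) + e1 * (h * (?n * \<eta>))"
          by (simp add: e1_def exp_add algebra_simps)
        ultimately show ?thesis by linarith
      qed
      also have "e2 * (1 + ((\<integral>\<xi>. (norm (?x \<xi>))\<^sup>2 \<partial>gauss) + (\<integral>\<xi>. (norm (?y \<xi>))\<^sup>2 \<partial>gauss))) \<le> A * (1 + V) - h * (lT / 4)"
      proof -
        have "(\<integral>\<xi>. (norm (?x \<xi>))\<^sup>2 \<partial>gauss) + (\<integral>\<xi>. (norm (?y \<xi>))\<^sup>2 \<partial>gauss)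
          = V + h * (2 * (x \<bullet> drift x) + 2 * (y \<bullet> drift y) + 2 * real CARD('m)) + h * (h * ((norm (drift x))\<^sup>2 + (norm (drift y))\<^sup>2))"
          unfolding Vx(2) Vy(2) V_def by (simp add: algebra_simps)
        also have "\<dots> \<le> V + h * (growth * (1 + V)) + h * (1/4)"
        proof (intro add_mono mult_left_mono order_refl)
          show "2 * (x \<bullet> drift x) + 2 * (y \<bullet> drift y) + 2 * real CARD('m) \<le> growth * (1 + V)"
            using growth(2)[of x y] by (simp add: V_def add.assoc)
          have "h * ((norm (drift x))\<^sup>2 + (norm (drift y))\<^sup>2) \<le> h * (B\<^sup>2 + B\<^sup>2)"
            using B xy h by (intro mult_left_mono add_mono power_mono) auto
          then show "h * ((norm (drift x))\<^sup>2 + (norm (drift y))\<^sup>2) \<le> 1/4" using hh(4) by simp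
        qed (use h in auto)
        finally have "1 + ((\<integral>\<xi>. (norm (?x \<xi>))\<^sup>2 \<partial>gauss) + (\<integral>\<xi>. (norm (?y \<xi>))\<^sup>2 \<partial>gauss)) \<le> (1 + V) * (1 + h * growth) + h / 4"
          by (simp add: algebra_simps)
        then have "e2 * (1 + ((\<integral>\<xi>. (norm (?x \<xi>))\<^sup>2 \<partial>gauss) + (\<integral>\<xi>. (norm (?y \<xi>))\<^sup>2 \<partial>gauss))) \<le> e2 * ((1 + V) * (1 + h * growth) + h / 4)"
          using e2 by (intro mult_left_mono) auto
        also have "\<dots> = A * (1 + V) * (exp (- ?C * h) * (1 + h * growth)) + e2 * (h / 4)"
          unfolding e2(2) by (simp add: algebra_simps)
        also have "\<dots> \<le> A * (1 + V) * (1 - h / 2) + A * (h / 4)"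
        proof (intro add_mono mult_left_mono mult_right_mono)
          \<comment> \<open>The growth of the second moment cancels, and the surplus 1 in
            \<open>growth + 1\<close> leaves \<open>exp (- h)\<close>.\<close>
          have "exp (- ?C * h) * (1 + h * growth) \<le> exp (- ?C * h) * exp (h * growth)"
            using exp_ge_add_one_self[of "h * growth"] by (intro mult_left_mono) auto
          also have "\<dots> = exp (- h)" by (simp add: exp_add[symmetric] algebra_simps)
          also have "\<dots> \<le> 1 - h / 2"
          proof -
            have "exp (-h) \<le> 1 / (1 + h)"
              using exp_ge_add_one_self[of h] h by (simp add: exp_minus field_simps)
            also have "\<dots> \<le> 1 - h / 2"
              using h hh mult_mono[of h 1 h 1] by (simp add: field_simps power2_eq_square)
            finally show ?thesis .
          qed
          finally show "exp (- ?C * h) * (1 + h * growth) \<le> 1 - h / 2" .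
          show "0 \<le> A * (1 + V)" using A pos V by simp
          have "exp (- ?C * h) \<le> 1" using h growth(1) by (auto simp: mult_le_0_iff)
          then show "e2 \<le> A" unfolding e2(2) using A pos mult_left_mono[of "exp (- ?C * h)" 1 A] by simp
        qed (use h in auto)
        also have "\<dots> \<le> A * (1 + V) - h * (lT / 4)"
        proof -
          have "A * h \<le> A * h * (1 + V)" using A pos h V by (simp add: mult_nonneg_nonneg)
          moreover have "lT * h \<le> A * h" using A h by (intro mult_right_mono) auto
          ultimately show ?thesis by (simp add: algebra_simps)
        qed
        finally show ?thesis .
      qed
      also have "exp (c * s) * F x y + h * (lT / 16) + (A * (1 + V) - h * (lT / 4)) + h * (lT / 16) \<le> lyap l s x y"
        using h pos by (simp add: lyap_def A_def V_def add.assoc)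
      finally show ?thesis using False by simp
    qed
  qed (use F h1 in auto)
qed

end

section \<open>Iterated kernels\<close>

primrec iter_kernel :: "'a measure \<Rightarrow> ('a \<Rightarrow> 'a measure) \<Rightarrow> nat \<Rightarrow> 'a \<Rightarrow> 'a measure" where
  "iter_kernel N K 0 x = return N x"
| "iter_kernel N K (Suc k) x = iter_kernel N K k x \<bind> K"

lemma iter_kernel_measurable [measurable]:
  assumes "K \<in> N \<rightarrow>\<^sub>M prob_algebra N"
  shows "iter_kernel N K k \<in> N \<rightarrow>\<^sub>M prob_algebra N"
proof (induction k)
  case 0
  show ?case by (simp add: measurable_return_prob_space cong: measurable_cong)
next
  case (Suc k)
  then show ?case using measurable_bind_prob_space[OF Suc assms] by (simp cong: measurable_cong)
qed

lemma iter_kernel_in_space: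
  assumes "K \<in> N \<rightarrow>\<^sub>M prob_algebra N" "x \<in> space N"
  shows "iter_kernel N K k x \<in> space (prob_algebra N)"
  using measurable_space[OF iter_kernel_measurable[OF assms(1)] assms(2)] .

lemma distr_bind_kernel:
  assumes \<mu>: "\<mu> \<in> space (prob_algebra N)" and K: "K \<in> N \<rightarrow>\<^sub>M prob_algebra L" and f: "f \<in> L \<rightarrow>\<^sub>M R"
  shows "distr (\<mu> \<bind> K) R f = \<mu> \<bind> (\<lambda>x. distr (K x) R f)"
proof (rule distr_bind)
  have "sets \<mu> = sets N" "prob_space \<mu>" using \<mu> by (auto simp: space_prob_algebra)
  then show "K \<in> \<mu> \<rightarrow>\<^sub>M subprob_algebra L" "space \<mu> \<noteq> {}"
    using measurable_prob_algebraD[OF K] by (auto cong: measurable_cong_sets simp: prob_space.not_empty)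
qed (rule f)

lemma bind_distr_kernel:
  assumes \<mu>: "\<mu> \<in> space (prob_algebra N)" and f: "f \<in> N \<rightarrow>\<^sub>M L" and K: "K \<in> L \<rightarrow>\<^sub>M prob_algebra R"
  shows "distr \<mu> L f \<bind> K = \<mu> \<bind> (\<lambda>x. K (f x))"
proof (rule bind_distr)
  have "sets \<mu> = sets N" "prob_space \<mu>" using \<mu> by (auto simp: space_prob_algebra)
  then show "f \<in> \<mu> \<rightarrow>\<^sub>M L" "space \<mu> \<noteq> {}"
    using f by (auto cong: measurable_cong_sets simp: prob_space.not_empty)
qed (rule measurable_prob_algebraD[OF K])

text \<open>Intertwining: if f maps one step of Q to one step of K, it maps the chain to the chain.
  With the two projections for f this identifies both marginals of the coupled chain.\<close>

lemma iter_kernel_image: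
  assumes Q: "Q \<in> N \<rightarrow>\<^sub>M prob_algebra N" and K: "K \<in> L \<rightarrow>\<^sub>M prob_algebra L" and f: "f \<in> N \<rightarrow>\<^sub>M L"
    and fQ: "\<And>p. p \<in> space N \<Longrightarrow> distr (Q p) L f = K (f p)"
    and p: "p \<in> space N"
  shows "distr (iter_kernel N Q k p) L f = iter_kernel L K k (f p)"
proof (induction k)
  case 0
  show ?case using f p by (simp add: distr_return)
next
  case (Suc k)
  note I = iter_kernel_in_space[OF Q p, of k]
  have "distr (iter_kernel N Q (Suc k) p) L f = iter_kernel N Q k p \<bind> (\<lambda>x. distr (Q x) L f)"
    using distr_bind_kernel[OF I Q f] by simp
  also have "\<dots> = iter_kernel N Q k p \<bind> (\<lambda>x. K (f x))"
    by (rule bind_cong) (use I fQ in \<open>auto simp: space_prob_algebra dest!: sets_eq_imp_space_eq\<close>)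
  also have "\<dots> = distr (iter_kernel N Q k p) L f \<bind> K"
    using bind_distr_kernel[OF I f K] by simp
  finally show ?case using Suc by simp
qed

lemma nn_integral_bind_kernel:
  assumes \<mu>: "\<mu> \<in> space (prob_algebra N)" and K: "K \<in> N \<rightarrow>\<^sub>M prob_algebra L" and f: "f \<in> borel_measurable L"
  shows "(\<integral>\<^sup>+ y. f y \<partial>(\<mu> \<bind> K)) = (\<integral>\<^sup>+ x. \<integral>\<^sup>+ y. f y \<partial>K x \<partial>\<mu>)"
proof (rule nn_integral_bind[OF f])
  show "K \<in> \<mu> \<rightarrow>\<^sub>M subprob_algebra L"
    using \<mu> measurable_prob_algebraD[OF K] by (auto cong: measurable_cong_sets simp: space_prob_algebra)
qed

text \<open>Tower property, with V depending on the step number because \<open>lyap\<close> depends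
  on time.\<close>

lemma iter_kernel_supermartingale:
  assumes Q: "Q \<in> N \<rightarrow>\<^sub>M prob_algebra N" and p: "p \<in> space N"
    and V: "\<And>k. V k \<in> borel_measurable N"
    and step: "\<And>k q. k < n \<Longrightarrow> q \<in> space N \<Longrightarrow> (\<integral>\<^sup>+ y. V (Suc k) y \<partial>Q q) \<le> V k q"
  shows "(\<integral>\<^sup>+ y. V n y \<partial>iter_kernel N Q n p) \<le> V 0 p"
proof -
  have "k \<le> n \<Longrightarrow> (\<integral>\<^sup>+ y. V k y \<partial>iter_kernel N Q k p) \<le> V 0 p" for k
  proof (induction k)
    case 0
    show ?case using V p by (simp add: nn_integral_return)
  next
    case (Suc k)
    note I = iter_kernel_in_space[OF Q p, of k]
    have "(\<integral>\<^sup>+ y. V (Suc k) y \<partial>iter_kernel N Q (Suc k) p) = (\<integral>\<^sup>+ q. \<integral>\<^sup>+ y. V (Suc k) y \<partial>Q q \<partial>iter_kernel N Q k p)"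
      using nn_integral_bind_kernel[OF I Q V] by simp
    also have "\<dots> \<le> (\<integral>\<^sup>+ q. V k q \<partial>iter_kernel N Q k p)"
      using Suc.prems I by (intro nn_integral_mono step) (auto simp: space_prob_algebra dest!: sets_eq_imp_space_eq)
    also have "\<dots> \<le> V 0 p" using Suc by simp
    finally show ?case .
  qed
  then show ?thesis by simp
qed

abbreviation borel2 :: "('a::topological_space \<times> 'a) measure" where
  "borel2 \<equiv> borel \<Otimes>\<^sub>M borel"

section \<open>The Euler kernel and its coupling\<close>

context weakly_coupled_drift
begin

definition euler_kernel :: "real \<Rightarrow> real ^ 'm \<Rightarrow> (real ^ 'm) measure" where
  "euler_kernel h x = distr gauss borel (euler_step h x)"

definition coupled_kernel :: "real \<Rightarrow> real \<Rightarrow> (real ^ 'm) \<times> (real ^ 'm) \<Rightarrow> ((real ^ 'm) \<times> (real ^ 'm)) measure" where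
  "coupled_kernel h \<delta> p = distr gauss borel2
     (\<lambda>\<xi>. (euler_step h (fst p) \<xi>, euler_step h (snd p) (mirror \<delta> (fst p) (snd p) \<xi>)))"

lemma gauss_in_prob_algebra: "gauss \<in> space (prob_algebra borel)"
  by (simp add: space_prob_algebra prob_gauss)

lemma euler_kernel_measurable [measurable]: "euler_kernel h \<in> borel \<rightarrow>\<^sub>M prob_algebra borel"
  unfolding euler_kernel_def[abs_def]
  by (rule measurable_distr_prob_space2[where M=borel and g="\<lambda>_. gauss"])
     (auto intro!: measurable_const gauss_in_prob_algebra)

lemma coupled_kernel_measurable [measurable]: "coupled_kernel h \<delta> \<in> borel2 \<rightarrow>\<^sub>M prob_algebra borel2"
  unfolding coupled_kernel_def[abs_def]
  by (rule measurable_distr_prob_space2[where M=borel and g="\<lambda>_. gauss"])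
     (auto intro!: measurable_const gauss_in_prob_algebra)

lemma distr_coupled_kernel_fst: "distr (coupled_kernel h \<delta> p) borel fst = euler_kernel h (fst p)"
  unfolding coupled_kernel_def euler_kernel_def by (subst distr_distr) (auto simp: comp_def)

text \<open>The mirror depends on the current positions but is orthogonal for each of them, so it
  leaves the Gaussian law unchanged.\<close>

lemma distr_coupled_kernel_snd:
  assumes "0 < \<delta>"
  shows "distr (coupled_kernel h \<delta> p) borel snd = euler_kernel h (snd p)"
proof -
  have "distr (coupled_kernel h \<delta> p) borel snd = distr gauss borel (\<lambda>\<xi>. euler_step h (snd p) (mirror \<delta> (fst p) (snd p) \<xi>))"
    unfolding coupled_kernel_def by (subst distr_distr) (auto simp: comp_def)
  also have "\<dots> = distr (distr gauss borel (mirror \<delta> (fst p) (snd p))) borel (euler_step h (snd p))"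
    by (subst distr_distr) (auto simp: comp_def)
  finally show ?thesis
    by (simp add: distr_gauss_orthogonal[OF mirror_orthogonal[OF assms]] euler_kernel_def)
qed

lemma coupled_chain_marginals:
  assumes "0 < \<delta>"
  shows "distr (iter_kernel borel2 (coupled_kernel h \<delta>) k p) borel fst = iter_kernel borel (euler_kernel h) k (fst p)"
    "distr (iter_kernel borel2 (coupled_kernel h \<delta>) k p) borel snd = iter_kernel borel (euler_kernel h) k (snd p)"
proof -
  have p: "p \<in> space borel2" by (simp add: space_pair_measure)
  show "distr (iter_kernel borel2 (coupled_kernel h \<delta>) k p) borel fst = iter_kernel borel (euler_kernel h) k (fst p)"
    by (rule iter_kernel_image[OF coupled_kernel_measurable euler_kernel_measurable measurable_fst _ p])
       (rule distr_coupled_kernel_fst)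
  show "distr (iter_kernel borel2 (coupled_kernel h \<delta>) k p) borel snd = iter_kernel borel (euler_kernel h) k (snd p)"
    by (rule iter_kernel_image[OF coupled_kernel_measurable euler_kernel_measurable measurable_snd _ p])
       (rule distr_coupled_kernel_snd[OF assms])
qed

text \<open>\<open>lyap_step\<close> is uniform in the positions and in times up to t, so \<delta>
  and N0 depend on l, S and t but not on the starting point; N0 only has to push the step below
  h0.\<close>

lemma coupled_chain_lyap:
  fixes l S t :: real
  assumes l: "0 < l" and S: "0 < S" and t: "0 < t"
  shows "\<exists>\<delta>>0. \<exists>N0. \<forall>N\<ge>N0. \<forall>p. (\<integral>\<^sup>+ q. ennreal (min (lyap l t (fst q) (snd q)) S)
    \<partial>iter_kernel borel2 (coupled_kernel (t / real (Suc N)) \<delta>) (Suc N) p) \<le> ennreal (lyap l 0 (fst p) (snd p))"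
proof -
  obtain \<delta> h0 where step: "0 < \<delta>" "0 < h0"
    "\<And>x y s h. 0 \<le> s \<Longrightarrow> s \<le> t \<Longrightarrow> 0 < h \<Longrightarrow> h \<le> h0 \<Longrightarrow>
      (\<integral>\<xi>. min (lyap l (s + h) (euler_step h x \<xi>) (euler_step h y (mirror \<delta> x y \<xi>))) S \<partial>gauss) \<le> min (lyap l s x y) S"
    using lyap_step[OF l S, of t] t by auto
  obtain N0 :: nat where N0: "t / h0 < real N0" using reals_Archimedean2 by blast
  have "(\<integral>\<^sup>+ q. ennreal (min (lyap l t (fst q) (snd q)) S)
    \<partial>iter_kernel borel2 (coupled_kernel (t / real (Suc N)) \<delta>) (Suc N) p) \<le> ennreal (lyap l 0 (fst p) (snd p))"
    if N: "N0 \<le> N" for N p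
  proof -
    interpret G: prob_space "gauss :: (real ^ 'm) measure" by (rule prob_gauss)
    define h where "h = t / real (Suc N)"
    have "t / h0 < real (Suc N)" using N0 N by linarith
    then have h: "0 < h" "h \<le> h0" using t step(2) by (auto simp: h_def field_simps)
    have nonneg: "0 \<le> min (lyap l s x y) S" for s x y using lyap_nonneg[of l s x y] l S by simp
    define V where "V k q = ennreal (min (lyap l (real k * h) (fst q) (snd q)) S)" for k q
    have "(\<integral>\<^sup>+ q. V (Suc N) q \<partial>iter_kernel borel2 (coupled_kernel h \<delta>) (Suc N) p) \<le> V 0 p"
    proof (rule iter_kernel_supermartingale)
      fix k q assume k: "k < Suc N"
      let ?x = "euler_step h (fst q)" and ?y = "\<lambda>\<xi>. euler_step h (snd q) (mirror \<delta> (fst q) (snd q) \<xi>)"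
      have s: "real k * h \<le> t"
      proof -
        have "real k * h \<le> real (Suc N) * h" using k h by (intro mult_right_mono) auto
        then show ?thesis by (simp add: h_def)
      qed
      have "(\<integral>\<^sup>+ q. V (Suc k) q \<partial>coupled_kernel h \<delta> q) = (\<integral>\<^sup>+ \<xi>. ennreal (min (lyap l (real k * h + h) (?x \<xi>) (?y \<xi>)) S) \<partial>gauss)"
        unfolding coupled_kernel_def V_def by (subst nn_integral_distr) (auto simp: distrib_right add.commute)
      also have "\<dots> = ennreal (\<integral>\<xi>. min (lyap l (real k * h + h) (?x \<xi>) (?y \<xi>)) S \<partial>gauss)"
        by (rule nn_integral_eq_integral)
           (use nonneg lyap_nonneg[of l] l S in \<open>auto intro!: G.integrable_const_bound[where B=S]\<close>)
      also have "\<dots> \<le> V k q"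
        unfolding V_def using step(3)[of "real k * h" h "fst q" "snd q"] s h by (intro ennreal_leI) auto
      finally show "(\<integral>\<^sup>+ q. V (Suc k) q \<partial>coupled_kernel h \<delta> q) \<le> V k q" .
    qed (auto simp: V_def[abs_def] space_pair_measure)
    also have "V 0 p \<le> ennreal (lyap l 0 (fst p) (snd p))"
      unfolding V_def by (intro ennreal_leI) simp
    finally show ?thesis by (simp add: V_def h_def)
  qed
  then show ?thesis using step(1) by blast
qed

end

section \<open>The Euler scheme\<close>

text \<open>A deterministic recursion with prescribed increments v, so that a single Brownian path
  drives the schemes for all step sizes and all starting points.\<close>

primrec euler_path :: "('a::real_vector \<Rightarrow> 'a) \<Rightarrow> real \<Rightarrow> 'a \<Rightarrow> (nat \<Rightarrow> 'a) \<Rightarrow> nat \<Rightarrow> 'a" where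
  "euler_path \<beta> h x v 0 = x"
| "euler_path \<beta> h x v (Suc k) = euler_path \<beta> h x v k + h *\<^sub>R \<beta> (euler_path \<beta> h x v k) + v k"

definition increments :: "real \<Rightarrow> (real \<Rightarrow> 'a::real_vector) \<Rightarrow> nat \<Rightarrow> 'a" where
  "increments h W k = W (real (Suc k) * h) - W (real k * h)"

text \<open>Discrete Gronwall: the bound solves
  \<open>a (Suc k) = (1 + h * L) * a k + h * L * \<eta>\<close> with \<open>a 0 = 0\<close>. The
  Lipschitz bound is available only within distance 1 of the path, and the induction itself keeps
  the scheme in that tube, because the bound never exceeds
  \<open>exp (L * t) * \<eta> \<le> 1\<close>.\<close>

lemma euler_path_error:
  fixes \<beta> :: "'a::euclidean_space \<Rightarrow> 'a"
  assumes X: "continuous_on {0..t} X" and \<beta>: "continuous_on UNIV \<beta>"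
    and eq: "\<And>s. 0 \<le> s \<Longrightarrow> s \<le> t \<Longrightarrow> X s = x + integral {0..s} (\<lambda>u. \<beta> (X u)) + W s" and W0: "W 0 = 0"
    and L: "0 \<le> L" "\<And>s y. 0 \<le> s \<Longrightarrow> s \<le> t \<Longrightarrow> norm (y - X s) \<le> 1 \<Longrightarrow>
        (\<And>u. 0 \<le> u \<Longrightarrow> u \<le> t \<Longrightarrow> norm (\<beta> y - \<beta> (X u)) \<le> L * norm (y - X u))"
    and h: "0 < h" "real n * h \<le> t"
    and osc: "\<And>s s'. 0 \<le> s \<Longrightarrow> s \<le> s' \<Longrightarrow> s' \<le> t \<Longrightarrow> s' - s \<le> h \<Longrightarrow> norm (X s - X s') \<le> \<eta>"
    and \<eta>: "exp (L * t) * \<eta> \<le> 1"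
  shows "k \<le> n \<Longrightarrow> norm (euler_path \<beta> h x (increments h W) k - X (real k * h)) \<le> (1 + h * L) ^ k * \<eta> - \<eta>"
proof (induction k)
  case 0
  have "0 \<le> real n * h" using h by simp
  then have "0 \<le> t" using h by linarith
  then have "X 0 = x" using eq[of 0] W0 by simp
  then show ?case by simp
next
  case (Suc k)
  let ?e = "euler_path \<beta> h x (increments h W) k" and ?s = "real k * h" and ?s' = "real (Suc k) * h"
  have s: "0 \<le> ?s" "?s \<le> ?s'" "?s' - ?s = h" using h by (auto simp: algebra_simps)
  have s't: "?s' \<le> t"
    using mult_right_mono[of "real (Suc k)" "real n" h] Suc.prems h by linarith
  have \<eta>0: "0 \<le> \<eta>" using osc[of ?s ?s'] s s't norm_ge_zero[of "X ?s - X ?s'"] by linarith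
  have IH: "norm (?e - X ?s) \<le> (1 + h * L) ^ k * \<eta> - \<eta>" using Suc by simp
  have "(1 + h * L) ^ k \<le> exp (h * L) ^ k"
    using h L by (intro power_mono exp_ge_add_one_self) auto
  also have "\<dots> = exp (L * ?s)" by (simp add: exp_of_nat_mult[symmetric] mult_ac)
  also have "\<dots> \<le> exp (L * t)" using L s s't by (simp add: mult_left_mono)
  finally have "(1 + h * L) ^ k * \<eta> \<le> exp (L * t) * \<eta>" using \<eta>0 by (intro mult_right_mono) auto
  \<comment> \<open>The scheme is still in the unit tube, so the Lipschitz bound applies to the next
    step.\<close>
  then have close: "norm (?e - X ?s) \<le> 1" using IH \<eta> \<eta>0 by linarith
  have cont: "continuous_on {a..b} (\<lambda>u. \<beta> (X u))" if "0 \<le> a" "b \<le> t" for a b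
    by (rule continuous_on_compose2[OF \<beta>]) (use that in \<open>auto intro: continuous_on_subset[OF X]\<close>)
  have "integral {0..?s} (\<lambda>u. \<beta> (X u)) + integral {?s..?s'} (\<lambda>u. \<beta> (X u)) = integral {0..?s'} (\<lambda>u. \<beta> (X u))"
    using s s't by (intro Henstock_Kurzweil_Integration.integral_combine integrable_continuous_real cont) auto
  then have "X ?s' = X ?s + integral {?s..?s'} (\<lambda>u. \<beta> (X u)) + increments h W k"
    using eq[of ?s] eq[of ?s'] s s't by (simp add: increments_def algebra_simps)
  then have "euler_path \<beta> h x (increments h W) (Suc k) - X ?s' = (?e - X ?s) + (h *\<^sub>R \<beta> ?e - integral {?s..?s'} (\<lambda>u. \<beta> (X u)))"
    by simp
  also have "h *\<^sub>R \<beta> ?e - integral {?s..?s'} (\<lambda>u. \<beta> (X u)) = integral {?s..?s'} (\<lambda>u. \<beta> ?e - \<beta> (X u))"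
  proof (subst Henstock_Kurzweil_Integration.integral_diff)
    show "(\<lambda>u. \<beta> (X u)) integrable_on {?s..?s'}" using s s't by (intro integrable_continuous_real cont) auto
    show "h *\<^sub>R \<beta> ?e - integral {?s..?s'} (\<lambda>u. \<beta> (X u)) = integral {?s..?s'} (\<lambda>u. \<beta> ?e) - integral {?s..?s'} (\<lambda>u. \<beta> (X u))"
      using s by simp
  qed auto
  also have "norm ((?e - X ?s) + \<dots>) \<le> norm (?e - X ?s) + L * (norm (?e - X ?s) + \<eta>) * (?s' - ?s)"
  proof (rule norm_triangle_le, rule add_left_mono, rule integral_bound)
    show "continuous_on {?s..?s'} (\<lambda>u. \<beta> ?e - \<beta> (X u))" using s s't by (intro continuous_intros cont) auto
    fix u assume "u \<in> {?s..?s'}"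
    then have u: "?s \<le> u" "u \<le> ?s'" by (auto simp del: of_nat_Suc)
    then have u0: "0 \<le> u" "u \<le> t" using s(1) s't by linarith+
    have "norm (\<beta> ?e - \<beta> (X u)) \<le> L * norm (?e - X u)"
      by (rule L(2)[OF s(1) _ close u0]) (use s s't in linarith)
    also have "\<dots> \<le> L * (norm (?e - X ?s) + \<eta>)"
    proof (intro mult_left_mono L)
      have "norm (X ?s - X u) \<le> \<eta>" by (rule osc[OF s(1) u(1) u0(2)]) (use u s(3) in linarith)
      then show "norm (?e - X u) \<le> norm (?e - X ?s) + \<eta>"
        using norm_triangle_ineq[of "?e - X ?s" "X ?s - X u"] by simp
    qed
    finally show "norm (\<beta> ?e - \<beta> (X u)) \<le> L * (norm (?e - X ?s) + \<eta>)" .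
  qed (use s in simp)
  also have "\<dots> = (1 + h * L) * norm (?e - X ?s) + h * L * \<eta>" unfolding s(3) by (simp add: algebra_simps)
  also have "\<dots> \<le> (1 + h * L) * ((1 + h * L) ^ k * \<eta> - \<eta>) + h * L * \<eta>"
    using IH h L by (intro add_right_mono mult_left_mono) auto
  also have "\<dots> = (1 + h * L) ^ Suc k * \<eta> - \<eta>" by (simp add: algebra_simps)
  finally show ?case .
qed

text \<open>A local Lipschitz condition is enough: L is taken on the compact unit tube around the
  given solution path, which exists up to time t.\<close>

lemma euler_path_tendsto:
  fixes \<beta> :: "'a::euclidean_space \<Rightarrow> 'a"
  assumes t: "0 < t" and X: "continuous_on {0..t} X" and \<beta>: "continuous_on UNIV \<beta>"
    and lip: "\<And>S. compact S \<Longrightarrow> \<exists>L\<ge>0. \<forall>y\<in>S. \<forall>z\<in>S. norm (\<beta> y - \<beta> z) \<le> L * norm (y - z)"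
    and eq: "\<And>s. 0 \<le> s \<Longrightarrow> s \<le> t \<Longrightarrow> X s = x + integral {0..s} (\<lambda>u. \<beta> (X u)) + W s" and W0: "W 0 = 0"
  shows "(\<lambda>N. euler_path \<beta> (t / real (Suc N)) x (increments (t / real (Suc N)) W) (Suc N)) \<longlonglongrightarrow> X t"
proof (rule LIMSEQ_I)
  fix \<epsilon> :: real assume "0 < \<epsilon>"
  define S where "S = (\<lambda>(s, u). X s + u) ` ({0..t} \<times> cball 0 1)"
  have "compact S" unfolding S_def
  proof (rule compact_continuous_image)
    show "continuous_on ({0..t} \<times> cball 0 1) (\<lambda>(s, u). X s + u)"
      unfolding case_prod_beta by (intro continuous_intros continuous_on_compose2[OF X]) auto
  qed (auto intro: compact_Times)
  from lip[OF this] obtain L where L: "0 \<le> L" "\<And>y z. y \<in> S \<Longrightarrow> z \<in> S \<Longrightarrow> norm (\<beta> y - \<beta> z) \<le> L * norm (y - z)"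
    by metis
  \<comment> \<open>The entry 1 keeps the scheme inside the tube, the entry
    \<open>\<epsilon> / 2\<close> gives the accuracy; dividing by \<open>exp (L * t)\<close>
    anticipates the Gronwall factor.\<close>
  define \<eta> where "\<eta> = min 1 (\<epsilon> / 2) / exp (L * t)"
  have \<eta>: "0 < \<eta>" "exp (L * t) * \<eta> = min 1 (\<epsilon> / 2)" using \<open>0 < \<epsilon>\<close> by (auto simp: \<eta>_def)
  have "uniformly_continuous_on {0..t} X" using X by (intro compact_uniformly_continuous) auto
  then obtain d where d: "0 < d" "\<And>s s'. s \<in> {0..t} \<Longrightarrow> s' \<in> {0..t} \<Longrightarrow> dist s' s < d \<Longrightarrow> dist (X s') (X s) < \<eta>"
    unfolding uniformly_continuous_on_def using \<eta>(1) by metis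
  obtain N0 :: nat where N0: "t / d < real N0" using reals_Archimedean2 by blast
  show "\<exists>N0. \<forall>N\<ge>N0. norm (euler_path \<beta> (t / real (Suc N)) x (increments (t / real (Suc N)) W) (Suc N) - X t) < \<epsilon>"
  proof (intro exI[of _ N0] allI impI)
    fix N assume N: "N0 \<le> N"
    define h where "h = t / real (Suc N)"
    have "t / d < real (Suc N)" using N0 N by linarith
    then have h: "0 < h" "h < d" "real (Suc N) * h = t" using t d(1) by (auto simp: h_def field_simps)
    have "norm (euler_path \<beta> h x (increments h W) (Suc N) - X (real (Suc N) * h)) \<le> (1 + h * L) ^ Suc N * \<eta> - \<eta>"
    proof (rule euler_path_error[OF X \<beta> eq W0 L(1)])
      fix s y u assume s: "0 \<le> s" "s \<le> t" "norm (y - X s) \<le> 1" and u: "0 \<le> u" "u \<le> t"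
      have "y \<in> S" unfolding S_def using s by (intro image_eqI[of _ _ "(s, y - X s)"]) auto
      moreover have "X u \<in> S" unfolding S_def using u by (intro image_eqI[of _ _ "(u, 0)"]) auto
      ultimately show "norm (\<beta> y - \<beta> (X u)) \<le> L * norm (y - X u)" by (rule L(2))
    next
      fix s s' assume "0 \<le> s" "s \<le> s'" "s' \<le> t" "s' - s \<le> h"
      then have "dist (X s) (X s') < \<eta>" using h by (intro d(2)) (auto simp: dist_real_def)
      then show "norm (X s - X s') \<le> \<eta>" by (simp add: dist_norm)
    qed (use h \<eta> in auto)
    also have "(1 + h * L) ^ Suc N * \<eta> - \<eta> < exp (L * t) * \<eta>"
    proof -
      have "(1 + h * L) ^ Suc N \<le> exp (h * L) ^ Suc N"
        using h L by (intro power_mono exp_ge_add_one_self) auto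
      also have "\<dots> = exp (L * (real (Suc N) * h))" by (simp only: exp_of_nat_mult[symmetric] mult_ac)
      finally have "(1 + h * L) ^ Suc N * \<eta> \<le> exp (L * t) * \<eta>"
        unfolding h(3) using \<eta> by (intro mult_right_mono) auto
      then show ?thesis using \<eta> by linarith
    qed
    also have "\<dots> \<le> \<epsilon> / 2" unfolding \<eta>(2) by simp
    finally show "norm (euler_path \<beta> (t / real (Suc N)) x (increments (t / real (Suc N)) W) (Suc N) - X t) < \<epsilon>"
      using \<open>0 < \<epsilon>\<close> unfolding h(3) unfolding h_def by linarith
  qed
qed

section \<open>Measurability and law of the Euler path\<close>

lemma euler_path_cong: "(\<And>l. l < k \<Longrightarrow> v l = v' l) \<Longrightarrow> euler_path \<beta> h x v k = euler_path \<beta> h x v' k"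
  by (induction k) auto

lemma euler_path_measurable [measurable]:
  fixes \<beta> :: "'a::euclidean_space \<Rightarrow> 'a"
  assumes [measurable]: "\<beta> \<in> borel_measurable borel" "f \<in> borel_measurable M"
    and v: "\<And>l. l < k \<Longrightarrow> (\<lambda>\<omega>. v \<omega> l) \<in> borel_measurable M"
  shows "(\<lambda>\<omega>. euler_path \<beta> h (f \<omega>) (v \<omega>) k) \<in> borel_measurable M"
  using v
proof (induction k)
  case (Suc k)
  then have [measurable]: "(\<lambda>\<omega>. v \<omega> k) \<in> borel_measurable M" "(\<lambda>\<omega>. euler_path \<beta> h (f \<omega>) (v \<omega>) k) \<in> borel_measurable M"
    by auto
  show ?case by simp
qed simp

lemma distr_pair_eq_bind:
  assumes "prob_space \<mu>" "prob_space \<nu>" and f[measurable]: "f \<in> \<mu> \<Otimes>\<^sub>M \<nu> \<rightarrow>\<^sub>M L"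
  shows "distr (\<mu> \<Otimes>\<^sub>M \<nu>) L f = \<mu> \<bind> (\<lambda>x. distr \<nu> L (\<lambda>y. f (x, y)))"
proof -
  interpret \<mu>: prob_space \<mu> by fact
  interpret \<nu>: prob_space \<nu> by fact
  have K: "(\<lambda>x. distr \<nu> L (\<lambda>y. f (x, y))) \<in> \<mu> \<rightarrow>\<^sub>M prob_algebra L"
    by (rule measurable_distr_prob_space2[where M=\<nu> and g="\<lambda>_. \<nu>"])
       (auto intro!: measurable_const simp: space_prob_algebra assms)
  have \<mu>: "\<mu> \<in> space (prob_algebra \<mu>)" by (simp add: space_prob_algebra assms)
  show ?thesis
  proof (rule measure_eqI)
    show "sets (distr (\<mu> \<Otimes>\<^sub>M \<nu>) L f) = sets (\<mu> \<bind> (\<lambda>x. distr \<nu> L (\<lambda>y. f (x, y))))"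
      using sets_bind'[OF \<mu> K] by simp
    fix A assume "A \<in> sets (distr (\<mu> \<Otimes>\<^sub>M \<nu>) L f)"
    then have A[measurable]: "A \<in> sets L" by simp
    have "emeasure (distr (\<mu> \<Otimes>\<^sub>M \<nu>) L f) A = (\<integral>\<^sup>+ x. emeasure \<nu> (Pair x -` (f -` A \<inter> space (\<mu> \<Otimes>\<^sub>M \<nu>))) \<partial>\<mu>)"
      by (simp add: emeasure_distr \<nu>.emeasure_pair_measure_alt)
    also have "\<dots> = (\<integral>\<^sup>+ x. emeasure (distr \<nu> L (\<lambda>y. f (x, y))) A \<partial>\<mu>)"
    proof (rule nn_integral_cong)
      fix x assume x: "x \<in> space \<mu>"
      then have "Pair x -` (f -` A \<inter> space (\<mu> \<Otimes>\<^sub>M \<nu>)) = (\<lambda>y. f (x, y)) -` A \<inter> space \<nu>"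
        by (auto simp: space_pair_measure)
      then show "emeasure \<nu> (Pair x -` (f -` A \<inter> space (\<mu> \<Otimes>\<^sub>M \<nu>))) = emeasure (distr \<nu> L (\<lambda>y. f (x, y))) A"
        using x by (subst emeasure_distr) auto
    qed
    also have "\<dots> = emeasure (\<mu> \<bind> (\<lambda>x. distr \<nu> L (\<lambda>y. f (x, y)))) A"
      using emeasure_bind_prob_algebra[OF \<mu> K A] by simp
    finally show "emeasure (distr (\<mu> \<Otimes>\<^sub>M \<nu>) L f) A = emeasure (\<mu> \<bind> (\<lambda>x. distr \<nu> L (\<lambda>y. f (x, y)))) A" .
  qed
qed

text \<open>Markov property: the position after k steps depends only on the increments before k,
  which are independent of increment k.\<close>

lemma (in prob_space) distr_euler_path_Suc:
  fixes \<beta> :: "'b::euclidean_space \<Rightarrow> 'b"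
  assumes \<beta>[measurable]: "\<beta> \<in> borel_measurable borel"
    and indep: "indep_vars (\<lambda>_. borel) v {..<n}" and k: "k < n"
  shows "distr M borel (\<lambda>\<omega>. euler_path \<beta> h x (\<lambda>l. v l \<omega>) (Suc k)) =
    distr M borel (\<lambda>\<omega>. euler_path \<beta> h x (\<lambda>l. v l \<omega>) k) \<bind> (\<lambda>y. distr (distr M borel (v k)) borel (\<lambda>u. y + h *\<^sub>R \<beta> y + u))"
proof -
  have v[measurable]: "random_variable borel (v l)" if "l < n" for l
    using indep that by (auto simp: indep_vars_def)
  let ?E = "\<lambda>\<omega>. euler_path \<beta> h x (\<lambda>l. v l \<omega>) k"
  have E[measurable]: "random_variable borel ?E"
    by (rule euler_path_measurable) (use k in auto)
  have vk[measurable]: "random_variable borel (v k)" using k by simp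
  have "indep_var (PiM {..<k} (\<lambda>_. borel)) (\<lambda>\<omega>. restrict (\<lambda>l. v l \<omega>) {..<k})
     (PiM {k} (\<lambda>_. borel)) (\<lambda>\<omega>. restrict (\<lambda>l. v l \<omega>) {k})"
    using k by (intro indep_var_restrict[OF indep]) auto
  then have "indep_var borel ((\<lambda>u. euler_path \<beta> h x u k) \<circ> (\<lambda>\<omega>. restrict (\<lambda>l. v l \<omega>) {..<k}))
     borel ((\<lambda>u. u k) \<circ> (\<lambda>\<omega>. restrict (\<lambda>l. v l \<omega>) {k}))"
    by (rule indep_var_compose) (auto intro!: euler_path_measurable measurable_component_singleton)
  also have "(\<lambda>u. euler_path \<beta> h x u k) \<circ> (\<lambda>\<omega>. restrict (\<lambda>l. v l \<omega>) {..<k}) = ?E"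
    by (auto simp: fun_eq_iff intro!: euler_path_cong)
  also have "(\<lambda>u. u k) \<circ> (\<lambda>\<omega>. restrict (\<lambda>l. v l \<omega>) {k}) = v k" by auto
  finally have "distr M borel ?E \<Otimes>\<^sub>M distr M borel (v k) = distr M (borel \<Otimes>\<^sub>M borel) (\<lambda>\<omega>. (?E \<omega>, v k \<omega>))"
    by (simp add: indep_var_distribution_eq)
  then have "distr (distr M borel ?E \<Otimes>\<^sub>M distr M borel (v k)) borel (\<lambda>(y, u). y + h *\<^sub>R \<beta> y + u) =
     distr M borel (\<lambda>\<omega>. euler_path \<beta> h x (\<lambda>l. v l \<omega>) (Suc k))"
    by (simp add: distr_distr comp_def)
  moreover have "distr (distr M borel ?E \<Otimes>\<^sub>M distr M borel (v k)) borel (\<lambda>(y, u). y + h *\<^sub>R \<beta> y + u) =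
     distr M borel ?E \<bind> (\<lambda>y. distr (distr M borel (v k)) borel (\<lambda>u. case (y, u) of (y, u) \<Rightarrow> y + h *\<^sub>R \<beta> y + u))"
    by (rule distr_pair_eq_bind[OF prob_space_distr[OF E] prob_space_distr[OF vk]]) measurable
  ultimately show ?thesis by simp
qed

section \<open>Gluing along a countable partition\<close>

text \<open>The cell of a point is the first member of a dense sequence within
  \<open>\<eta> / 2\<close>; taking the least index makes it measurable.\<close>

lemma small_cells:
  assumes "0 < \<eta>"
  obtains cell :: "'b::euclidean_space \<Rightarrow> nat"
  where "cell \<in> borel \<rightarrow>\<^sub>M count_space UNIV" "\<And>x y. cell x = cell y \<Longrightarrow> norm (x - y) \<le> \<eta>"
proof -
  obtain D :: "'b set" where D: "countable D" "\<And>X. open X \<Longrightarrow> X \<noteq> {} \<Longrightarrow> \<exists>d\<in>D. d \<in> X"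
    by (rule countable_dense_exists[THEN exE]) auto
  define d where "d = from_nat_into D"
  have "D \<noteq> {}" using D(2)[of UNIV] by auto
  then have d: "range d = D" unfolding d_def using D(1) by (rule range_from_nat_into)
  define cell where "cell x = (LEAST n. dist x (d n) < \<eta> / 2)" for x
  have cell: "dist x (d (cell x)) < \<eta> / 2" for x
  proof -
    have "\<exists>e\<in>D. e \<in> ball x (\<eta> / 2)" using assms by (intro D(2)) auto
    then have "\<exists>n. dist x (d n) < \<eta> / 2" using d by auto
    then show ?thesis unfolding cell_def by (rule LeastI_ex)
  qed
  show thesis
  proof (rule that[of cell])
    show "cell \<in> borel \<rightarrow>\<^sub>M count_space UNIV" unfolding cell_def[abs_def] by measurable
    fix x y assume eq: "cell x = cell y"
    have "dist x y \<le> dist x (d (cell x)) + dist y (d (cell x))" by (rule dist_triangle2)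
    then show "norm (x - y) \<le> \<eta>" using cell[of x] cell[of y] eq by (simp add: dist_norm)
  qed
qed

lemma pred_eq_count_space [measurable (raw)]:
  fixes f g :: "'a \<Rightarrow> nat"
  assumes [measurable]: "f \<in> M \<rightarrow>\<^sub>M count_space UNIV" "g \<in> M \<rightarrow>\<^sub>M count_space UNIV"
  shows "Measurable.pred M (\<lambda>x. f x = g x)"
proof -
  have "Measurable.pred M (\<lambda>x. \<exists>i. g x = i \<and> f x = i)" by measurable
  then show ?thesis by simp
qed

context prob_space
begin

text \<open>There are only countably many null cells, so almost every \<omega> avoids all of
  them.\<close>

lemma AE_index_not_null:
  assumes [measurable]: "Z \<in> M \<rightarrow>\<^sub>M count_space (UNIV :: nat set)"
  shows "AE \<omega> in M. emeasure M {\<omega>'\<in>space M. Z \<omega>' = Z \<omega>} \<noteq> 0"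
proof -
  have "AE \<omega> in M. emeasure M {\<omega>'\<in>space M. Z \<omega>' = i} = 0 \<longrightarrow> Z \<omega> \<noteq> i" for i
  proof (cases "emeasure M {\<omega>'\<in>space M. Z \<omega>' = i} = 0")
    case True
    then have "{\<omega>'\<in>space M. Z \<omega>' = i} \<in> null_sets M" by (intro null_setsI) auto
    then have "AE \<omega> in M. \<omega> \<notin> {\<omega>'\<in>space M. Z \<omega>' = i}" by (rule AE_not_in)
    then show ?thesis by (rule AE_mp) (auto intro!: AE_I2)
  qed auto
  then have "AE \<omega> in M. \<forall>i. emeasure M {\<omega>'\<in>space M. Z \<omega>' = i} = 0 \<longrightarrow> Z \<omega> \<noteq> i"
    by (simp add: AE_all_countable)
  then show ?thesis by eventually_elim blast
qed

text \<open>The tower property for conditioning on a countably valued Z. Exchanging the two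
  integrals leaves \<open>k \<omega>'\<close> times the probability of its own cell divided by
  itself.\<close>

lemma nn_integral_countable_tower:
  assumes Z[measurable]: "Z \<in> M \<rightarrow>\<^sub>M count_space (UNIV :: nat set)" and k[measurable]: "k \<in> borel_measurable M"
  shows "(\<integral>\<^sup>+ \<omega>. (\<integral>\<^sup>+ \<omega>'. k \<omega>' * indicator {\<omega>'\<in>space M. Z \<omega>' = Z \<omega>} \<omega>' \<partial>M) / emeasure M {\<omega>'\<in>space M. Z \<omega>' = Z \<omega>} \<partial>M)
    = (\<integral>\<^sup>+ \<omega>. k \<omega> \<partial>M)"
proof -
  interpret P: pair_sigma_finite M M ..
  define e where "e i = emeasure M {\<omega>'\<in>space M. Z \<omega>' = i}" for i
  have [measurable]: "e \<in> borel_measurable (count_space UNIV)" by simp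
  let ?I = "\<lambda>\<omega> \<omega>'. indicator {\<omega>'\<in>space M. Z \<omega>' = Z \<omega>} \<omega>' :: ennreal"
  have I: "?I \<omega> \<omega>' = indicator {p. Z (fst p) = Z (snd p)} (\<omega>', \<omega>)" if "\<omega>' \<in> space M" for \<omega> \<omega>'
    using that by (auto simp: indicator_def)
  have "(\<integral>\<^sup>+ \<omega>. (\<integral>\<^sup>+ \<omega>'. k \<omega>' * ?I \<omega> \<omega>' \<partial>M) / e (Z \<omega>) \<partial>M) =
      (\<integral>\<^sup>+ \<omega>. \<integral>\<^sup>+ \<omega>'. k \<omega>' * indicator {p. Z (fst p) = Z (snd p)} (\<omega>', \<omega>) / e (Z \<omega>) \<partial>M \<partial>M)"
  proof (rule nn_integral_cong)
    fix \<omega> assume [measurable]: "\<omega> \<in> space M"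
    show "(\<integral>\<^sup>+ \<omega>'. k \<omega>' * ?I \<omega> \<omega>' \<partial>M) / e (Z \<omega>) =
       (\<integral>\<^sup>+ \<omega>'. k \<omega>' * indicator {p. Z (fst p) = Z (snd p)} (\<omega>', \<omega>) / e (Z \<omega>) \<partial>M)"
      by (subst nn_integral_divide[symmetric]) (auto intro!: nn_integral_cong simp: I)
  qed
  also have "\<dots> = (\<integral>\<^sup>+ \<omega>'. \<integral>\<^sup>+ \<omega>. k \<omega>' * indicator {p. Z (fst p) = Z (snd p)} (\<omega>', \<omega>) / e (Z \<omega>) \<partial>M \<partial>M)"
  proof (rule P.Fubini')
    have "Measurable.pred (M \<Otimes>\<^sub>M M) (\<lambda>p. Z (fst p) = Z (snd p))" by measurable
    then show "(\<lambda>(\<omega>', \<omega>). k \<omega>' * indicator {p. Z (fst p) = Z (snd p)} (\<omega>', \<omega>) / e (Z \<omega>)) \<in> borel_measurable (M \<Otimes>\<^sub>M M)"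
      unfolding indicator_def case_prod_beta by measurable
  qed
  also have "\<dots> = (\<integral>\<^sup>+ \<omega>'. k \<omega>' * (e (Z \<omega>') / e (Z \<omega>')) \<partial>M)"
  proof (rule nn_integral_cong)
    fix \<omega>' assume \<omega>': "\<omega>' \<in> space M"
    have "(\<integral>\<^sup>+ \<omega>. k \<omega>' * indicator {p. Z (fst p) = Z (snd p)} (\<omega>', \<omega>) / e (Z \<omega>) \<partial>M)
      = (\<integral>\<^sup>+ \<omega>. k \<omega>' / e (Z \<omega>') * indicator {\<omega>\<in>space M. Z \<omega> = Z \<omega>'} \<omega> \<partial>M)"
      by (rule nn_integral_cong) (auto simp: indicator_def)
    also have "\<dots> = k \<omega>' / e (Z \<omega>') * e (Z \<omega>')"
      unfolding e_def by (rule nn_integral_cmult_indicator) measurable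
    finally show "(\<integral>\<^sup>+ \<omega>. k \<omega>' * indicator {p. Z (fst p) = Z (snd p)} (\<omega>', \<omega>) / e (Z \<omega>) \<partial>M)
        = k \<omega>' * (e (Z \<omega>') / e (Z \<omega>'))"
      by (simp add: ennreal_times_divide mult.commute)
  qed
  also have "\<dots> = (\<integral>\<^sup>+ \<omega>. k \<omega> \<partial>M)"
  proof (rule nn_integral_cong_AE)
    show "AE \<omega> in M. k \<omega> * (e (Z \<omega>) / e (Z \<omega>)) = k \<omega>"
      using AE_index_not_null[OF Z]
    proof eventually_elim
      case (elim \<omega>)
      then have "e (Z \<omega>) \<noteq> 0" "e (Z \<omega>) \<noteq> \<top>" by (auto simp: e_def)
      then show ?case by (simp add: ennreal_divide_self less_top)
    qed
  qed
  finally show ?thesis by (simp add: e_def)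
qed

text \<open>Conditional law of \<open>L x\<close> given that \<open>E x\<close> lies in the cell of
  z. Countably many cells make it an elementary quotient, measurable in x and z jointly. For a null
  cell the unconditional law is the default, so that the kernel is always a probability
  measure.\<close>

definition glue :: "('c \<Rightarrow> 'a \<Rightarrow> 'b) \<Rightarrow> ('c \<Rightarrow> 'a \<Rightarrow> 'b) \<Rightarrow> ('b \<Rightarrow> nat) \<Rightarrow> 'c \<times> 'b \<Rightarrow> 'b::topological_space measure" where
  "glue E L cell p = (let A = {\<omega>\<in>space M. cell (E (fst p) \<omega>) = cell (snd p)}
     in distr (if emeasure M A = 0 then M else uniform_measure M A) borel (L (fst p)))"

lemma nn_integral_glue:
  assumes [measurable]: "E x \<in> borel_measurable M" "L x \<in> borel_measurable M"
      "cell \<in> borel \<rightarrow>\<^sub>M count_space UNIV" "g \<in> borel_measurable borel"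
  shows "(\<integral>\<^sup>+ u. g u \<partial>glue E L cell (x, z)) =
    (if emeasure M {\<omega>\<in>space M. cell (E x \<omega>) = cell z} = 0 then (\<integral>\<^sup>+ \<omega>. g (L x \<omega>) \<partial>M)
     else (\<integral>\<^sup>+ \<omega>. g (L x \<omega>) * indicator {\<omega>\<in>space M. cell (E x \<omega>) = cell z} \<omega> \<partial>M) / emeasure M {\<omega>\<in>space M. cell (E x \<omega>) = cell z})"
proof -
  have [measurable]: "{\<omega>\<in>space M. cell (E x \<omega>) = cell z} \<in> sets M" by measurable
  show ?thesis
    unfolding glue_def Let_def fst_conv snd_conv
    by (auto simp: nn_integral_distr nn_integral_uniform_measure)
qed

lemma glue_measurable:
  fixes E L :: "'c \<Rightarrow> 'a \<Rightarrow> 'b::topological_space"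
  assumes [measurable]: "(\<lambda>(x, \<omega>). E x \<omega>) \<in> borel_measurable (N \<Otimes>\<^sub>M M)" "(\<lambda>(x, \<omega>). L x \<omega>) \<in> borel_measurable (N \<Otimes>\<^sub>M M)"
      "cell \<in> borel \<rightarrow>\<^sub>M count_space UNIV"
  shows "glue E L cell \<in> N \<Otimes>\<^sub>M borel \<rightarrow>\<^sub>M prob_algebra borel"
proof (rule measurable_prob_algebraI)
  have E: "E x \<in> borel_measurable M" and L: "L x \<in> borel_measurable M" if "x \<in> space N" for x
    using that assms(1,2) by (auto intro: measurable_Pair2)
  fix p assume p: "p \<in> space (N \<Otimes>\<^sub>M (borel :: 'b measure))"
  then have [measurable]: "E (fst p) \<in> borel_measurable M" "L (fst p) \<in> borel_measurable M"
    by (auto intro!: E L simp: space_pair_measure)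
  let ?A = "{\<omega>\<in>space M. cell (E (fst p) \<omega>) = cell (snd p)}"
  have [measurable]: "?A \<in> sets M" by measurable
  have "prob_space (if emeasure M ?A = 0 then M else uniform_measure M ?A)"
    using prob_space_uniform_measure[of M ?A] prob_space_axioms by auto
  then show "prob_space (glue E L cell p)"
    unfolding glue_def Let_def by (rule prob_space.prob_space_distr) (auto split: if_splits)
next
  have E: "E x \<in> borel_measurable M" and L: "L x \<in> borel_measurable M" if "x \<in> space N" for x
    using that assms(1,2) by (auto intro: measurable_Pair2)
  show "glue E L cell \<in> N \<Otimes>\<^sub>M borel \<rightarrow>\<^sub>M subprob_algebra borel"
  proof (rule measurable_subprob_algebra)
    fix p assume p: "p \<in> space (N \<Otimes>\<^sub>M (borel :: 'b measure))"
    then have [measurable]: "E (fst p) \<in> borel_measurable M" "L (fst p) \<in> borel_measurable M"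
      by (auto intro!: E L simp: space_pair_measure)
    let ?A = "{\<omega>\<in>space M. cell (E (fst p) \<omega>) = cell (snd p)}"
    have [measurable]: "?A \<in> sets M" by measurable
    have "prob_space (if emeasure M ?A = 0 then M else uniform_measure M ?A)"
      using prob_space_uniform_measure[of M ?A] prob_space_axioms by auto
    then have "prob_space (glue E L cell p)"
      unfolding glue_def Let_def by (rule prob_space.prob_space_distr) (auto split: if_splits)
    then show "subprob_space (glue E L cell p)" by (rule prob_space_imp_subprob_space)
    show "sets (glue E L cell p) = sets borel" by (simp add: glue_def Let_def)
  next
    fix B :: "'b set" assume B[measurable]: "B \<in> sets borel"
    let ?e = "\<lambda>p. emeasure M {\<omega>\<in>space M. cell (E (fst p) \<omega>) = cell (snd p)}"
    let ?n = "\<lambda>p. emeasure M {\<omega>\<in>space M. cell (E (fst p) \<omega>) = cell (snd p) \<and> L (fst p) \<omega> \<in> B}"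
    let ?l = "\<lambda>p. emeasure M {\<omega>\<in>space M. L (fst p) \<omega> \<in> B}"
    have "emeasure (glue E L cell p) B = (if ?e p = 0 then ?l p else ?n p / ?e p)"
      if p: "p \<in> space (N \<Otimes>\<^sub>M (borel :: 'b measure))" for p
    proof -
      have [measurable]: "E (fst p) \<in> borel_measurable M" "L (fst p) \<in> borel_measurable M"
        using p by (auto intro!: E L simp: space_pair_measure)
      have A[measurable]: "{\<omega>\<in>space M. cell (E (fst p) \<omega>) = cell (snd p)} \<in> sets M" by measurable
      have C: "L (fst p) -` B \<inter> space M = {\<omega>\<in>space M. L (fst p) \<omega> \<in> B}"
        "{\<omega>\<in>space M. cell (E (fst p) \<omega>) = cell (snd p)} \<inter> {\<omega>\<in>space M. L (fst p) \<omega> \<in> B} =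
          {\<omega>\<in>space M. cell (E (fst p) \<omega>) = cell (snd p) \<and> L (fst p) \<omega> \<in> B}" by auto
      show ?thesis
        unfolding glue_def Let_def by (auto simp: emeasure_distr C)
    qed
    moreover have "(\<lambda>p. if ?e p = 0 then ?l p else ?n p / ?e p) \<in> borel_measurable (N \<Otimes>\<^sub>M borel)"
    proof -
      have [measurable]: "(\<lambda>q. E (fst (fst q)) (snd q)) \<in> borel_measurable ((N \<Otimes>\<^sub>M (borel :: 'b measure)) \<Otimes>\<^sub>M M)"
        "(\<lambda>q. L (fst (fst q)) (snd q)) \<in> borel_measurable ((N \<Otimes>\<^sub>M (borel :: 'b measure)) \<Otimes>\<^sub>M M)"
        using measurable_compose[OF _ assms(1), of "\<lambda>q. (fst (fst q), snd q)" "(N \<Otimes>\<^sub>M (borel :: 'b measure)) \<Otimes>\<^sub>M M"]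
          measurable_compose[OF _ assms(2), of "\<lambda>q. (fst (fst q), snd q)" "(N \<Otimes>\<^sub>M (borel :: 'b measure)) \<Otimes>\<^sub>M M"]
        by auto
      have s: "{q\<in>space ((N \<Otimes>\<^sub>M (borel :: 'b measure)) \<Otimes>\<^sub>M M). snd q \<in> {\<omega>\<in>space M. P (fst q) \<omega>}}
         = {q\<in>space ((N \<Otimes>\<^sub>M (borel :: 'b measure)) \<Otimes>\<^sub>M M). P (fst q) (snd q)}" for P
        by (auto simp: space_pair_measure)
      have e: "?e \<in> borel_measurable (N \<Otimes>\<^sub>M borel)" by (rule measurable_emeasure) (auto simp: s)
      have n: "?n \<in> borel_measurable (N \<Otimes>\<^sub>M borel)" by (rule measurable_emeasure) (auto simp: s)
      have l: "?l \<in> borel_measurable (N \<Otimes>\<^sub>M borel)" by (rule measurable_emeasure) (auto simp: s)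
      note [measurable] = e n l
      show ?thesis by measurable
    qed
    ultimately show "(\<lambda>p. emeasure (glue E L cell p) B) \<in> borel_measurable (N \<Otimes>\<^sub>M borel)"
      by (simp cong: measurable_cong)
  qed
qed

text \<open>The cost of pairing \<open>E x \<omega>\<close> with a resampled
  \<open>L x \<omega>'\<close> is bounded by a function of \<omega>' alone, using that both points
  share a cell; the tower property then removes the conditioning.\<close>

lemma nn_integral_glue_le:
  assumes [measurable]: "E x \<in> borel_measurable M" "L x \<in> borel_measurable M"
      "cell \<in> borel \<rightarrow>\<^sub>M count_space UNIV" "case_prod g \<in> borel_measurable (borel \<Otimes>\<^sub>M borel)" "k \<in> borel_measurable M"
    and gk: "\<And>\<omega> \<omega>'. \<omega> \<in> space M \<Longrightarrow> \<omega>' \<in> space M \<Longrightarrow> cell (E x \<omega>') = cell (E x \<omega>) \<Longrightarrow> g (E x \<omega>) (L x \<omega>') \<le> k \<omega>'"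
  shows "(\<integral>\<^sup>+ \<omega>. \<integral>\<^sup>+ u. g (E x \<omega>) u \<partial>glue E L cell (x, E x \<omega>) \<partial>M) \<le> (\<integral>\<^sup>+ \<omega>. k \<omega> \<partial>M)"
proof -
  let ?C = "\<lambda>\<omega>. {\<omega>'\<in>space M. cell (E x \<omega>') = cell (E x \<omega>)}"
  have "(\<integral>\<^sup>+ \<omega>. \<integral>\<^sup>+ u. g (E x \<omega>) u \<partial>glue E L cell (x, E x \<omega>) \<partial>M)
    \<le> (\<integral>\<^sup>+ \<omega>. (\<integral>\<^sup>+ \<omega>'. k \<omega>' * indicator (?C \<omega>) \<omega>' \<partial>M) / emeasure M (?C \<omega>) \<partial>M)"
  proof (rule nn_integral_mono_AE)
    have Z: "(\<lambda>\<omega>. cell (E x \<omega>)) \<in> M \<rightarrow>\<^sub>M count_space UNIV" by measurable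
    show "AE \<omega> in M. (\<integral>\<^sup>+ u. g (E x \<omega>) u \<partial>glue E L cell (x, E x \<omega>)) \<le>
        (\<integral>\<^sup>+ \<omega>'. k \<omega>' * indicator (?C \<omega>) \<omega>' \<partial>M) / emeasure M (?C \<omega>)"
      using AE_index_not_null[OF Z] AE_space
    proof eventually_elim
      case (elim \<omega>)
      have "g (E x \<omega>) \<in> borel_measurable borel" using measurable_Pair2[OF assms(4), of "E x \<omega>"] by simp
      then have "(\<integral>\<^sup>+ u. g (E x \<omega>) u \<partial>glue E L cell (x, E x \<omega>)) =
         (\<integral>\<^sup>+ \<omega>'. g (E x \<omega>) (L x \<omega>') * indicator (?C \<omega>) \<omega>' \<partial>M) / emeasure M (?C \<omega>)"
        using elim by (subst nn_integral_glue) auto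
      also have "\<dots> \<le> (\<integral>\<^sup>+ \<omega>'. k \<omega>' * indicator (?C \<omega>) \<omega>' \<partial>M) / emeasure M (?C \<omega>)"
        using gk elim by (intro divide_right_mono_ennreal nn_integral_mono) (auto simp: indicator_def)
      finally show ?case .
    qed
  qed
  also have "\<dots> = (\<integral>\<^sup>+ \<omega>. k \<omega> \<partial>M)"
    by (rule nn_integral_countable_tower[of "\<lambda>\<omega>. cell (E x \<omega>)"]) measurable
  finally show ?thesis .
qed

text \<open>Resampling from the conditional law restores the law of \<open>L x\<close> exactly. The
  preceding lemma gives one inequality on every set; both sides being probability measures,
  complements give the other.\<close>

lemma bind_glue:
  assumes E: "(\<lambda>(x, \<omega>). E x \<omega>) \<in> borel_measurable (N \<Otimes>\<^sub>M M)" and L: "(\<lambda>(x, \<omega>). L x \<omega>) \<in> borel_measurable (N \<Otimes>\<^sub>M M)"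
    and cell: "cell \<in> borel \<rightarrow>\<^sub>M count_space UNIV" and x: "x \<in> space N"
  shows "distr M borel (E x) \<bind> (\<lambda>z. glue E L cell (x, z)) = distr M borel (L x)"
proof -
  have Ex[measurable]: "E x \<in> borel_measurable M" and Lx[measurable]: "L x \<in> borel_measurable M"
    using x E L by (auto intro: measurable_Pair2)
  have K: "(\<lambda>z. glue E L cell (x, z)) \<in> borel \<rightarrow>\<^sub>M prob_algebra borel"
    using measurable_compose[OF _ glue_measurable[OF E L cell], of "\<lambda>z. (x, z)" borel] x by simp
  have D: "distr M borel (E x) \<in> space (prob_algebra borel)"
    by (simp add: space_prob_algebra prob_space_distr)
  have le: "emeasure (distr M borel (E x) \<bind> (\<lambda>z. glue E L cell (x, z))) B \<le> emeasure (distr M borel (L x)) B"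
    if B[measurable]: "B \<in> sets borel" for B
  proof -
    have "emeasure (distr M borel (E x) \<bind> (\<lambda>z. glue E L cell (x, z))) B
      = (\<integral>\<^sup>+ z. emeasure (glue E L cell (x, z)) B \<partial>distr M borel (E x))"
      by (rule emeasure_bind_prob_algebra[OF D K B])
    also have "\<dots> = (\<integral>\<^sup>+ \<omega>. emeasure (glue E L cell (x, E x \<omega>)) B \<partial>M)"
      using measurable_emeasure_kernel[OF measurable_prob_algebraD[OF K] B]
      by (subst nn_integral_distr) auto
    also have "\<dots> = (\<integral>\<^sup>+ \<omega>. \<integral>\<^sup>+ u. indicator B u \<partial>glue E L cell (x, E x \<omega>) \<partial>M)"
      by (simp add: glue_def Let_def)
    also have "\<dots> \<le> (\<integral>\<^sup>+ \<omega>. indicator B (L x \<omega>) \<partial>M)"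
      by (rule nn_integral_glue_le[where g="\<lambda>_. indicator B"]) (use cell in \<open>auto\<close>)
    also have "\<dots> = emeasure (distr M borel (L x)) B"
      using nn_integral_distr[of "L x" M borel "indicator B"] by simp
    finally show ?thesis .
  qed
  have sets: "sets (distr M borel (E x) \<bind> (\<lambda>z. glue E L cell (x, z))) = sets borel" by (rule sets_bind'[OF D K])
  show ?thesis
  proof (rule measure_eqI)
    interpret B: prob_space "distr M borel (E x) \<bind> (\<lambda>z. glue E L cell (x, z))" by (rule prob_space_bind'[OF D K])
    interpret L: prob_space "distr M borel (L x)" by (rule prob_space_distr[OF Lx])
    fix A assume "A \<in> sets (distr M borel (E x) \<bind> (\<lambda>z. glue E L cell (x, z)))"
    then have A: "A \<in> sets borel" using sets by simp
    have "L.prob A \<le> B.prob A"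
    proof -
      have "B.prob (- A) \<le> L.prob (- A)" using le[of "- A"] A by (simp add: B.emeasure_eq_measure L.emeasure_eq_measure)
      moreover have "B.prob (- A) = 1 - B.prob A" "L.prob (- A) = 1 - L.prob A"
        using B.prob_compl[of A] L.prob_compl[of A] A sets sets_eq_imp_space_eq[OF sets] by (auto simp: Compl_eq_Diff_UNIV)
      ultimately show ?thesis by simp
    qed
    moreover have "B.prob A \<le> L.prob A" using le[OF A] by (simp add: B.emeasure_eq_measure L.emeasure_eq_measure)
    ultimately show "emeasure (distr M borel (E x) \<bind> (\<lambda>z. glue E L cell (x, z))) A = emeasure (distr M borel (L x)) A"
      by (simp add: B.emeasure_eq_measure L.emeasure_eq_measure)
  qed (simp add: sets)
qed

end

section \<open>Couplings of the transition kernels\<close>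

text \<open>What the coupling argument takes from the diffusion at a fixed time: schemes with the
  law of the Euler chain, measurable jointly in starting point and \<omega>, that converge almost
  surely to Y for each starting point.\<close>

locale euler_limit = weakly_coupled_drift blk b b0 \<gamma> \<kappa> w \<epsilon> + prob_space M
  for blk :: "'m::finite \<Rightarrow> 'n::finite" and b b0 \<gamma> \<kappa> w \<epsilon> and M :: "'w measure" +
  fixes E :: "nat \<Rightarrow> real ^ 'm \<Rightarrow> 'w \<Rightarrow> real ^ 'm" and Y :: "real ^ 'm \<Rightarrow> 'w \<Rightarrow> real ^ 'm" and t :: real
  assumes t: "0 < t"
    and E_measurable [measurable]: "\<And>N. (\<lambda>(x, \<omega>). E N x \<omega>) \<in> borel_measurable (borel \<Otimes>\<^sub>M M)"
    and law_E: "\<And>N x. distr M borel (E N x) = iter_kernel borel (euler_kernel (t / real (Suc N))) (Suc N) x"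
    and E_tendsto: "\<And>x. AE \<omega> in M. (\<lambda>N. E N x \<omega>) \<longlonglongrightarrow> Y x \<omega>"
    and Y_measurable [measurable]: "\<And>x. Y x \<in> borel_measurable M"
begin

abbreviation p :: "real ^ 'm \<Rightarrow> (real ^ 'm) measure" where "p x \<equiv> distr M borel (Y x)"

text \<open>A version of Y that is measurable jointly in x and \<omega>, whereas Y is only assumed
  measurable for each fixed x. Where the schemes diverge, which is a null set for each x,
  \<open>lim\<close> has an arbitrary value.\<close>

definition L :: "real ^ 'm \<Rightarrow> 'w \<Rightarrow> real ^ 'm" where "L x \<omega> = lim (\<lambda>N. E N x \<omega>)"

lemma L_measurable [measurable]: "(\<lambda>(x, \<omega>). L x \<omega>) \<in> borel_measurable (borel \<Otimes>\<^sub>M M)"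
proof -
  have "(\<lambda>p. lim (\<lambda>N. case_prod (E N) p)) \<in> borel_measurable (borel \<Otimes>\<^sub>M M)"
    by (rule borel_measurable_lim_metric) simp
  then show ?thesis by (simp add: L_def case_prod_beta')
qed

lemma E_measurable' [measurable]: "E N x \<in> borel_measurable M"
  using measurable_Pair2[OF E_measurable, of x] by simp

lemma L_measurable' [measurable]: "L x \<in> borel_measurable M"
  using measurable_Pair2[OF L_measurable, of x] by simp

lemma L_eq_Y: "AE \<omega> in M. L x \<omega> = Y x \<omega>"
  using E_tendsto[of x] by eventually_elim (simp add: L_def limI)

lemma E_tendsto_L: "AE \<omega> in M. (\<lambda>N. E N x \<omega>) \<longlonglongrightarrow> L x \<omega>"
  using E_tendsto[of x] L_eq_Y[of x] by eventually_elim simp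

lemma p_eq: "p x = distr M borel (L x)"
  by (rule distr_cong_AE) (use L_eq_Y[of x] in auto)

lemma p_measurable [measurable]: "p \<in> borel \<rightarrow>\<^sub>M prob_algebra borel"
  unfolding p_eq
  by (rule measurable_distr_prob_space2[where M=M and g="\<lambda>_. M"])
     (auto intro!: measurable_const simp: space_prob_algebra prob_space_axioms)

lemma euler_error_tendsto:
  assumes "0 \<le> S"
  shows "(\<lambda>N. \<integral>\<^sup>+ \<omega>. ennreal (min (CARD('n) * norm (L x \<omega> - E N x \<omega>)) S) \<partial>M) \<longlonglongrightarrow> 0"
proof -
  have "(\<lambda>N. \<integral>\<^sup>+ \<omega>. ennreal (min (CARD('n) * norm (L x \<omega> - E N x \<omega>)) S) \<partial>M) \<longlonglongrightarrow> (\<integral>\<^sup>+ \<omega>. 0 \<partial>M)"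
  proof (rule nn_integral_dominated_convergence[where w="\<lambda>_. ennreal S"])
    show "AE \<omega> in M. (\<lambda>N. ennreal (min (CARD('n) * norm (L x \<omega> - E N x \<omega>)) S)) \<longlonglongrightarrow> 0"
      using E_tendsto_L[of x]
    proof eventually_elim
      case (elim \<omega>)
      have "(\<lambda>N. ennreal (min (CARD('n) * norm (L x \<omega> - E N x \<omega>)) S)) \<longlonglongrightarrow> ennreal (min (CARD('n) * norm (L x \<omega> - L x \<omega>)) S)"
        by (intro tendsto_intros elim)
      then show ?case using assms by (simp add: min_def)
    qed
    show "(\<integral>\<^sup>+ \<omega>. ennreal S \<partial>M) < \<infinity>" by (simp add: emeasure_space_1)
  qed (auto intro!: AE_I2 ennreal_leI)
  then show ?thesis by simp
qed

definition chain :: "real \<Rightarrow> nat \<Rightarrow> (real ^ 'm) \<times> (real ^ 'm) \<Rightarrow> ((real ^ 'm) \<times> (real ^ 'm)) measure" where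
  "chain \<delta> N = iter_kernel borel2 (coupled_kernel (t / real (Suc N)) \<delta>) (Suc N)"

lemma chain_measurable [measurable]: "chain \<delta> N \<in> borel2 \<rightarrow>\<^sub>M prob_algebra borel2"
  unfolding chain_def by (rule iter_kernel_measurable[OF coupled_kernel_measurable])

lemma chain_in_space: "chain \<delta> N q \<in> space (prob_algebra borel2)"
  using measurable_space[OF chain_measurable, of q] by (simp add: space_pair_measure)

lemma sets_chain [measurable_cong]: "sets (chain \<delta> N q) = sets borel2"
  using chain_in_space by (simp add: space_prob_algebra)

lemma chain_marginal_fst: "0 < \<delta> \<Longrightarrow> distr (chain \<delta> N (x, y)) borel fst = distr M borel (E N x)"
  and chain_marginal_snd: "0 < \<delta> \<Longrightarrow> distr (chain \<delta> N (x, y)) borel snd = distr M borel (E N y)"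
  unfolding law_E chain_def using coupled_chain_marginals[of \<delta> "t / real (Suc N)" "Suc N" "(x, y)"]
  by (simp_all del: iter_kernel.simps)

lemma chain_lyap:
  "0 < l \<Longrightarrow> 0 < S \<Longrightarrow> \<exists>\<delta>>0. \<exists>N0. \<forall>N\<ge>N0. \<forall>p. (\<integral>\<^sup>+ q. ennreal (min (lyap l t (fst q) (snd q)) S) \<partial>chain \<delta> N p)
    \<le> ennreal (lyap l 0 (fst p) (snd p))"
  unfolding chain_def by (rule coupled_chain_lyap[OF _ _ t])

text \<open>Both chains start at x, so \<open>F x x = 0\<close> and the initial value of
  \<open>lyap\<close> is \<open>1 + 2 * (norm x)\<^sup>2\<close>. The truncation at
  \<open>Suc n\<close> permits the passage from the scheme to the diffusion; monotone convergence
  then removes it.\<close>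

lemma second_moment: "(\<integral>\<^sup>+ u. ennreal ((norm u)\<^sup>2) \<partial>p x) \<le> ennreal (exp ((growth + 1) * t) * (1 + 2 * (norm x)\<^sup>2))"
proof -
  let ?a = "exp (- (growth + 1) * t)"
  have F0: "F x x = 0" by (simp add: F_def)
  have trunc: "(\<integral>\<^sup>+ \<omega>. ennreal (min (?a * (norm (L x \<omega>))\<^sup>2) (real (Suc n))) \<partial>M) \<le> ennreal (1 + 2 * (norm x)\<^sup>2)" for n
  proof -
    have "0 < real (Suc n)" by simp
    from chain_lyap[OF zero_less_one this]
    obtain \<delta> N0 where d: "0 < \<delta>" "\<And>N p. N0 \<le> N \<Longrightarrow> (\<integral>\<^sup>+ q. ennreal (min (lyap 1 t (fst q) (snd q)) (real (Suc n)))
      \<partial>chain \<delta> N p) \<le> ennreal (lyap 1 0 (fst p) (snd p))"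
      by blast
    have le: "(\<integral>\<^sup>+ \<omega>. ennreal (min (?a * (norm (E N x \<omega>))\<^sup>2) (real (Suc n))) \<partial>M) \<le> ennreal (1 + 2 * (norm x)\<^sup>2)" if N: "N0 \<le> N" for N
    proof -
      let ?q = "chain \<delta> N (x, x)"
      have "(\<integral>\<^sup>+ \<omega>. ennreal (min (?a * (norm (E N x \<omega>))\<^sup>2) (real (Suc n))) \<partial>M) = (\<integral>\<^sup>+ u. ennreal (min (?a * (norm u)\<^sup>2) (real (Suc n))) \<partial>distr M borel (E N x))"
        by (simp add: nn_integral_distr)
      also have "\<dots> = (\<integral>\<^sup>+ q. ennreal (min (?a * (norm (fst q))\<^sup>2) (real (Suc n))) \<partial>?q)"
        unfolding chain_marginal_fst[OF d(1), of N x x, symmetric]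
        by (subst nn_integral_distr) auto
      also have "\<dots> \<le> (\<integral>\<^sup>+ q. ennreal (min (lyap 1 t (fst q) (snd q)) (real (Suc n))) \<partial>?q)"
      proof (intro nn_integral_mono ennreal_leI min.mono order_refl)
        fix q :: "(real ^ 'm) \<times> (real ^ 'm)"
        have "?a * (norm (fst q))\<^sup>2 \<le> ?a * (1 + (norm (fst q))\<^sup>2 + (norm (snd q))\<^sup>2)" by (intro mult_left_mono) auto
        then show "?a * (norm (fst q))\<^sup>2 \<le> lyap 1 t (fst q) (snd q)"
          using F_nonneg[of "fst q" "snd q"] unfolding lyap_def by (simp add: add_increasing)
      qed
      also have "\<dots> \<le> ennreal (lyap 1 0 x x)" using d(2)[OF N, of "(x, x)"] by simp
      also have "lyap 1 0 x x = 1 + 2 * (norm x)\<^sup>2" by (simp add: lyap_def F0)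
      finally show ?thesis .
    qed
    have "(\<lambda>N. \<integral>\<^sup>+ \<omega>. ennreal (min (?a * (norm (E N x \<omega>))\<^sup>2) (real (Suc n))) \<partial>M) \<longlonglongrightarrow> (\<integral>\<^sup>+ \<omega>. ennreal (min (?a * (norm (L x \<omega>))\<^sup>2) (real (Suc n))) \<partial>M)"
    proof (rule nn_integral_dominated_convergence[where w="\<lambda>_. ennreal (real (Suc n))"])
      show "AE \<omega> in M. (\<lambda>N. ennreal (min (?a * (norm (E N x \<omega>))\<^sup>2) (real (Suc n)))) \<longlonglongrightarrow> ennreal (min (?a * (norm (L x \<omega>))\<^sup>2) (real (Suc n)))"
        using E_tendsto_L[of x] by eventually_elim (intro tendsto_intros)
      show "(\<integral>\<^sup>+ \<omega>. ennreal (real (Suc n)) \<partial>M) < \<infinity>" by (simp add: emeasure_space_1 ennreal_mult_less_top)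
      show "AE \<omega> in M. ennreal (min (?a * (norm (E N x \<omega>))\<^sup>2) (real (Suc n))) \<le> ennreal (real (Suc n))" for N
        by (intro AE_I2 ennreal_leI) (rule min.cobounded2)
    qed measurable
    then show ?thesis
      by (rule LIMSEQ_le_const2) (use le in blast)
  qed
  have "(\<integral>\<^sup>+ \<omega>. ennreal (?a * (norm (L x \<omega>))\<^sup>2) \<partial>M) = (\<integral>\<^sup>+ \<omega>. (SUP n. ennreal (min (?a * (norm (L x \<omega>))\<^sup>2) (real (Suc n)))) \<partial>M)"
  proof (rule nn_integral_cong)
    fix \<omega>
    let ?v = "?a * (norm (L x \<omega>))\<^sup>2"
    obtain n :: nat where n: "?v \<le> real n" using real_arch_simple by blast
    show "ennreal ?v = (SUP n. ennreal (min ?v (real (Suc n))))"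
    proof (rule antisym)
      have "ennreal ?v = ennreal (min ?v (real (Suc n)))" using n by (simp add: min_def)
      also have "\<dots> \<le> (SUP n. ennreal (min ?v (real (Suc n))))" by (rule SUP_upper) simp
      finally show "ennreal ?v \<le> (SUP n. ennreal (min ?v (real (Suc n))))" .
    qed (auto intro!: SUP_least ennreal_leI)
  qed
  also have "\<dots> = (SUP n. \<integral>\<^sup>+ \<omega>. ennreal (min (?a * (norm (L x \<omega>))\<^sup>2) (real (Suc n))) \<partial>M)"
    by (rule nn_integral_monotone_convergence_SUP) (auto intro!: incseq_SucI le_funI ennreal_leI min.mono)
  also have "\<dots> \<le> ennreal (1 + 2 * (norm x)\<^sup>2)" by (rule SUP_least) (rule trunc)
  finally have *: "(\<integral>\<^sup>+ \<omega>. ennreal (?a * (norm (L x \<omega>))\<^sup>2) \<partial>M) \<le> ennreal (1 + 2 * (norm x)\<^sup>2)" .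
  have "(\<integral>\<^sup>+ u. ennreal ((norm u)\<^sup>2) \<partial>p x) = (\<integral>\<^sup>+ \<omega>. ennreal (exp ((growth + 1) * t)) * ennreal (?a * (norm (L x \<omega>))\<^sup>2) \<partial>M)"
    unfolding p_eq by (subst nn_integral_distr) (auto simp: ennreal_mult[symmetric] exp_add[symmetric] mult.assoc[symmetric] algebra_simps intro!: nn_integral_cong)
  also have "\<dots> = ennreal (exp ((growth + 1) * t)) * (\<integral>\<^sup>+ \<omega>. ennreal (?a * (norm (L x \<omega>))\<^sup>2) \<partial>M)"
    by (rule nn_integral_cmult) measurable
  also have "\<dots> \<le> ennreal (exp ((growth + 1) * t)) * ennreal (1 + 2 * (norm x)\<^sup>2)"
    using * by (rule mult_left_mono) simp
  finally show ?thesis by (simp add: ennreal_mult)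
qed

text \<open>Given the endpoints of the coupled chain, the two exact endpoints are resampled
  independently of each other. The coupling survives because each stays close to its own Euler
  endpoint.\<close>

definition glued :: "real \<Rightarrow> (real ^ 'm \<Rightarrow> nat) \<Rightarrow> nat \<Rightarrow> (real ^ 'm) \<times> (real ^ 'm) \<Rightarrow> ((real ^ 'm) \<times> (real ^ 'm)) measure" where
  "glued \<delta> cell N q = chain \<delta> N q \<bind>
     (\<lambda>z. glue (E N) L cell (fst q, fst z) \<Otimes>\<^sub>M glue (E N) L cell (snd q, snd z))"

context
  fixes cell :: "real ^ 'm \<Rightarrow> nat" and \<delta> :: real
  assumes cell [measurable]: "cell \<in> borel \<rightarrow>\<^sub>M count_space UNIV" and \<delta>: "0 < \<delta>"
begin

lemma glue_E_measurable [measurable]: "glue (E N) L cell \<in> borel2 \<rightarrow>\<^sub>M prob_algebra borel"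
  by (rule glue_measurable[OF E_measurable L_measurable cell])

lemma glue_in_space: "glue (E N) L cell q \<in> space (prob_algebra borel)"
  using measurable_space[OF glue_E_measurable, of q] by (simp add: space_pair_measure)

lemma glue_pair_measurable:
  "(\<lambda>z. glue (E N) L cell (x, fst z) \<Otimes>\<^sub>M glue (E N) L cell (y, snd z)) \<in> borel2 \<rightarrow>\<^sub>M prob_algebra borel2"
  by measurable

lemma glued_measurable: "glued \<delta> cell N \<in> borel2 \<rightarrow>\<^sub>M prob_algebra borel2"
  unfolding glued_def[abs_def]
  by (rule measurable_bind_prob_space2[OF chain_measurable]) measurable

lemma glued_marginals:
  "distr (glued \<delta> cell N q) borel fst = p (fst q)" "distr (glued \<delta> cell N q) borel snd = p (snd q)"
proof -
  obtain x y where q: "q = (x, y)" by (cases q)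
  let ?Q = "chain \<delta> N (x, y)"
  let ?G = "\<lambda>x z. glue (E N) L cell (x, z)"
  have G: "prob_space (?G x z)" "sets (?G x z) = sets borel" for x z
    using glue_in_space by (auto simp: space_prob_algebra)
  have Gm: "?G x \<in> borel \<rightarrow>\<^sub>M prob_algebra borel" for x by measurable
  have fst: "distr (?G x z \<Otimes>\<^sub>M ?G y z') borel fst = ?G x z" for z z'
  proof -
    have "distr (?G x z \<Otimes>\<^sub>M ?G y z') borel fst = distr (?G x z \<Otimes>\<^sub>M ?G y z') (?G x z) fst"
      by (rule distr_cong) (simp_all add: G)
    then show ?thesis using prob_space.distr_pair_fst[OF G(1)] by simp
  qed
  have snd: "distr (?G x z \<Otimes>\<^sub>M ?G y z') borel snd = ?G y z'" for z z'
  proof -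
    interpret A: prob_space "?G x z" by (rule G)
    interpret B: prob_space "?G y z'" by (rule G)
    interpret pair_prob_space "?G x z" "?G y z'" ..
    have "distr (?G x z \<Otimes>\<^sub>M ?G y z') borel snd = distr (?G x z \<Otimes>\<^sub>M ?G y z') (?G y z') snd"
      by (rule distr_cong) (simp_all add: G)
    also have "\<dots> = distr (distr (?G y z' \<Otimes>\<^sub>M ?G x z) (?G x z \<Otimes>\<^sub>M ?G y z') (\<lambda>(x, y). (y, x))) (?G y z') snd"
      by (subst distr_pair_swap) (rule refl)
    also have "\<dots> = distr (?G y z' \<Otimes>\<^sub>M ?G x z) (?G y z') fst"
      by (subst distr_distr) (auto simp: comp_def case_prod_beta intro!: distr_cong)
    also have "\<dots> = ?G y z'" by (rule A.distr_pair_fst)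
    finally show ?thesis .
  qed
  have "distr (glued \<delta> cell N q) borel fst = ?Q \<bind> (\<lambda>z. ?G x (fst z))"
    unfolding glued_def q by (subst distr_bind_kernel[OF chain_in_space glue_pair_measurable measurable_fst]) (simp add: fst)
  also have "\<dots> = distr ?Q borel fst \<bind> ?G x"
    by (rule bind_distr_kernel[OF chain_in_space measurable_fst Gm, symmetric])
  also have "\<dots> = p x"
    unfolding chain_marginal_fst[OF \<delta>] p_eq by (rule bind_glue[OF E_measurable L_measurable cell]) simp
  finally show "distr (glued \<delta> cell N q) borel fst = p (fst q)" by (simp add: q)
  have "distr (glued \<delta> cell N q) borel snd = ?Q \<bind> (\<lambda>z. ?G y (snd z))"
    unfolding glued_def q by (subst distr_bind_kernel[OF chain_in_space glue_pair_measurable measurable_snd]) (simp add: snd)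
  also have "\<dots> = distr ?Q borel snd \<bind> ?G y"
    by (rule bind_distr_kernel[OF chain_in_space measurable_snd Gm, symmetric])
  also have "\<dots> = p y"
    unfolding chain_marginal_snd[OF \<delta>] p_eq by (rule bind_glue[OF E_measurable L_measurable cell]) simp
  finally show "distr (glued \<delta> cell N q) borel snd = p (snd q)" by (simp add: q)
qed

lemma F_triangle: "F u u' \<le> F z z' + CARD('n) * norm (u - z) + CARD('n) * norm (u' - z')"
proof -
  have "ffun (\<kappa> i) (norm (P i u - P i u')) * w i \<le>
      ffun (\<kappa> i) (norm (P i z - P i z')) * w i + (norm (u - z) + norm (u' - z'))" for i
  proof -
    have eq: "P i u - P i u' = (P i z - P i z') + ((P i u - P i z) - (P i u' - P i z'))" by simp
    have "norm (P i u - P i u') \<le> norm (P i z - P i z') + (norm (P i u - P i z) + norm (P i u' - P i z'))"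
      by (subst eq) (intro norm_triangle_le add_left_mono norm_triangle_ineq4)
    then have "norm (P i u - P i u') \<le> norm (P i z - P i z') + (norm (u - z) + norm (u' - z'))"
      using norm_block_diff_le[of i u z] norm_block_diff_le[of i u' z'] by linarith
    then have "ffun (\<kappa> i) (norm (P i u - P i u')) \<le> ffun (\<kappa> i) (norm (P i z - P i z')) + (norm (u - z) + norm (u' - z'))"
      by (intro profile.ffun_le_add) auto
    then have "ffun (\<kappa> i) (norm (P i u - P i u')) * w i \<le> (ffun (\<kappa> i) (norm (P i z - P i z')) + (norm (u - z) + norm (u' - z'))) * w i"
      by (intro mult_right_mono w_nonneg)
    also have "\<dots> = ffun (\<kappa> i) (norm (P i z - P i z')) * w i + (norm (u - z) + norm (u' - z')) * w i"
      by (rule distrib_right)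
    also have "(norm (u - z) + norm (u' - z')) * w i \<le> (norm (u - z) + norm (u' - z')) * 1"
      using w_bounds[of i] by (intro mult_left_mono) auto
    finally show ?thesis by simp
  qed
  then have "F u u' \<le> (\<Sum>i\<in>UNIV. ffun (\<kappa> i) (norm (P i z - P i z')) * w i + (norm (u - z) + norm (u' - z')))"
    unfolding F_def by (rule sum_mono)
  also have "\<dots> = F z z' + CARD('n) * norm (u - z) + CARD('n) * norm (u' - z')"
    by (simp add: F_def sum.distrib distrib_left)
  finally show ?thesis .
qed

text \<open>Points of one cell are at most \<eta> apart, so the resampled endpoint misses the Euler
  endpoint by at most \<eta> plus the error of the scheme.\<close>

lemma glue_error:
  fixes \<eta> S :: real
  assumes "\<And>x y. cell x = cell y \<Longrightarrow> norm (x - y) \<le> \<eta>" "0 \<le> \<eta>" "0 \<le> S"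
  shows "(\<integral>\<^sup>+ z. \<integral>\<^sup>+ u. ennreal (min (CARD('n) * norm (u - z)) S) \<partial>glue (E N) L cell (x, z) \<partial>distr M borel (E N x)) \<le>
    ennreal (CARD('n) * \<eta>) + (\<integral>\<^sup>+ \<omega>. ennreal (min (CARD('n) * norm (L x \<omega> - E N x \<omega>)) S) \<partial>M)"
proof -
  let ?g = "\<lambda>z u. ennreal (min (CARD('n) * norm (u - z)) S)"
  have G: "(\<lambda>z. glue (E N) L cell (x, z)) \<in> borel \<rightarrow>\<^sub>M subprob_algebra borel"
    by (rule measurable_prob_algebraD) measurable
  have "(\<lambda>z. \<integral>\<^sup>+ u. ?g z u \<partial>glue (E N) L cell (x, z)) \<in> borel_measurable borel"
    by (rule nn_integral_measurable_subprob_algebra2[OF _ G]) measurable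
  then have "(\<integral>\<^sup>+ z. \<integral>\<^sup>+ u. ?g z u \<partial>glue (E N) L cell (x, z) \<partial>distr M borel (E N x)) =
     (\<integral>\<^sup>+ \<omega>. \<integral>\<^sup>+ u. ?g (E N x \<omega>) u \<partial>glue (E N) L cell (x, E N x \<omega>) \<partial>M)"
    by (simp add: nn_integral_distr)
  also have "\<dots> \<le> (\<integral>\<^sup>+ \<omega>. ennreal (CARD('n) * \<eta>) + ?g (E N x \<omega>) (L x \<omega>) \<partial>M)"
  proof (rule nn_integral_glue_le)
    fix \<omega> \<omega>' assume "cell (E N x \<omega>') = cell (E N x \<omega>)"
    then have "norm (E N x \<omega>' - E N x \<omega>) \<le> \<eta>" by (rule assms)
    then have "norm (L x \<omega>' - E N x \<omega>) \<le> \<eta> + norm (L x \<omega>' - E N x \<omega>')"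
      using norm_triangle_ineq[of "L x \<omega>' - E N x \<omega>'" "E N x \<omega>' - E N x \<omega>"] by simp
    then have "CARD('n) * norm (L x \<omega>' - E N x \<omega>) \<le> CARD('n) * \<eta> + CARD('n) * norm (L x \<omega>' - E N x \<omega>')"
      by (simp add: distrib_left[symmetric])
    moreover have "0 \<le> CARD('n) * \<eta>" using assms by simp
    ultimately have "min (CARD('n) * norm (L x \<omega>' - E N x \<omega>)) S \<le> CARD('n) * \<eta> + min (CARD('n) * norm (L x \<omega>' - E N x \<omega>')) S"
      by (simp add: min_def)
    then have "?g (E N x \<omega>) (L x \<omega>') \<le> ennreal (CARD('n) * \<eta> + min (CARD('n) * norm (L x \<omega>' - E N x \<omega>')) S)" by (rule ennreal_leI)
    also have "\<dots> = ennreal (CARD('n) * \<eta>) + ?g (E N x \<omega>') (L x \<omega>')"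
      using assms by (intro ennreal_plus) auto
    finally show "?g (E N x \<omega>) (L x \<omega>') \<le> ennreal (CARD('n) * \<eta>) + ?g (E N x \<omega>') (L x \<omega>')" .
  qed measurable
  also have "\<dots> = ennreal (CARD('n) * \<eta>) + (\<integral>\<^sup>+ \<omega>. ?g (E N x \<omega>) (L x \<omega>) \<partial>M)"
    by (subst nn_integral_add) (auto simp: emeasure_space_1)
  finally show ?thesis .
qed

text \<open>\<open>F_triangle\<close> transfers the cost from the chain to the glued pair, with one
  \<open>glue_error\<close> for each marginal. The error terms are truncated at S as well, which
  \<open>euler_error_tendsto\<close> relies on.\<close>

lemma glued_cost_truncated:
  fixes \<eta> S :: real
  assumes \<eta>: "\<And>x y. cell x = cell y \<Longrightarrow> norm (x - y) \<le> \<eta>" "0 \<le> \<eta>" and S: "0 \<le> S"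
  shows "(\<integral>\<^sup>+ u. ennreal (min (F (fst u) (snd u)) S) \<partial>glued \<delta> cell N (x, y)) \<le>
    (\<integral>\<^sup>+ z. ennreal (min (F (fst z) (snd z)) S) \<partial>chain \<delta> N (x, y))
    + (ennreal (CARD('n) * \<eta>) + (\<integral>\<^sup>+ \<omega>. ennreal (min (CARD('n) * norm (L x \<omega> - E N x \<omega>)) S) \<partial>M))
    + (ennreal (CARD('n) * \<eta>) + (\<integral>\<^sup>+ \<omega>. ennreal (min (CARD('n) * norm (L y \<omega> - E N y \<omega>)) S) \<partial>M))"
proof -
  let ?Q = "chain \<delta> N (x, y)"
  let ?G = "\<lambda>x z. glue (E N) L cell (x, z)"
  let ?g = "\<lambda>z u. ennreal (min (CARD('n) * norm (u - z)) S)"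
  let ?f = "\<lambda>u. ennreal (min (F (fst u) (snd u)) S)"
  have G: "prob_space (?G x z)" and [measurable_cong]: "sets (?G x z) = sets borel" for x z
    using glue_in_space by (auto simp: space_prob_algebra)
  have Gm: "?G x \<in> borel \<rightarrow>\<^sub>M subprob_algebra borel" for x by (rule measurable_prob_algebraD) measurable
  have gm[measurable]: "(\<lambda>z. \<integral>\<^sup>+ u. ?g z u \<partial>?G x z) \<in> borel_measurable borel" for x
    by (rule nn_integral_measurable_subprob_algebra2[OF _ Gm]) measurable
  have "(\<integral>\<^sup>+ u. ?f u \<partial>glued \<delta> cell N (x, y)) = (\<integral>\<^sup>+ z. \<integral>\<^sup>+ u. ?f u \<partial>(?G x (fst z) \<Otimes>\<^sub>M ?G y (snd z)) \<partial>?Q)"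
    unfolding glued_def fst_conv snd_conv
    by (rule nn_integral_bind_kernel[OF chain_in_space glue_pair_measurable]) measurable
  also have "\<dots> \<le> (\<integral>\<^sup>+ z. ?f z + (\<integral>\<^sup>+ u. ?g (fst z) u \<partial>?G x (fst z)) + (\<integral>\<^sup>+ u. ?g (snd z) u \<partial>?G y (snd z)) \<partial>?Q)"
  proof (rule nn_integral_mono)
    fix z :: "(real ^ 'm) \<times> (real ^ 'm)"
    interpret A: prob_space "?G x (fst z)" by (rule G)
    interpret B: prob_space "?G y (snd z)" by (rule G)
    interpret AB: pair_prob_space "?G x (fst z)" "?G y (snd z)" ..
    have "(\<integral>\<^sup>+ u. ?f u \<partial>(?G x (fst z) \<Otimes>\<^sub>M ?G y (snd z))) \<le>
       (\<integral>\<^sup>+ u. ?f z + ?g (fst z) (fst u) + ?g (snd z) (snd u) \<partial>(?G x (fst z) \<Otimes>\<^sub>M ?G y (snd z)))"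
    proof (rule nn_integral_mono)
      fix u
      have "min (F (fst u) (snd u)) S \<le> min (F (fst z) (snd z)) S + min (CARD('n) * norm (fst u - fst z)) S + min (CARD('n) * norm (snd u - snd z)) S"
      proof -
        have *: "min a S \<le> min f S + min b S + min d S" if "a \<le> f + b + d" "0 \<le> f" "0 \<le> b" "0 \<le> d" for a f b d :: real
          using that S unfolding min_def by (smt (verit))
        show ?thesis
          by (rule *[OF F_triangle]) (simp_all add: F_nonneg)
      qed
      then have "?f u \<le> ennreal (min (F (fst z) (snd z)) S + min (CARD('n) * norm (fst u - fst z)) S + min (CARD('n) * norm (snd u - snd z)) S)"
        by (rule ennreal_leI)
      then show "?f u \<le> ?f z + ?g (fst z) (fst u) + ?g (snd z) (snd u)"
        using F_nonneg S by (simp add: ennreal_plus)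
    qed
    also have "\<dots> = ?f z + (\<integral>\<^sup>+ u. ?g (fst z) (fst u) \<partial>(?G x (fst z) \<Otimes>\<^sub>M ?G y (snd z))) + (\<integral>\<^sup>+ u. ?g (snd z) (snd u) \<partial>(?G x (fst z) \<Otimes>\<^sub>M ?G y (snd z)))"
      by (simp add: nn_integral_add AB.emeasure_space_1)
    also have "(\<integral>\<^sup>+ u. ?g (fst z) (fst u) \<partial>(?G x (fst z) \<Otimes>\<^sub>M ?G y (snd z))) = (\<integral>\<^sup>+ u. ?g (fst z) u \<partial>?G x (fst z))"
      by (subst B.nn_integral_fst[symmetric]) (simp_all add: B.emeasure_space_1)
    also have "(\<integral>\<^sup>+ u. ?g (snd z) (snd u) \<partial>(?G x (fst z) \<Otimes>\<^sub>M ?G y (snd z))) = (\<integral>\<^sup>+ u. ?g (snd z) u \<partial>?G y (snd z))"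
      by (subst B.nn_integral_fst[symmetric]) (simp_all add: A.emeasure_space_1)
    finally show "(\<integral>\<^sup>+ u. ?f u \<partial>(?G x (fst z) \<Otimes>\<^sub>M ?G y (snd z))) \<le>
       ?f z + (\<integral>\<^sup>+ u. ?g (fst z) u \<partial>?G x (fst z)) + (\<integral>\<^sup>+ u. ?g (snd z) u \<partial>?G y (snd z))" .
  qed
  also have "\<dots> = (\<integral>\<^sup>+ z. ?f z \<partial>?Q) + (\<integral>\<^sup>+ z. \<integral>\<^sup>+ u. ?g (fst z) u \<partial>?G x (fst z) \<partial>?Q) + (\<integral>\<^sup>+ z. \<integral>\<^sup>+ u. ?g (snd z) u \<partial>?G y (snd z) \<partial>?Q)"
  proof -
    have [measurable]: "(\<lambda>z. \<integral>\<^sup>+ u. ?g (fst z) u \<partial>?G x (fst z)) \<in> borel_measurable ?Q"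
      "(\<lambda>z. \<integral>\<^sup>+ u. ?g (snd z) u \<partial>?G y (snd z)) \<in> borel_measurable ?Q"
      using measurable_compose[OF measurable_fst gm[of x]] measurable_compose[OF measurable_snd gm[of y]]
      by simp_all
    show ?thesis by (simp add: nn_integral_add)
  qed
  also have "(\<integral>\<^sup>+ z. \<integral>\<^sup>+ u. ?g (fst z) u \<partial>?G x (fst z) \<partial>?Q) = (\<integral>\<^sup>+ z. \<integral>\<^sup>+ u. ?g z u \<partial>?G x z \<partial>distr ?Q borel fst)"
    by (subst nn_integral_distr) simp_all
  also have "(\<integral>\<^sup>+ z. \<integral>\<^sup>+ u. ?g (snd z) u \<partial>?G y (snd z) \<partial>?Q) = (\<integral>\<^sup>+ z. \<integral>\<^sup>+ u. ?g z u \<partial>?G y z \<partial>distr ?Q borel snd)"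
    by (subst nn_integral_distr) simp_all
  finally show ?thesis
    unfolding chain_marginal_fst[OF \<delta>] chain_marginal_snd[OF \<delta>]
    by (rule order_trans) (intro add_mono order_refl glue_error \<eta> S)
qed

end

text \<open>Chebyshev's device: where \<open>F > S\<close> one has
  \<open>F \<le> F\<^sup>2 / S\<close>, and \<open>F\<close> is at most linear in the distance.
  Second moments thus give uniform integrability.\<close>

lemma F_le_truncated:
  assumes "0 < S"
  shows "F x y \<le> min (F x y) S + 2 * (real CARD('n))\<^sup>2 / S * ((norm x)\<^sup>2 + (norm y)\<^sup>2)"
proof (cases "F x y \<le> S")
  case False
  let ?n = "real CARD('n)"
  have "S * F x y \<le> F x y * F x y" using False assms by (intro mult_right_mono) auto
  also have "\<dots> \<le> (?n * norm (x - y))\<^sup>2"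
    unfolding power2_eq_square by (intro mult_mono F_le_norm F_nonneg) auto
  also have "\<dots> = ?n\<^sup>2 * (norm (x - y))\<^sup>2" by (simp add: power_mult_distrib)
  also have "(norm (x - y))\<^sup>2 \<le> 2 * ((norm x)\<^sup>2 + (norm y)\<^sup>2)"
  proof -
    have "(norm (x - y))\<^sup>2 \<le> (norm x + norm y)\<^sup>2" by (intro power_mono norm_triangle_ineq4) auto
    also have "\<dots> \<le> 2 * ((norm x)\<^sup>2 + (norm y)\<^sup>2)"
      using zero_le_power2[of "norm x - norm y"] by (simp add: power2_sum power2_diff)
    finally show ?thesis .
  qed
  finally have "S * F x y \<le> ?n\<^sup>2 * (2 * ((norm x)\<^sup>2 + (norm y)\<^sup>2))" by (simp add: mult_left_mono)
  then have "F x y \<le> 2 * ?n\<^sup>2 / S * ((norm x)\<^sup>2 + (norm y)\<^sup>2)"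
    using assms by (simp add: field_simps)
  then show ?thesis using False assms by simp
qed (use assms in simp)

text \<open>The index k codes a pair (n, N): n sets the Lyapunov weight \<open>1 / (n + 1)\<close>
  and the truncation level \<open>n + 1\<close>, while N sets the step and the cell size. Neither
  depends on x, y or e; only the choice of k does, which keeps the family countable.\<close>

lemma coupling_kernels:
  "\<exists>R :: nat \<Rightarrow> (real ^ 'm) \<times> (real ^ 'm) \<Rightarrow> ((real ^ 'm) \<times> (real ^ 'm)) measure.
    (\<forall>k. R k \<in> borel2 \<rightarrow>\<^sub>M prob_algebra borel2) \<and>
    (\<forall>k q. distr (R k q) borel fst = p (fst q) \<and> distr (R k q) borel snd = p (snd q)) \<and>
    (\<forall>x y e. 0 < e \<longrightarrow> (\<exists>k. (\<integral>\<^sup>+ u. ennreal (F (fst u) (snd u)) \<partial>R k (x, y)) \<le> ennreal (exp (- c * t) * F x y + e)))"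
proof -
  let ?n = "real CARD('n)"
  let ?S = "\<lambda>n. real (Suc n)" and ?l = "\<lambda>n. 1 / real (Suc n)"
  \<comment> \<open>The factor \<open>exp (c * t)\<close> in the level disappears on division by the
    weight of \<open>F\<close> in \<open>lyap\<close>, which leaves \<open>F\<close> truncated at
    \<open>?S n\<close>.\<close>
  have "\<exists>\<delta>>0. \<exists>N0. \<forall>N\<ge>N0. \<forall>p. (\<integral>\<^sup>+ q. ennreal (min (lyap (?l n) t (fst q) (snd q)) (exp (c * t) * ?S n))
    \<partial>chain \<delta> N p) \<le> ennreal (lyap (?l n) 0 (fst p) (snd p))" for n
    by (rule chain_lyap) auto
  then have "\<forall>n. \<exists>\<delta> N0. 0 < \<delta> \<and> (\<forall>N\<ge>N0. \<forall>p. (\<integral>\<^sup>+ q. ennreal (min (lyap (?l n) t (fst q) (snd q)) (exp (c * t) * ?S n))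
    \<partial>chain \<delta> N p) \<le> ennreal (lyap (?l n) 0 (fst p) (snd p)))"
    by blast
  then obtain \<delta> N0 where chain0: "\<forall>n. 0 < \<delta> n \<and> (\<forall>N\<ge>N0 n. \<forall>p. (\<integral>\<^sup>+ q. ennreal (min (lyap (?l n) t (fst q) (snd q)) (exp (c * t) * ?S n))
    \<partial>chain (\<delta> n) N p) \<le> ennreal (lyap (?l n) 0 (fst p) (snd p)))"
    unfolding choice_iff by blast
  then have \<delta>: "\<And>n. 0 < \<delta> n" and chain: "\<And>n N p. N0 n \<le> N \<Longrightarrow>
    (\<integral>\<^sup>+ q. ennreal (min (lyap (?l n) t (fst q) (snd q)) (exp (c * t) * ?S n))
    \<partial>chain (\<delta> n) N p) \<le> ennreal (lyap (?l n) 0 (fst p) (snd p))"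
    by blast+
  have "\<exists>cell :: real ^ 'm \<Rightarrow> nat. cell \<in> borel \<rightarrow>\<^sub>M count_space UNIV \<and> (\<forall>x y. cell x = cell y \<longrightarrow> norm (x - y) \<le> 1 / real (Suc N))" for N
    using small_cells[of "1 / real (Suc N)", where 'b="real ^ 'm"] by (metis of_nat_0_less_iff zero_less_Suc zero_less_divide_1_iff)
  then obtain cell :: "nat \<Rightarrow> real ^ 'm \<Rightarrow> nat" where cell: "\<And>N. cell N \<in> borel \<rightarrow>\<^sub>M count_space UNIV"
    "\<And>N x y. cell N x = cell N y \<Longrightarrow> norm (x - y) \<le> 1 / real (Suc N)" by metis
  define R where "R k = (case prod_decode k of (n, N) \<Rightarrow> glued (\<delta> n) (cell N) N)" for k
  show ?thesis
  proof (intro exI[of _ R] conjI allI impI)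
    fix k
    show "R k \<in> borel2 \<rightarrow>\<^sub>M prob_algebra borel2"
      unfolding R_def by (cases "prod_decode k") (simp add: glued_measurable[OF cell(1) \<delta>])
    fix q
    show "distr (R k q) borel fst = p (fst q)" "distr (R k q) borel snd = p (snd q)"
      unfolding R_def by (cases "prod_decode k"; simp add: glued_marginals[OF cell(1) \<delta>])+
  next
    fix x y :: "real ^ 'm" and e :: real assume e: "0 < e"
    define B where "B = exp ((growth + 1) * t) * (1 + 2 * (norm x)\<^sup>2) + exp ((growth + 1) * t) * (1 + 2 * (norm y)\<^sup>2)"
    define V where "V = 1 + (norm x)\<^sup>2 + (norm y)\<^sup>2"
    \<comment> \<open>n is fixed before N: it controls the Lyapunov weight and, through the second
      moment bound B, the truncation error, and neither depends on N.\<close>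
    have "(\<lambda>n. exp (- c * t) * (?l n * V) + 2 * ?n\<^sup>2 / ?S n * B) \<longlonglongrightarrow> exp (- c * t) * (0 * V) + 0 * B"
    proof (intro tendsto_intros)
      show "?l \<longlonglongrightarrow> 0" using LIMSEQ_inverse_real_of_nat by (simp add: inverse_eq_divide)
      from tendsto_mult_right_zero[OF this, of "2 * ?n\<^sup>2"]
      show "(\<lambda>n. 2 * ?n\<^sup>2 / ?S n) \<longlonglongrightarrow> 0" by simp
    qed
    then have "eventually (\<lambda>n. exp (- c * t) * (?l n * V) + 2 * ?n\<^sup>2 / ?S n * B < e / 2) sequentially"
      by (rule order_tendstoD) (use e in simp)
    then obtain n where n: "exp (- c * t) * (?l n * V) + 2 * ?n\<^sup>2 / ?S n * B < e / 2"
      by (auto simp: eventually_sequentially)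
    let ?err = "\<lambda>N x. ennreal (?n * (1 / real (Suc N))) + (\<integral>\<^sup>+ \<omega>. ennreal (min (?n * norm (L x \<omega> - E N x \<omega>)) (?S n)) \<partial>M)"
    have "(\<lambda>N. ennreal (?n * (1 / real (Suc N)))) \<longlonglongrightarrow> ennreal (?n * 0)"
      using LIMSEQ_inverse_real_of_nat by (intro tendsto_intros) (simp add: inverse_eq_divide)
    then have "(\<lambda>N. ?err N x + ?err N y) \<longlonglongrightarrow> (ennreal (?n * 0) + 0) + (ennreal (?n * 0) + 0)"
      by (intro tendsto_add euler_error_tendsto) auto
    then have "eventually (\<lambda>N. ?err N x + ?err N y < ennreal (e / 2)) sequentially"
      by (rule order_tendstoD) (use e in simp)
    then have "eventually (\<lambda>N. N0 n \<le> N \<and> ?err N x + ?err N y < ennreal (e / 2)) sequentially"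
      by (intro eventually_conj eventually_ge_at_top)
    then obtain N where N: "N0 n \<le> N" "?err N x + ?err N y < ennreal (e / 2)"
      by (auto simp: eventually_sequentially)
    let ?R = "glued (\<delta> n) (cell N) N (x, y)"
    have Rk: "R (prod_encode (n, N)) = glued (\<delta> n) (cell N) N" by (simp add: R_def)
    have Rs[measurable_cong]: "sets ?R = sets borel2"
      using measurable_space[OF glued_measurable[OF cell(1) \<delta>], of "(x, y)"] by (simp add: space_prob_algebra space_pair_measure)
    have "(\<integral>\<^sup>+ z. ennreal (min (F (fst z) (snd z)) (?S n)) \<partial>chain (\<delta> n) N (x, y))
      \<le> (\<integral>\<^sup>+ z. ennreal (exp (- c * t)) * ennreal (min (lyap (?l n) t (fst z) (snd z)) (exp (c * t) * ?S n))
         \<partial>chain (\<delta> n) N (x, y))"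
    proof (rule nn_integral_mono)
      fix z
      have "exp (c * t) * F (fst z) (snd z) \<le> lyap (?l n) t (fst z) (snd z)"
        unfolding lyap_def by (simp add: add_nonneg_nonneg)
      then have "min (exp (c * t) * F (fst z) (snd z)) (exp (c * t) * ?S n) \<le> min (lyap (?l n) t (fst z) (snd z)) (exp (c * t) * ?S n)"
        by (intro min.mono order_refl)
      then have "exp (- c * t) * (exp (c * t) * min (F (fst z) (snd z)) (?S n)) \<le> exp (- c * t) * min (lyap (?l n) t (fst z) (snd z)) (exp (c * t) * ?S n)"
        by (intro mult_left_mono) (auto simp: min_mult_distrib_left)
      then have "min (F (fst z) (snd z)) (?S n) \<le> exp (- c * t) * min (lyap (?l n) t (fst z) (snd z)) (exp (c * t) * ?S n)"
        by (simp add: exp_add[symmetric] mult.assoc[symmetric])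
      then show "ennreal (min (F (fst z) (snd z)) (?S n)) \<le> ennreal (exp (- c * t)) * ennreal (min (lyap (?l n) t (fst z) (snd z)) (exp (c * t) * ?S n))"
        by (subst ennreal_mult[symmetric]) (auto intro!: ennreal_leI lyap_nonneg)
    qed
    also have "\<dots> = ennreal (exp (- c * t)) * (\<integral>\<^sup>+ z. ennreal (min (lyap (?l n) t (fst z) (snd z)) (exp (c * t) * ?S n))
         \<partial>chain (\<delta> n) N (x, y))"
      by (rule nn_integral_cmult) measurable
    also have "\<dots> \<le> ennreal (exp (- c * t)) * ennreal (F x y + ?l n * V)"
      using chain[OF N(1), of "(x, y)"] by (intro mult_left_mono) (auto simp: lyap_def V_def)
    also have "\<dots> = ennreal (exp (- c * t) * F x y + exp (- c * t) * (?l n * V))"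
      using F_nonneg by (simp add: ennreal_mult[symmetric] V_def distrib_left add_nonneg_nonneg)
    finally have 1: "(\<integral>\<^sup>+ z. ennreal (min (F (fst z) (snd z)) (?S n)) \<partial>chain (\<delta> n) N (x, y))
      \<le> ennreal (exp (- c * t) * F x y + exp (- c * t) * (?l n * V))" .
    have "(\<integral>\<^sup>+ u. ennreal (min (F (fst u) (snd u)) (?S n)) \<partial>?R) \<le>
        (\<integral>\<^sup>+ z. ennreal (min (F (fst z) (snd z)) (?S n)) \<partial>chain (\<delta> n) N (x, y))
        + ?err N x + ?err N y"
      by (rule glued_cost_truncated[OF cell(1) \<delta> cell(2)]) auto
    also have "\<dots> \<le> ennreal (exp (- c * t) * F x y + exp (- c * t) * (?l n * V)) + ennreal (e / 2)"
      unfolding add.assoc[of _ "?err N x"] using 1 N(2) by (intro add_mono) auto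
    finally have 2: "(\<integral>\<^sup>+ u. ennreal (min (F (fst u) (snd u)) (?S n)) \<partial>?R) \<le>
       ennreal (exp (- c * t) * F x y + exp (- c * t) * (?l n * V)) + ennreal (e / 2)" .
    have "(\<integral>\<^sup>+ u. ennreal ((norm (fst u))\<^sup>2) \<partial>?R) = (\<integral>\<^sup>+ u. ennreal ((norm u)\<^sup>2) \<partial>distr ?R borel fst)"
      by (subst nn_integral_distr) auto
    then have mx: "(\<integral>\<^sup>+ u. ennreal ((norm (fst u))\<^sup>2) \<partial>?R) \<le> ennreal (exp ((growth + 1) * t) * (1 + 2 * (norm x)\<^sup>2))"
      using second_moment[of x] by (simp add: glued_marginals[OF cell(1) \<delta>])
    have "(\<integral>\<^sup>+ u. ennreal ((norm (snd u))\<^sup>2) \<partial>?R) = (\<integral>\<^sup>+ u. ennreal ((norm u)\<^sup>2) \<partial>distr ?R borel snd)"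
      by (subst nn_integral_distr) auto
    then have my: "(\<integral>\<^sup>+ u. ennreal ((norm (snd u))\<^sup>2) \<partial>?R) \<le> ennreal (exp ((growth + 1) * t) * (1 + 2 * (norm y)\<^sup>2))"
      using second_moment[of y] by (simp add: glued_marginals[OF cell(1) \<delta>])
    let ?a = "2 * ?n\<^sup>2 / ?S n"
    have "(\<integral>\<^sup>+ u. ennreal (F (fst u) (snd u)) \<partial>?R) \<le>
       (\<integral>\<^sup>+ u. ennreal (min (F (fst u) (snd u)) (?S n)) + ennreal ?a * (ennreal ((norm (fst u))\<^sup>2) + ennreal ((norm (snd u))\<^sup>2)) \<partial>?R)"
    proof (rule nn_integral_mono)
      fix u
      have "ennreal (F (fst u) (snd u)) \<le> ennreal (min (F (fst u) (snd u)) (?S n) + ?a * ((norm (fst u))\<^sup>2 + (norm (snd u))\<^sup>2))"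
        by (intro ennreal_leI F_le_truncated) simp
      also have "\<dots> = ennreal (min (F (fst u) (snd u)) (?S n)) + ennreal ?a * (ennreal ((norm (fst u))\<^sup>2) + ennreal ((norm (snd u))\<^sup>2))"
        using F_nonneg by (simp add: ennreal_mult[symmetric] ennreal_plus[symmetric] del: ennreal_plus)
      finally show "ennreal (F (fst u) (snd u)) \<le> ennreal (min (F (fst u) (snd u)) (?S n)) + ennreal ?a * (ennreal ((norm (fst u))\<^sup>2) + ennreal ((norm (snd u))\<^sup>2))" .
    qed
    also have "\<dots> = (\<integral>\<^sup>+ u. ennreal (min (F (fst u) (snd u)) (?S n)) \<partial>?R)
       + ennreal ?a * ((\<integral>\<^sup>+ u. ennreal ((norm (fst u))\<^sup>2) \<partial>?R) + (\<integral>\<^sup>+ u. ennreal ((norm (snd u))\<^sup>2) \<partial>?R))"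
      by (simp add: nn_integral_add nn_integral_cmult)
    also have "\<dots> \<le> (ennreal (exp (- c * t) * F x y + exp (- c * t) * (?l n * V)) + ennreal (e / 2))
       + ennreal ?a * (ennreal (exp ((growth + 1) * t) * (1 + 2 * (norm x)\<^sup>2)) + ennreal (exp ((growth + 1) * t) * (1 + 2 * (norm y)\<^sup>2)))"
      by (intro add_mono mult_left_mono 2 mx my) simp
    also have "\<dots> = ennreal (exp (- c * t) * F x y + exp (- c * t) * (?l n * V) + e / 2 + ?a * B)"
      using F_nonneg[of x y] e by (simp add: B_def V_def ennreal_plus[symmetric] ennreal_mult[symmetric] add_nonneg_nonneg del: ennreal_plus)
    also have "\<dots> \<le> ennreal (exp (- c * t) * F x y + e)"
      using n by (intro ennreal_leI) linarith
    finally show "\<exists>k. (\<integral>\<^sup>+ u. ennreal (F (fst u) (snd u)) \<partial>R k (x, y)) \<le> ennreal (exp (- c * t) * F x y + e)"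
      by (intro exI[of _ "prod_encode (n, N)"]) (simp add: Rk)
  qed
qed

end

section \<open>Contraction of Kantorovich distances\<close>

text \<open>Dividing by a moves the factor across the infimum; this also covers infinite costs and
  an empty set of couplings.\<close>

lemma le_mult_kantorovich:
  assumes a: "0 < a" and le: "\<And>\<eta>. \<eta> \<in> couplings \<mu> \<nu> \<Longrightarrow> K \<le> ennreal a * (\<integral>\<^sup>+ p. ennreal (\<rho> (fst p) (snd p)) \<partial>\<eta>)"
  shows "K \<le> ennreal a * kantorovich \<rho> \<mu> \<nu>"
proof -
  have 1: "ennreal (1 / a) * ennreal a = 1" using a by (simp add: ennreal_mult[symmetric])
  have "ennreal (1 / a) * K \<le> kantorovich \<rho> \<mu> \<nu>"
    unfolding kantorovich_def
  proof (rule INF_greatest)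
    fix \<eta> assume "\<eta> \<in> couplings \<mu> \<nu>"
    then have "ennreal (1 / a) * K \<le> ennreal (1 / a) * (ennreal a * (\<integral>\<^sup>+ p. ennreal (\<rho> (fst p) (snd p)) \<partial>\<eta>))"
      by (intro mult_left_mono le) auto
    then show "ennreal (1 / a) * K \<le> (\<integral>\<^sup>+ p. ennreal (\<rho> (fst p) (snd p)) \<partial>\<eta>)"
      by (simp add: mult.assoc[symmetric] 1)
  qed
  then have "ennreal a * (ennreal (1 / a) * K) \<le> ennreal a * kantorovich \<rho> \<mu> \<nu>"
    by (rule mult_left_mono) simp
  then show ?thesis by (simp add: mult.assoc[symmetric] mult.commute[of "ennreal a"] 1)
qed

lemma kantorovich_mono:
  assumes a: "0 < a" and le: "\<And>x y. \<rho> x y \<le> a * \<rho>' x y"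
    and \<rho>': "(\<lambda>p. \<rho>' (fst p) (snd p)) \<in> borel_measurable borel2"
  shows "kantorovich \<rho> \<mu> \<nu> \<le> ennreal a * kantorovich \<rho>' \<mu> \<nu>"
proof (rule le_mult_kantorovich[OF a])
  fix \<eta> assume \<eta>: "\<eta> \<in> couplings \<mu> \<nu>"
  then have [measurable_cong]: "sets \<eta> = sets borel2" by (simp add: couplings_def)
  note [measurable] = \<rho>'
  have "kantorovich \<rho> \<mu> \<nu> \<le> (\<integral>\<^sup>+ p. ennreal (\<rho> (fst p) (snd p)) \<partial>\<eta>)"
    unfolding kantorovich_def using \<eta> by (rule INF_lower)
  also have "\<dots> \<le> (\<integral>\<^sup>+ p. ennreal a * ennreal (\<rho>' (fst p) (snd p)) \<partial>\<eta>)"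
    using a by (intro nn_integral_mono) (auto simp: ennreal_mult'[symmetric] intro!: ennreal_leI le)
  also have "\<dots> = ennreal a * (\<integral>\<^sup>+ p. ennreal (\<rho>' (fst p) (snd p)) \<partial>\<eta>)"
    by (rule nn_integral_cmult) measurable
  finally show "kantorovich \<rho> \<mu> \<nu> \<le> ennreal a * (\<integral>\<^sup>+ p. ennreal (\<rho>' (fst p) (snd p)) \<partial>\<eta>)" .
qed

text \<open>Measurable selection among the couplings is elementary because the family \<open>R\<close> is countable.\<close>

lemma kantorovich_contraction:
  fixes \<rho> :: "'a::topological_space \<Rightarrow> 'a \<Rightarrow> real"
  assumes a: "0 < a" and p: "p \<in> borel \<rightarrow>\<^sub>M prob_algebra borel"
    and R: "\<And>k::nat. R k \<in> borel2 \<rightarrow>\<^sub>M prob_algebra borel2"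
    and marg: "\<And>k q. distr (R k q) borel fst = p (fst q)" "\<And>k q. distr (R k q) borel snd = p (snd q)"
    and \<rho>: "(\<lambda>q. \<rho> (fst q) (snd q)) \<in> borel_measurable borel2" "\<And>x y. 0 \<le> \<rho> x y"
    and cost: "\<And>x y e. 0 < e \<Longrightarrow> \<exists>k. (\<integral>\<^sup>+ u. ennreal (\<rho> (fst u) (snd u)) \<partial>R k (x, y)) \<le> ennreal (a * \<rho> x y + e)"
  shows "kantorovich \<rho> (\<mu> \<bind> p) (\<nu> \<bind> p) \<le> ennreal a * kantorovich \<rho> \<mu> \<nu>"
proof (rule le_mult_kantorovich[OF a])
  fix \<eta> assume \<eta>: "\<eta> \<in> couplings \<mu> \<nu>"
  then have [measurable_cong]: "sets \<eta> = sets borel2" and "prob_space \<eta>"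
    and \<mu>\<nu>: "distr \<eta> borel fst = \<mu>" "distr \<eta> borel snd = \<nu>" by (auto simp: couplings_def)
  then have \<eta>s: "\<eta> \<in> space (prob_algebra borel2)" by (simp add: space_prob_algebra)
  interpret prob_space \<eta> by fact
  note [measurable] = \<rho>(1)
  show "kantorovich \<rho> (\<mu> \<bind> p) (\<nu> \<bind> p) \<le> ennreal a * (\<integral>\<^sup>+ q. ennreal (\<rho> (fst q) (snd q)) \<partial>\<eta>)"
  proof (rule ennreal_le_epsilon)
    fix e :: real assume e: "0 < e"
    define C where "C k q = (\<integral>\<^sup>+ u. ennreal (\<rho> (fst u) (snd u)) \<partial>R k q)" for k q
    have C[measurable]: "C k \<in> borel_measurable borel2" for k
      unfolding C_def by (rule nn_integral_measurable_subprob_algebra2[OF _ measurable_prob_algebraD[OF R]]) measurable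
    define k where "k q = (LEAST k. C k q \<le> ennreal (a * \<rho> (fst q) (snd q) + e))" for q
    have k: "C (k q) q \<le> ennreal (a * \<rho> (fst q) (snd q) + e)" for q
      unfolding k_def by (rule LeastI_ex) (use cost[OF e, of "fst q" "snd q"] in \<open>simp add: C_def\<close>)
    have km[measurable]: "k \<in> borel2 \<rightarrow>\<^sub>M count_space UNIV" unfolding k_def[abs_def] by measurable
    define K where "K q = R (k q) q" for q
    have K: "K \<in> borel2 \<rightarrow>\<^sub>M prob_algebra borel2"
      unfolding K_def[abs_def] by (rule measurable_compose_countable[OF R km])
    have "\<eta> \<bind> K \<in> couplings (\<mu> \<bind> p) (\<nu> \<bind> p)"
    proof -
      have "distr (\<eta> \<bind> K) borel fst = distr \<eta> borel fst \<bind> p"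
        by (simp add: distr_bind_kernel[OF \<eta>s K] bind_distr_kernel[OF \<eta>s _ p] K_def marg)
      moreover have "distr (\<eta> \<bind> K) borel snd = distr \<eta> borel snd \<bind> p"
        by (simp add: distr_bind_kernel[OF \<eta>s K] bind_distr_kernel[OF \<eta>s _ p] K_def marg)
      ultimately show ?thesis
        unfolding couplings_def using prob_space_bind'[OF \<eta>s K] sets_bind'[OF \<eta>s K] by (simp add: \<mu>\<nu>)
    qed
    then have "kantorovich \<rho> (\<mu> \<bind> p) (\<nu> \<bind> p) \<le> (\<integral>\<^sup>+ u. ennreal (\<rho> (fst u) (snd u)) \<partial>(\<eta> \<bind> K))"
      unfolding kantorovich_def by (rule INF_lower)
    also have "\<dots> = (\<integral>\<^sup>+ q. C (k q) q \<partial>\<eta>)"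
      unfolding C_def K_def[symmetric] by (rule nn_integral_bind_kernel[OF \<eta>s K]) measurable
    also have "\<dots> \<le> (\<integral>\<^sup>+ q. ennreal a * ennreal (\<rho> (fst q) (snd q)) + ennreal e \<partial>\<eta>)"
    proof (rule nn_integral_mono)
      fix q
      have "ennreal (a * \<rho> (fst q) (snd q) + e) = ennreal a * ennreal (\<rho> (fst q) (snd q)) + ennreal e"
        using a e \<rho>(2) by (simp add: ennreal_mult)
      then show "C (k q) q \<le> ennreal a * ennreal (\<rho> (fst q) (snd q)) + ennreal e" using k[of q] by simp
    qed
    also have "\<dots> = ennreal a * (\<integral>\<^sup>+ q. ennreal (\<rho> (fst q) (snd q)) \<partial>\<eta>) + ennreal e"
      by (simp add: nn_integral_add nn_integral_cmult emeasure_space_1)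
    finally show "kantorovich \<rho> (\<mu> \<bind> p) (\<nu> \<bind> p) \<le> ennreal a * (\<integral>\<^sup>+ q. ennreal (\<rho> (fst q) (snd q)) \<partial>\<eta>) + ennreal e" .
  qed
qed

section \<open>Brownian increments\<close>

lemma vec_nth_measurable [measurable]: "(\<lambda>x::real ^ 'm::finite. x $ j) \<in> borel_measurable borel"
  by (intro borel_measurable_continuous_onI continuous_intros)

lemma vec_measurableI:
  fixes f :: "'a \<Rightarrow> real ^ 'm::finite"
  assumes "\<And>j. (\<lambda>x. f x $ j) \<in> borel_measurable M"
  shows "f \<in> borel_measurable M"
  by (subst borel_measurable_euclidean_space) (auto simp: Basis_vec_def inner_axis assms)

abbreviation vec_boxes :: "(real ^ 'm::finite) set set" where
  "vec_boxes \<equiv> {{x. \<forall>j. x $ j \<in> A j} | A. \<forall>j. A j \<in> sets borel}"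

lemma Int_stable_vec_boxes: "Int_stable (vec_boxes :: (real ^ 'm::finite) set set)"
proof (rule Int_stableI, safe)
  fix A A' :: "'m \<Rightarrow> real set" assume "\<forall>j. A j \<in> sets borel" "\<forall>j. A' j \<in> sets borel"
  then show "\<exists>C. {x :: real ^ 'm. \<forall>j. x $ j \<in> A j} \<inter> {x. \<forall>j. x $ j \<in> A' j} = {x. \<forall>j. x $ j \<in> C j} \<and> (\<forall>j. C j \<in> sets borel)"
    by (intro exI[of _ "\<lambda>j. A j \<inter> A' j"]) auto
qed

lemma UNIV_in_vec_boxes: "UNIV \<in> vec_boxes"
  by (auto intro!: exI[of _ "\<lambda>_. UNIV"])

lemma sets_borel_vec_boxes: "sets (borel :: (real ^ 'm::finite) measure) = sigma_sets UNIV vec_boxes"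
proof
  have "(vec_boxes :: (real ^ 'm) set set) \<subseteq> sets borel" by auto
  then show "sigma_sets UNIV vec_boxes \<subseteq> sets (borel :: (real ^ 'm) measure)"
    using sets.sigma_sets_subset[of vec_boxes borel] by simp
  have "sets (borel :: (real ^ 'm) measure) = sigma_sets UNIV (range (\<lambda>(a, b). box a b :: (real ^ 'm) set))"
    by (subst borel_eq_box) simp
  also have "\<dots> \<subseteq> sigma_sets UNIV vec_boxes"
  proof (rule sigma_sets_mono', safe)
    fix a b :: "real ^ 'm"
    show "\<exists>A. box a b = {x. \<forall>j. x $ j \<in> A j} \<and> (\<forall>j. A j \<in> sets borel)"
      by (intro exI[of _ "\<lambda>j. {a $ j <..< b $ j}"]) (auto simp: mem_box_cart)
  qed
  finally show "sets (borel :: (real ^ 'm) measure) \<subseteq> sigma_sets UNIV vec_boxes" .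
qed

lemma gauss_vec_eqI:
  fixes N :: "(real ^ 'm::finite) measure"
  assumes N: "sets N = sets borel"
    and eq: "\<And>A. (\<And>j. A j \<in> sets borel) \<Longrightarrow> emeasure N {x. \<forall>j. x $ j \<in> A j} = (\<Prod>j\<in>UNIV. emeasure std_normal (A j))"
  shows "N = gauss"
proof (rule measure_eqI_generator_eq[of vec_boxes UNIV N gauss "\<lambda>_. UNIV"])
  have B: "(Basis :: (real ^ 'm) set) = range (\<lambda>j. axis j 1)" by (auto simp: Basis_vec_def)
  fix X assume "X \<in> (vec_boxes :: (real ^ 'm) set set)"
  then obtain A where X: "X = {x. \<forall>j. x $ j \<in> A j}" and A: "\<And>j. A j \<in> sets borel" by auto
  \<comment> \<open>Boxes are indexed here by coordinates but in \<open>emeasure_gauss_box\<close>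
    by basis vectors; the choice inverts \<open>axis\<close>.\<close>
  define A' where "A' b = A (SOME j. b = axis j (1::real))" for b :: "real ^ 'm"
  have A': "A' (axis j 1) = A j" for j by (simp add: A'_def axis_eq_axis)
  have "X = {x. \<forall>b\<in>Basis. x \<bullet> b \<in> A' b}"
    unfolding X B by (auto simp: inner_axis A')
  then have "emeasure gauss X = (\<Prod>b\<in>(Basis :: (real ^ 'm) set). emeasure std_normal (A' b))"
    using emeasure_gauss_box[of A'] A by (simp add: A'_def)
  also have "\<dots> = (\<Prod>j\<in>UNIV. emeasure std_normal (A j))"
    unfolding B by (subst prod.reindex) (auto simp: inj_on_def axis_eq_axis A')
  finally show "emeasure N X = emeasure gauss X" using eq[OF A] by (simp add: X)
next
  have "emeasure N UNIV = 1"
    using eq[of "\<lambda>_. UNIV"] prob_space.emeasure_space_1[OF prob_std_normal] by simp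
  then show "emeasure N UNIV \<noteq> \<infinity>" by simp
  show "range (\<lambda>_. UNIV) \<subseteq> vec_boxes" using UNIV_in_vec_boxes by auto
qed (use N sets_borel_vec_boxes Int_stable_vec_boxes in simp_all)

locale block_brownian_motion = prob_space M
  for M :: "'w measure" +
  fixes blk :: "'m::finite \<Rightarrow> 'n::finite" and B :: "'n \<Rightarrow> real \<Rightarrow> 'w \<Rightarrow> real ^ 'm"
  assumes surj: "surj blk"
    and brownian: "\<And>i. brownian_motion_in M (blk -` {i}) (B i)"
    and indep: "indep_processes M B UNIV"
begin

text \<open>The block motions live in complementary coordinate subspaces, so the sum just collects
  their coordinates (\<open>W_nth\<close>).\<close>

definition W :: "real \<Rightarrow> 'w \<Rightarrow> real ^ 'm" where "W s \<omega> = (\<Sum>i\<in>UNIV. B i s \<omega>)"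

lemma B_in: "0 \<le> s \<Longrightarrow> \<omega> \<in> space M \<Longrightarrow> B i s \<omega> \<in> block_space blk i"
  using brownian by (auto simp: brownian_motion_in_def)

lemma component_brownian: "real_brownian_motion M (\<lambda>s \<omega>. B (blk j) s \<omega> $ j)"
  using brownian[of "blk j"] by (auto simp: brownian_motion_in_def)

lemma W_nth: assumes "0 \<le> s" "\<omega> \<in> space M" shows "W s \<omega> $ j = B (blk j) s \<omega> $ j"
proof -
  have "W s \<omega> $ j = (\<Sum>i\<in>UNIV. if i = blk j then B (blk j) s \<omega> $ j else 0)"
    unfolding W_def sum_component
    by (rule sum.cong) (use B_in[OF assms] in \<open>auto simp: coord_space_def\<close>)
  then show ?thesis by simp
qed

lemma B_measurable: assumes "0 \<le> s" shows "B i s \<in> borel_measurable M"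
proof (rule vec_measurableI)
  fix j
  show "(\<lambda>\<omega>. B i s \<omega> $ j) \<in> borel_measurable M"
  proof (cases "blk j = i")
    case True
    then show ?thesis using component_brownian[of j] assms by (auto simp: real_brownian_motion_def)
  next
    case False
    have "(\<lambda>\<omega>. B i s \<omega> $ j) \<in> borel_measurable M \<longleftrightarrow> (\<lambda>\<omega>. 0 :: real) \<in> borel_measurable M"
      by (rule measurable_cong) (use B_in[OF assms] False in \<open>auto simp: coord_space_def\<close>)
    then show ?thesis by simp
  qed
qed

lemma W_measurable: "0 \<le> s \<Longrightarrow> W s \<in> borel_measurable M"
  unfolding W_def[abs_def] by (intro borel_measurable_sum B_measurable)

lemma W_0: "AE \<omega> in M. W 0 \<omega> = 0"
proof -
  have "AE \<omega> in M. \<forall>j. B (blk j) 0 \<omega> $ j = 0"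
    using component_brownian by (simp add: AE_all_countable real_brownian_motion_def)
  then show ?thesis using AE_space by eventually_elim (simp add: vec_eq_iff W_nth)
qed

section \<open>Increments of the driving noise over an equidistant time grid\<close>

context
  fixes h :: real assumes h: "0 < h"
begin

abbreviation "V k \<omega> \<equiv> increments h (\<lambda>s. W s \<omega>) k"

lemma V_nth: "\<omega> \<in> space M \<Longrightarrow> V k \<omega> $ j = B (blk j) (real (Suc k) * h) \<omega> $ j - B (blk j) (real k * h) \<omega> $ j"
  unfolding increments_def using h by (simp add: W_nth)

lemma V_measurable: "V k \<in> borel_measurable M"
  unfolding increments_def using h by (intro borel_measurable_diff W_measurable) auto

lemma V_nth_measurable: "(\<lambda>\<omega>. V k \<omega> $ j) \<in> borel_measurable M"
  using measurable_compose[OF V_measurable vec_nth_measurable] .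

text \<open>Three independence assumptions are combined: between blocks, between the coordinates of
  a block, and between the increments of one coordinate. Together they factor the probability over
  all coordinates and times.\<close>

lemma prob_increments_box:
  fixes A :: "'m \<Rightarrow> nat \<Rightarrow> real set"
  assumes A: "\<And>j k. A j k \<in> sets borel"
  shows "prob {\<omega>\<in>space M. \<forall>j. \<forall>k<n. V k \<omega> $ j \<in> A j k} = (\<Prod>j\<in>UNIV. \<Prod>k<n. prob {\<omega>\<in>space M. V k \<omega> $ j \<in> A j k})"
proof -
  note [measurable] = A
  let ?t = "\<lambda>k. real k * h"
  have t: "?t k \<in> {0..}" for k using h by simp
  define S where "S j = {\<omega>\<in>space M. \<forall>k<n. V k \<omega> $ j \<in> A j k}" for j
  define D where "D i = {u\<in>space (Pi\<^sub>M {0..} (\<lambda>_. borel :: (real ^ 'm) measure)).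
      \<forall>j\<in>blk -` {i}. \<forall>k<n. u (?t (Suc k)) $ j - u (?t k) $ j \<in> A j k}" for i
  have D: "D i \<in> sets (Pi\<^sub>M {0..} (\<lambda>_. borel))" for i
  proof -
    have [measurable]: "(\<lambda>u. u (?t k)) \<in> Pi\<^sub>M {0..} (\<lambda>_. borel :: (real ^ 'm) measure) \<rightarrow>\<^sub>M borel" for k
      by (rule measurable_component_singleton) (rule t)
    show ?thesis unfolding D_def by measurable
  qed
  have DS: "(\<lambda>\<omega>. \<lambda>s\<in>{0..}. B i s \<omega>) -` D i \<inter> space M = {\<omega>\<in>space M. \<forall>j\<in>blk -` {i}. \<omega> \<in> S j}" for i
  proof -
    have "(\<lambda>s\<in>{0..}. B i s \<omega>) \<in> D i \<longleftrightarrow> (\<forall>j\<in>blk -` {i}. \<omega> \<in> S j)" if "\<omega> \<in> space M" for \<omega>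
      using t that by (auto simp: D_def S_def space_PiM V_nth[OF that] simp del: of_nat_Suc)
    then show ?thesis by auto
  qed
  define C where "C j = {u\<in>space (Pi\<^sub>M {0..} (\<lambda>_. borel :: real measure)). \<forall>k<n. u (?t (Suc k)) - u (?t k) \<in> A j k}" for j
  have C: "C j \<in> sets (Pi\<^sub>M {0..} (\<lambda>_. borel))" for j
  proof -
    have [measurable]: "(\<lambda>u. u (?t k)) \<in> Pi\<^sub>M {0..} (\<lambda>_. borel :: real measure) \<rightarrow>\<^sub>M borel" for k
      by (rule measurable_component_singleton) (rule t)
    show ?thesis unfolding C_def by measurable
  qed
  have CS: "(\<lambda>\<omega>. \<lambda>s\<in>{0..}. B i s \<omega> $ j) -` C j \<inter> space M = S j" if "blk j = i" for i j
    using t that by (auto simp: C_def S_def space_PiM V_nth simp del: of_nat_Suc)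
  have "prob {\<omega>\<in>space M. \<forall>j. \<forall>k<n. V k \<omega> $ j \<in> A j k} =
      prob (\<Inter>i\<in>UNIV. (\<lambda>\<omega>. \<lambda>s\<in>{0..}. B i s \<omega>) -` D i \<inter> space M)"
    unfolding DS by (rule arg_cong[where f=prob]) (auto simp: S_def)
  also have "\<dots> = (\<Prod>i\<in>UNIV. prob ((\<lambda>\<omega>. \<lambda>s\<in>{0..}. B i s \<omega>) -` D i \<inter> space M))"
    using indep unfolding indep_processes_def by (rule indep_varsD) (auto intro: D)
  also have "\<dots> = (\<Prod>i\<in>UNIV. \<Prod>j\<in>{j\<in>UNIV. blk j = i}. prob (S j))"
  proof (rule prod.cong[OF refl])
    fix i
    obtain j0 where j0: "blk j0 = i" using surj by (metis surjD)
    have "prob ((\<lambda>\<omega>. \<lambda>s\<in>{0..}. B i s \<omega>) -` D i \<inter> space M) =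
        prob (\<Inter>j\<in>blk -` {i}. (\<lambda>\<omega>. \<lambda>s\<in>{0..}. B i s \<omega> $ j) -` C j \<inter> space M)"
      unfolding DS by (rule arg_cong[where f=prob]) (use j0 in \<open>auto simp: CS\<close>, auto simp: S_def)
    also have "\<dots> = (\<Prod>j\<in>blk -` {i}. prob ((\<lambda>\<omega>. \<lambda>s\<in>{0..}. B i s \<omega> $ j) -` C j \<inter> space M))"
      using brownian[of i] unfolding brownian_motion_in_def indep_processes_def
      by (intro indep_varsD[where I="blk -` {i}"]) (use j0 C in auto)
    also have "\<dots> = (\<Prod>j\<in>{j\<in>UNIV. blk j = i}. prob (S j))"
      by (rule prod.cong) (auto simp: CS)
    finally show "prob ((\<lambda>\<omega>. \<lambda>s\<in>{0..}. B i s \<omega>) -` D i \<inter> space M) = (\<Prod>j\<in>{j\<in>UNIV. blk j = i}. prob (S j))" .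
  qed
  also have "\<dots> = (\<Prod>j\<in>UNIV. prob (S j))"
    by (rule prod.group) auto
  also have "\<dots> = (\<Prod>j\<in>UNIV. \<Prod>k<n. prob {\<omega>\<in>space M. V k \<omega> $ j \<in> A j k})"
  proof (rule prod.cong[OF refl])
    fix j
    show "prob (S j) = (\<Prod>k<n. prob {\<omega>\<in>space M. V k \<omega> $ j \<in> A j k})"
    proof (cases "n = 0")
      case True
      then show ?thesis by (simp add: S_def prob_space)
    next
      case False
      let ?X = "\<lambda>k \<omega>. B (blk j) (?t (Suc k)) \<omega> $ j - B (blk j) (?t k) \<omega> $ j"
      have *: "indep_vars (\<lambda>_. borel) (\<lambda>k \<omega>. B (blk j) (\<tau> (Suc k)) \<omega> $ j - B (blk j) (\<tau> k) \<omega> $ j) {..<N}"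
        if "0 \<le> \<tau> 0" "mono \<tau>" for \<tau> N
        using component_brownian[of j] that unfolding real_brownian_motion_def by blast
      have "mono ?t" using h by (intro monoI mult_right_mono) auto
      then have "indep_vars (\<lambda>_. borel) ?X {..<n}" by (intro *) simp_all
      then have "prob (\<Inter>k\<in>{..<n}. ?X k -` A j k \<inter> space M) = (\<Prod>k<n. prob (?X k -` A j k \<inter> space M))"
        by (rule indep_varsD) (use False A in auto)
      moreover have "(\<Inter>k\<in>{..<n}. ?X k -` A j k \<inter> space M) = S j"
        using False by (auto simp: S_def V_nth simp del: of_nat_Suc)
      moreover have "?X k -` A j k \<inter> space M = {\<omega>\<in>space M. V k \<omega> $ j \<in> A j k}" for k
        by (auto simp: V_nth simp del: of_nat_Suc)
      ultimately show ?thesis by simp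
    qed
  qed
  finally show ?thesis .
qed

lemma prob_increment_box:
  fixes A :: "'m \<Rightarrow> real set"
  assumes A: "\<And>j. A j \<in> sets borel"
  shows "prob {\<omega>\<in>space M. \<forall>j. V k \<omega> $ j \<in> A j} = (\<Prod>j\<in>UNIV. prob {\<omega>\<in>space M. V k \<omega> $ j \<in> A j})"
proof -
  have "prob {\<omega>\<in>space M. \<forall>j. V k \<omega> $ j \<in> A j} = prob {\<omega>\<in>space M. \<forall>j. \<forall>l<Suc k. V l \<omega> $ j \<in> (if l = k then A j else UNIV)}"
    by (rule arg_cong[where f=prob]) auto
  also have "\<dots> = (\<Prod>j\<in>UNIV. \<Prod>l<Suc k. prob {\<omega>\<in>space M. V l \<omega> $ j \<in> (if l = k then A j else UNIV)})"
    by (rule prob_increments_box) (use A in auto)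
  also have "\<dots> = (\<Prod>j\<in>UNIV. prob {\<omega>\<in>space M. V k \<omega> $ j \<in> A j})"
    by (simp add: prob_space)
  finally show ?thesis .
qed

text \<open>Boxes form a generating family stable under intersection, so the product rule on them
  suffices. The factors are regrouped from coordinates to times by exchanging the products.\<close>

lemma indep_increments: "indep_vars (\<lambda>_. borel) (\<lambda>k. V k) {..<n}"
proof (cases "n = 0")
  case True
  then show ?thesis by (simp add: indep_vars_def indep_sets_def)
next
  case False
  show ?thesis
  proof (subst indep_vars_finite[where E="\<lambda>_. vec_boxes :: (real ^ 'm) set set"])
    show "\<forall>A\<in>(\<Pi> i\<in>{..<n}. vec_boxes :: (real ^ 'm) set set). prob (\<Inter>k\<in>{..<n}. V k -` A k \<inter> space M) = (\<Prod>k\<in>{..<n}. prob (V k -` A k \<inter> space M))"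
    proof
      fix A :: "nat \<Rightarrow> (real ^ 'm) set" assume "A \<in> (\<Pi> i\<in>{..<n}. vec_boxes)"
      then have "\<forall>k\<in>{..<n}. \<exists>C. A k = {x. \<forall>j. x $ j \<in> C j} \<and> (\<forall>j. C j \<in> sets borel)" by (auto simp: Pi_iff)
      from bchoice[OF this] obtain C where C: "\<And>k. k < n \<Longrightarrow> A k = {x. \<forall>j. x $ j \<in> C k j}" "\<And>k j. k < n \<Longrightarrow> C k j \<in> sets borel"
        by auto
      define C' where "C' j k = (if k < n then C k j else UNIV)" for j k
      have C': "C' j k \<in> sets borel" for j k using C by (auto simp: C'_def)
      have VA: "V k -` A k \<inter> space M = {\<omega>\<in>space M. \<forall>j. V k \<omega> $ j \<in> C' j k}" if "k < n" for k
        using that C(1)[OF that] by (auto simp: C'_def)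
      have "(\<Inter>k\<in>{..<n}. V k -` A k \<inter> space M) = {\<omega>\<in>space M. \<forall>j. \<forall>k<n. V k \<omega> $ j \<in> C' j k}"
        using False by (auto simp: VA)
      then have "prob (\<Inter>k\<in>{..<n}. V k -` A k \<inter> space M) = (\<Prod>j\<in>UNIV. \<Prod>k<n. prob {\<omega>\<in>space M. V k \<omega> $ j \<in> C' j k})"
        using prob_increments_box[of C' n] C' by simp
      also have "\<dots> = (\<Prod>k<n. \<Prod>j\<in>UNIV. prob {\<omega>\<in>space M. V k \<omega> $ j \<in> C' j k})" by (rule prod.swap)
      also have "\<dots> = (\<Prod>k\<in>{..<n}. prob (V k -` A k \<inter> space M))"
        by (rule prod.cong) (use VA prob_increment_box C' in auto)
      finally show "prob (\<Inter>k\<in>{..<n}. V k -` A k \<inter> space M) = (\<Prod>k\<in>{..<n}. prob (V k -` A k \<inter> space M))" .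
    qed
  qed (use False V_measurable sets_borel_vec_boxes Int_stable_vec_boxes UNIV_in_vec_boxes in auto)
qed

text \<open>Each coordinate divided by \<open>sqrt h\<close> is standard normal and
  \<open>prob_increment_box\<close> factors over coordinates, so the rescaled increment is
  \<open>gauss\<close>; scaling back gives the claim.\<close>

lemma distr_increment: "distr M borel (V k) = distr gauss borel (\<lambda>\<xi>. sqrt h *\<^sub>R \<xi>)"
proof -
  note [measurable] = V_measurable V_nth_measurable
  have component: "prob {\<omega>\<in>space M. V k \<omega> $ j / sqrt h \<in> A} = measure std_normal A" if A[measurable]: "A \<in> sets borel" for j A
  proof -
    let ?X = "\<lambda>\<omega>. B (blk j) (real (Suc k) * h) \<omega> $ j - B (blk j) (real k * h) \<omega> $ j"
    have "distributed M lborel ?X (normal_density 0 (sqrt (real (Suc k) * h - real k * h)))"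
      using component_brownian[of j] h unfolding real_brownian_motion_def by (simp add: mult_strict_right_mono)
    also have "real (Suc k) * h - real k * h = h" by (simp add: algebra_simps)
    finally have X: "distributed M lborel ?X (normal_density 0 (sqrt h))" .
    then have [measurable]: "?X \<in> borel_measurable M" by (simp add: distributed_def)
    have "distributed M lborel (\<lambda>\<omega>. (?X \<omega> - 0) / sqrt h) std_normal_density"
      by (rule normal_standard_normal_convert[THEN iffD1, OF _ X]) (use h in simp)
    then have "distr M lborel (\<lambda>\<omega>. (?X \<omega> - 0) / sqrt h) = std_normal" by (simp add: distributed_def)
    moreover have "measure (distr M lborel (\<lambda>\<omega>. (?X \<omega> - 0) / sqrt h)) A = prob {\<omega>\<in>space M. V k \<omega> $ j / sqrt h \<in> A}"
    proof (subst measure_distr)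
      show "(\<lambda>\<omega>. (?X \<omega> - 0) / sqrt h) \<in> M \<rightarrow>\<^sub>M lborel"
        by measurable
      show "prob ((\<lambda>\<omega>. (?X \<omega> - 0) / sqrt h) -` A \<inter> space M) = prob {\<omega>\<in>space M. V k \<omega> $ j / sqrt h \<in> A}"
        by (rule arg_cong[where f=prob]) (auto simp: V_nth simp del: of_nat_Suc)
    qed simp
    ultimately show ?thesis by simp
  qed
  interpret std: prob_space std_normal by (rule prob_std_normal)
  have "distr M borel (\<lambda>\<omega>. (1 / sqrt h) *\<^sub>R V k \<omega>) = gauss"
  proof (rule gauss_vec_eqI)
    fix A :: "'m \<Rightarrow> real set" assume A: "\<And>j. A j \<in> sets borel"
    note [measurable] = A
    define A' where "A' j = {r. r / sqrt h \<in> A j}" for j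
    have A': "A' j \<in> sets borel" for j
    proof -
      have "A' j = (\<lambda>r. r / sqrt h) -` A j \<inter> space borel" by (auto simp: A'_def)
      also have "\<dots> \<in> sets borel" by (rule measurable_sets[where A=borel]) (use A in auto)
      finally show ?thesis .
    qed
    have "emeasure (distr M borel (\<lambda>\<omega>. (1 / sqrt h) *\<^sub>R V k \<omega>)) {x. \<forall>j. x $ j \<in> A j} = emeasure M {\<omega>\<in>space M. \<forall>j. V k \<omega> $ j \<in> A' j}"
      by (subst emeasure_distr) (auto intro!: arg_cong[where f="emeasure M"] simp: A'_def)
    also have "\<dots> = ennreal (\<Prod>j\<in>UNIV. prob {\<omega>\<in>space M. V k \<omega> $ j \<in> A' j})"
      by (simp add: emeasure_eq_measure prob_increment_box[OF A'])
    also have "\<dots> = ennreal (\<Prod>j\<in>UNIV. measure std_normal (A j))"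
      using component[OF A] by (simp add: A'_def)
    also have "\<dots> = (\<Prod>j\<in>UNIV. emeasure std_normal (A j))"
      by (simp add: std.emeasure_eq_measure prod_ennreal)
    finally show "emeasure (distr M borel (\<lambda>\<omega>. (1 / sqrt h) *\<^sub>R V k \<omega>)) {x. \<forall>j. x $ j \<in> A j} = (\<Prod>j\<in>UNIV. emeasure std_normal (A j))" .
  qed simp
  then have "distr gauss borel (\<lambda>\<xi>. sqrt h *\<^sub>R \<xi>) = distr (distr M borel (\<lambda>\<omega>. (1 / sqrt h) *\<^sub>R V k \<omega>)) borel (\<lambda>\<xi>. sqrt h *\<^sub>R \<xi>)"
    by simp
  also have "\<dots> = distr M borel (V k)"
    using h by (subst distr_distr) (auto simp: comp_def)
  finally show ?thesis ..
qed

end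

end

section \<open>The coupled diffusion\<close>

lemma (in block_brownian_motion) law_euler_path:
  fixes \<beta> :: "real ^ 'm \<Rightarrow> real ^ 'm"
  assumes [measurable]: "\<beta> \<in> borel_measurable borel" and h: "0 < h"
    and K: "\<And>y. K y = distr gauss borel (\<lambda>\<xi>. y + h *\<^sub>R \<beta> y + sqrt h *\<^sub>R \<xi>)"
  shows "distr M borel (\<lambda>\<omega>. euler_path \<beta> h x (increments h (\<lambda>s. W s \<omega>)) n) = iter_kernel borel K n x"
proof -
  have "k \<le> n \<Longrightarrow> distr M borel (\<lambda>\<omega>. euler_path \<beta> h x (increments h (\<lambda>s. W s \<omega>)) k) = iter_kernel borel K k x" for k
  proof (induction k)
    case 0
    show ?case by (simp add: distr_const)
  next
    case (Suc k)
    have "distr (distr M borel (\<lambda>\<omega>. increments h (\<lambda>s. W s \<omega>) k)) borel (\<lambda>u. y + h *\<^sub>R \<beta> y + u) = K y" for y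
      unfolding distr_increment[OF h] K by (subst distr_distr) (auto simp: comp_def)
    then show ?case
      using distr_euler_path_Suc[OF assms(1) indep_increments[OF h, of n], of k h x] Suc by simp
  qed
  then show ?thesis by simp
qed

locale coupled_diffusion = weakly_coupled_drift blk b b0 \<gamma> \<kappa> w \<epsilon> + block_brownian_motion M blk B
  for blk :: "'m::finite \<Rightarrow> 'n::finite" and b b0 \<gamma> \<kappa> w \<epsilon> and M :: "'w measure" and B +
  fixes X :: "real ^ 'm \<Rightarrow> real \<Rightarrow> 'w \<Rightarrow> real ^ 'm"
  assumes solution: "\<And>x. strong_solution M blk b B x (X x)"
begin

text \<open>The augmented filtration adds only null sets of M, which are already measurable, so it
  is contained in the sigma-algebra of M.\<close>

lemma X_measurable: assumes "0 \<le> s" shows "X x s \<in> borel_measurable M"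
proof -
  have G: "{B i r -` A \<inter> space M | i r A. 0 \<le> r \<and> r \<le> s \<and> A \<in> sets borel} \<union> null_sets M \<subseteq> sets M" using B_measurable by (auto intro: measurable_sets)
  then have "sets (augmented_filtration M B s) \<subseteq> sets M"
    unfolding augmented_filtration_def using sets.sigma_sets_subset[OF G] sets.space_closed[of M]
    by (subst sets_measure_of) auto
  moreover have "space (augmented_filtration M B s) = space M"
    by (simp add: augmented_filtration_def space_measure_of_conv)
  moreover have "X x s \<in> measurable (augmented_filtration M B s) borel"
    using solution assms by (simp add: strong_solution_def)
  ultimately show ?thesis by (auto simp: measurable_def)
qed

text \<open>Summing the block equations gives one vector equation, the form required by
  \<open>euler_path_tendsto\<close>.\<close>

lemma X_integral_equation:
  "AE \<omega> in M. continuous_on {0..} (\<lambda>s. X x s \<omega>) \<and> (\<forall>s\<ge>0. X x s \<omega> = x + integral {0..s} (\<lambda>u. drift (X x u \<omega>)) + W s \<omega>)"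
proof -
  have "AE \<omega> in M. continuous_on {0..} (\<lambda>s. X x s \<omega>) \<and>
        (\<forall>s\<ge>0. \<forall>i. P i (X x s \<omega>) = P i x + integral {0..s} (\<lambda>u. b i (X x u \<omega>)) + B i s \<omega>)"
    using solution[of x] by (simp add: strong_solution_def)
  then show ?thesis
  proof eventually_elim
    case (elim \<omega>)
    have "X x s \<omega> = x + integral {0..s} (\<lambda>u. drift (X x u \<omega>)) + W s \<omega>" if s: "0 \<le> s" for s
    proof -
      have cont: "continuous_on {0..s} (\<lambda>u. b i (X x u \<omega>))" for i
      proof -
        have "continuous_on {0..s} (\<lambda>u. drift (X x u \<omega>))"
          by (rule continuous_on_compose2[OF drift_continuous]) (use elim in \<open>auto intro: continuous_on_subset\<close>)
        then have "continuous_on {0..s} (\<lambda>u. P i (drift (X x u \<omega>)))"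
          by (rule linear_continuous_on_compose) (rule linear_coord_proj)
        then show ?thesis by (simp add: block_drift)
      qed
      have "X x s \<omega> = (\<Sum>i\<in>UNIV. P i x + integral {0..s} (\<lambda>u. b i (X x u \<omega>)) + B i s \<omega>)"
        using elim s sum_block[of blk "X x s \<omega>"] by simp
      also have "\<dots> = x + (\<Sum>i\<in>UNIV. integral {0..s} (\<lambda>u. b i (X x u \<omega>))) + W s \<omega>"
        by (simp add: sum.distrib sum_block W_def)
      also have "(\<Sum>i\<in>UNIV. integral {0..s} (\<lambda>u. b i (X x u \<omega>))) = integral {0..s} (\<lambda>u. drift (X x u \<omega>))"
        unfolding drift_def by (rule integral_sum[symmetric]) (auto intro: integrable_continuous_real cont)
      finally show ?thesis .
    qed
    then show ?case using elim by simp
  qed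
qed

lemma euler_limit:
  assumes t: "0 < t"
  shows "euler_limit blk b b0 \<gamma> \<kappa> w \<epsilon> M
    (\<lambda>N x \<omega>. euler_path drift (t / real (Suc N)) x (increments (t / real (Suc N)) (\<lambda>s. W s \<omega>)) (Suc N)) (\<lambda>x. X x t) t"
proof (intro euler_limit.intro euler_limit_axioms.intro)
  show "weakly_coupled_drift blk b b0 \<gamma> \<kappa> w \<epsilon>" by (rule weakly_coupled_drift_axioms)
  show "prob_space M" by (rule prob_space_axioms)
  show "0 < t" by fact
  show "X x t \<in> borel_measurable M" for x using t by (intro X_measurable) simp
  fix N
  let ?h = "t / real (Suc N)"
  have h: "0 < ?h" using t by simp
  show "(\<lambda>(x, \<omega>). euler_path drift ?h x (increments ?h (\<lambda>s. W s \<omega>)) (Suc N)) \<in> borel_measurable (borel \<Otimes>\<^sub>M M)"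
    unfolding case_prod_beta
  proof (rule euler_path_measurable)
    fix l
    have "(\<lambda>\<omega>. increments ?h (\<lambda>s. W s \<omega>) l) \<in> borel_measurable M" by (rule V_measurable[OF h])
    from measurable_compose[OF measurable_snd this]
    show "(\<lambda>p. increments ?h (\<lambda>s. W s (snd p)) l) \<in> borel_measurable (borel \<Otimes>\<^sub>M M)" .
  qed measurable
  fix x
  show "distr M borel (\<lambda>\<omega>. euler_path drift ?h x (increments ?h (\<lambda>s. W s \<omega>)) (Suc N)) = iter_kernel borel (euler_kernel ?h) (Suc N) x"
    by (rule law_euler_path[OF drift_measurable h]) (simp add: euler_kernel_def euler_step_def[abs_def])
next
  fix x
  show "AE \<omega> in M. (\<lambda>N. euler_path drift (t / real (Suc N)) x (increments (t / real (Suc N)) (\<lambda>s. W s \<omega>)) (Suc N)) \<longlonglongrightarrow> X x t \<omega>"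
    using X_integral_equation[of x] W_0
  proof eventually_elim
    case (elim \<omega>)
    show ?case
    proof (rule euler_path_tendsto[OF t _ drift_continuous])
      show "continuous_on {0..t} (\<lambda>s. X x s \<omega>)" using elim by (auto intro: continuous_on_subset)
      show "\<exists>L\<ge>0. \<forall>y\<in>S. \<forall>z\<in>S. norm (drift y - drift z) \<le> L * norm (y - z)" if "compact S" for S
        using drift_lipschitz_on_compact[OF that] by metis
    qed (use elim in auto)
  qed
qed

lemma contraction_F_pos:
  assumes t: "0 < t"
  shows "kantorovich F (\<mu> \<bind> transition_kernel M X t) (\<nu> \<bind> transition_kernel M X t)
    \<le> ennreal (exp (- c * t)) * kantorovich F \<mu> \<nu>"
proof -
  interpret euler_limit blk b b0 \<gamma> \<kappa> w \<epsilon> M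
    "\<lambda>N x \<omega>. euler_path drift (t / real (Suc N)) x (increments (t / real (Suc N)) (\<lambda>s. W s \<omega>)) (Suc N)" "\<lambda>x. X x t" t
    by (rule euler_limit[OF t])
  have p: "transition_kernel M X t = (\<lambda>x. distr M borel (X x t))" by (simp add: transition_kernel_def[abs_def])
  obtain R :: "nat \<Rightarrow> (real ^ 'm) \<times> (real ^ 'm) \<Rightarrow> ((real ^ 'm) \<times> (real ^ 'm)) measure" where
    "(\<forall>k. R k \<in> borel2 \<rightarrow>\<^sub>M prob_algebra borel2) \<and>
    (\<forall>k q. distr (R k q) borel fst = distr M borel (X (fst q) t) \<and> distr (R k q) borel snd = distr M borel (X (snd q) t)) \<and>
    (\<forall>x y e. 0 < e \<longrightarrow> (\<exists>k. (\<integral>\<^sup>+ u. ennreal (F (fst u) (snd u)) \<partial>R k (x, y)) \<le> ennreal (exp (- c * t) * F x y + e)))"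
    using coupling_kernels ..
  then have R:
    "\<And>k. R k \<in> borel2 \<rightarrow>\<^sub>M prob_algebra borel2"
    "\<And>k q. distr (R k q) borel fst = distr M borel (X (fst q) t)" "\<And>k q. distr (R k q) borel snd = distr M borel (X (snd q) t)"
    "\<And>x y e. 0 < e \<Longrightarrow> \<exists>k. (\<integral>\<^sup>+ u. ennreal (F (fst u) (snd u)) \<partial>R k (x, y)) \<le> ennreal (exp (- c * t) * F x y + e)"
    by blast+
  show ?thesis unfolding p
    by (rule kantorovich_contraction[OF _ p_measurable R(1) R(2) R(3) _ F_nonneg R(4)]) simp_all
qed

text \<open>The Euler scheme is set up for positive times; time 0 is read off the initial
  condition.\<close>

lemma transition_kernel_0: "transition_kernel M X 0 x = return borel x"
proof -
  have "AE \<omega> in M. X x 0 \<omega> = x"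
    using X_integral_equation[of x] W_0 by eventually_elim auto
  then have "distr M borel (X x 0) = distr M borel (\<lambda>_. x)"
    by (intro distr_cong_AE) (auto intro: X_measurable)
  then show ?thesis by (simp add: transition_kernel_def distr_const)
qed

lemma contraction_F:
  assumes t: "0 \<le> t" and \<mu>: "sets \<mu> = sets borel" and \<nu>: "sets \<nu> = sets borel"
  shows "kantorovich F (\<mu> \<bind> transition_kernel M X t) (\<nu> \<bind> transition_kernel M X t)
    \<le> ennreal (exp (- c * t)) * kantorovich F \<mu> \<nu>"
proof (cases "t = 0")
  case True
  have "transition_kernel M X 0 = return borel" by (rule ext) (rule transition_kernel_0)
  then show ?thesis using True \<mu> \<nu> by (simp add: bind_return'')
qed (use t contraction_F_pos in simp)

text \<open>The comparison \<open>m / 2 * dist_l1 \<le> F \<le> dist_l1\<close>, with m the minimum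
  in A, transfers the contraction of \<open>F\<close> at the price of the factor
  \<open>A = 2 / m\<close>.\<close>

lemma contraction_l1:
  assumes t: "0 \<le> t" and \<mu>: "sets \<mu> = sets borel" and \<nu>: "sets \<nu> = sets borel"
  defines "A \<equiv> 2 / Min (range (\<lambda>i. phi (\<kappa> i) (R0 (\<kappa> i)) * w i))"
  shows "kantorovich (dist_l1 blk) (\<mu> \<bind> transition_kernel M X t) (\<nu> \<bind> transition_kernel M X t)
    \<le> ennreal (A * exp (- c * t)) * kantorovich (dist_l1 blk) \<mu> \<nu>"
proof -
  define m where "m = Min (range (\<lambda>i. phi (\<kappa> i) (R0 (\<kappa> i)) * w i))"
  have m: "0 < m" unfolding m_def using w_bounds profile.phi_pos by (subst Min_gr_iff) auto
  have m_le: "m \<le> phi (\<kappa> i) (R0 (\<kappa> i)) * w i" for i unfolding m_def by (rule Min_le) auto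
  have A: "A = 2 / m" "0 < A" using m by (auto simp: A_def m_def)
  have l1_meas: "(\<lambda>p. dist_l1 blk (fst p) (snd p)) \<in> borel_measurable borel2"
    unfolding dist_l1_def by measurable
  have "dist_l1 blk x y \<le> A * F x y" for x y
  proof -
    have "m / 2 * norm (P i x - P i y) \<le> ffun (\<kappa> i) (norm (P i x - P i y)) * w i" for i
    proof -
      have "m * (norm (P i x - P i y) / 2) \<le> phi (\<kappa> i) (R0 (\<kappa> i)) * w i * (norm (P i x - P i y) / 2)"
        by (intro mult_right_mono m_le) simp
      also have "\<dots> = phi (\<kappa> i) (R0 (\<kappa> i)) / 2 * norm (P i x - P i y) * w i" by simp
      also have "\<dots> \<le> ffun (\<kappa> i) (norm (P i x - P i y)) * w i"
        by (intro mult_right_mono w_nonneg profile.ffun_ge) simp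
      finally show ?thesis by simp
    qed
    then have "m / 2 * dist_l1 blk x y \<le> F x y"
      unfolding dist_l1_def F_def sum_distrib_left by (rule sum_mono)
    then show ?thesis using m by (simp add: A(1) field_simps)
  qed
  then have "kantorovich (dist_l1 blk) (\<mu> \<bind> transition_kernel M X t) (\<nu> \<bind> transition_kernel M X t)
     \<le> ennreal A * kantorovich F (\<mu> \<bind> transition_kernel M X t) (\<nu> \<bind> transition_kernel M X t)"
    by (intro kantorovich_mono A) auto
  also have "\<dots> \<le> ennreal A * (ennreal (exp (- c * t)) * kantorovich F \<mu> \<nu>)"
    by (intro mult_left_mono contraction_F assms) simp
  also have "kantorovich F \<mu> \<nu> \<le> ennreal 1 * kantorovich (dist_l1 blk) \<mu> \<nu>"
    by (rule kantorovich_mono[OF _ _ l1_meas]) (use F_le in \<open>auto simp: dist_l1_def\<close>)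
  finally show ?thesis using A(2) by (simp add: ennreal_mult[OF less_imp_le[OF A(2)]] mult.assoc mult_left_mono)
qed

end

theorem theorem7:
  fixes M :: "'w measure"
    and blk :: "'m::finite \<Rightarrow> 'n::finite"
    and b b0 \<gamma> :: "'n \<Rightarrow> real ^ 'm \<Rightarrow> real ^ 'm"
    and B :: "'n \<Rightarrow> real \<Rightarrow> 'w \<Rightarrow> real ^ 'm"
    and X :: "real ^ 'm \<Rightarrow> real \<Rightarrow> 'w \<Rightarrow> real ^ 'm"
    and \<kappa> f :: "'n \<Rightarrow> real \<Rightarrow> real"
    and w \<epsilon> :: "'n \<Rightarrow> real"
    and c A t :: real
    and \<mu> \<nu> :: "(real ^ 'm) measure"
  assumes "surj blk"
    and "\<And>i. b0 i \<in> block_space blk i \<rightarrow> block_space blk i"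
    and "\<And>i. \<gamma> i \<in> UNIV \<rightarrow> block_space blk i"
    and "\<And>i x. b i x = b0 i (block blk i x) + \<gamma> i x"
    and "\<And>i. locally_lipschitz_on UNIV (b i)"
    and "\<And>i. locally_lipschitz_on (block_space blk i) (b0 i)"
    and "prob_space M"
    and "\<And>i. brownian_motion_in M (blk -` {i}) (B i)"
    and "indep_processes M B UNIV"
    and "\<And>x. strong_solution M blk b B x (X x)"
    and "\<And>i r. r > 0 \<Longrightarrow> kappa (block_space blk i) (b0 i) r = ereal (\<kappa> i r)"
    and "\<And>i. continuous_on {0<..} (\<kappa> i)"
    and "\<And>i. Liminf at_top (\<lambda>r. ereal (\<kappa> i r)) > 0"
    and "\<And>i. ((\<lambda>r. r * \<kappa> i r) \<longlongrightarrow> 0) (at_right 0)"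
    and "\<And>i. f i = ffun (\<kappa> i)"
    and "\<And>i. 0 < w i \<and> w i \<le> 1"
    and "\<And>i. 0 \<le> \<epsilon> i \<and> \<epsilon> i < rate (\<kappa> i)"
    and "\<And>x y. (\<Sum>i\<in>UNIV. norm (\<gamma> i x - \<gamma> i y) * w i)
            \<le> (\<Sum>i\<in>UNIV. \<epsilon> i * f i (norm (block blk i x - block blk i y)) * w i)"
    and "c = Min (range (\<lambda>i. rate (\<kappa> i) - \<epsilon> i))"
    and "A = 2 / Min (range (\<lambda>i. phi (\<kappa> i) (R0 (\<kappa> i)) * w i))"
    and "t \<ge> 0"
    and "prob_space \<mu>" and "sets \<mu> = sets borel"
    and "prob_space \<nu>" and "sets \<nu> = sets borel"
  shows "kantorovich (dist_fw blk f w) (\<mu> \<bind> transition_kernel M X t) (\<nu> \<bind> transition_kernel M X t)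
           \<le> ennreal (exp (- c * t)) * kantorovich (dist_fw blk f w) \<mu> \<nu>
       \<and> kantorovich (dist_l1 blk) (\<mu> \<bind> transition_kernel M X t) (\<nu> \<bind> transition_kernel M X t)
           \<le> ennreal (A * exp (- c * t)) * kantorovich (dist_l1 blk) \<mu> \<nu>"
proof -
  have f: "f = (\<lambda>i. ffun (\<kappa> i))" using assms(15) by auto
  have profile: "contraction_profile (\<kappa> i)" for i
    by (rule contraction_profile.intro[OF assms(12-14)])
  have drift: "weakly_coupled_drift blk b b0 \<gamma> \<kappa> w \<epsilon>"
    by (rule weakly_coupled_drift.intro[OF assms(2-5) assms(11) profile assms(16,17) assms(18)[unfolded f]])
  have noise: "block_brownian_motion M blk B"
    by (rule block_brownian_motion.intro[OF assms(7) block_brownian_motion_axioms.intro[OF assms(1,8,9)]])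
  interpret D: coupled_diffusion blk b b0 \<gamma> \<kappa> w \<epsilon> M B X
    by (rule coupled_diffusion.intro[OF drift noise coupled_diffusion_axioms.intro[OF assms(10)]])
  have F: "D.F = dist_fw blk f w" by (intro ext) (simp add: D.F_def dist_fw_def f)
  show ?thesis
    using D.contraction_F[OF assms(21) assms(23) assms(25)] D.contraction_l1[OF assms(21) assms(23) assms(25)]
    unfolding F D.c_def assms(19) assms(20) by blast
qed

end
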